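(* Let $(a_1,b_1)$ and $(a_2,b_2)$ be bi-free, bi-partite, self-adjoint two-faced pairs in a $C^*$-noncommutative probability space, with none of $a_1,b_1,a_2,b_2$ being a multiple of the identity. Let $\eta_j$ be the distribution of $(a_j,b_j)$ and $\mu_j$ and $\nu_j$ its first and second marginal, respectively, $j=1,2$. Assume that there exist sequences $\{z_n\}_{n\in\mathbb N},\{w_n\}_{n\in\mathbb N}\subset\mathbb C^+$ such that $$\lim_{n\to\infty}\sqrt{\Im z_n\,\Im w_n}\,|G_{\eta_1\boxplus\boxplus\eta_2}(z_n,w_n)|=+\infty.$$ Then at least one of the two marginals of $\eta_1\boxplus\boxplus\eta_2$ has an unbounded Cauchy transform. In particular, there exists a pair $\alpha,\beta\in\mathbb R$ such that either $\mu_1(\{\alpha\})+\mu_2(\{\beta\})\ge1$ or $\nu_1(\{\alpha\})+\nu_2(\{\beta\})\ge1$.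
   Context: A $C^*$-noncommutative probability space $(\mathcal A,\varphi)$ is a unital $C^*$-algebra with a faithful state. A two-faced pair $(a,b)\in\mathcal A^2$ is self-adjoint if $a=a^*,b=b^*$, and bi-partite if $ab=ba$. $\mathbb C^+$ is the open upper half-plane. Bi-freeness: given vector spaces with state vectors $\mathcal X_j=\mathbb C\xi_j\oplus\mathcal X_j^\circ$, $j=1,2$, their free product is $\mathcal X=\mathbb C\xi\oplus\bigoplus_{n\ge1}\bigoplus_{i_1\ne i_2\ne\cdots\ne i_n}\mathcal X^\circ_{i_1}\otimes\cdots\otimes\mathcal X^\circ_{i_n}$. Let $\mathcal X(\ell,j)$ (resp. $\mathcal X(r,j)$) be the sum of $\mathbb C\xi$ and the summands with $i_1\ne j$ (resp. $i_n\neq j$), with natural isomorphisms $V_j:\mathcal X_j\otimes\mathcal X(\ell,j)\to\mathcal X$ and $W_j:\mathcal X(r,j)\otimes\mathcal X_j\to\mathcal X$, and $\lambda_j(T)=V_j(T\otimes I)V_j^{-1}$, $\rho_j(T)=W_j(I\otimes T)W_j^{-1}$ for linear $T$ on $\mathcal X_j$. Let $\varphi_\xi(T)$ be the $\xi$-coefficient of $T\xi$. Pairs $(a_1,b_1),(a_2,b_2)$ are bi-free with respect to $\varphi$ if there exist such $\mathcal X_1,\mathcal X_2$ and linear operators $T_j,S_j$ on $\mathcal X_j$ such that the joint moments of $a_1,a_2,b_1,b_2$ under $\varphi$ equal those of $\lambda_1(T_1),\lambda_2(T_2),\rho_1(S_1),\rho_2(S_2)$ under $\varphi_\xi$. The distribution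 $\eta_j$ is the compactly supported probability measure on $\mathbb R^2$ with $\varphi(a_j^mb_j^n)=\int t^ms^n\,d\eta_j(t,s)$ for all $m,n\ge0$. $\eta_1\boxplus\boxplus\eta_2$ (bi-free additive convolution) is the distribution of the commuting self-adjoint pair $(a_1+a_2,b_1+b_2)$; its marginals are the free additive convolutions $\mu_1\boxplus\mu_2$ and $\nu_1\boxplus\nu_2$. Cauchy transforms: $G_\mu(z)=\int_{\mathbb R}\frac{d\mu(t)}{z-t}$ for a probability measure $\mu$ on $\mathbb R$ (unboundedness refers to $z\in\mathbb C^+$), and $G_\eta(z,w)=\int_{\mathbb R^2}\frac{d\eta(t,s)}{(z-t)(w-s)}$ for a probability measure $\eta$ on $\mathbb R^2$. *)

theory Defs
  imports "HOL-Probability.Probability" "HOL-Library.Poly_Mapping"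
begin

section \<open>Complex vector spaces and unital C*-algebras\<close>

class complex_vector = ab_group_add +
  fixes scaleC :: "complex \<Rightarrow> 'a \<Rightarrow> 'a"  (infixr \<open>*\<^sub>C\<close> 75)
  assumes scaleC_add_right: "c *\<^sub>C (x + y) = c *\<^sub>C x + c *\<^sub>C y"
    and scaleC_add_left: "(c + d) *\<^sub>C x = c *\<^sub>C x + d *\<^sub>C x"
    and scaleC_scaleC: "c *\<^sub>C d *\<^sub>C x = (c * d) *\<^sub>C x"
    and scaleC_one: "1 *\<^sub>C x = x"

global_interpretation complex_vec: vector_space "scaleC :: complex \<Rightarrow> 'a \<Rightarrow> 'a::complex_vector"
  by unfold_locales
    (simp_all add: scaleC_add_right scaleC_add_left scaleC_scaleC scaleC_one)

abbreviation clinear :: "('a::complex_vector \<Rightarrow> 'b::complex_vector) \<Rightarrow> bool" where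
  "clinear \<equiv> Vector_Spaces.linear (*\<^sub>C) (*\<^sub>C)"

class cstar_algebra = real_normed_algebra_1 + banach + complex_vector +
  fixes adj :: "'a \<Rightarrow> 'a"  (\<open>(_\<^sup>\<star>)\<close> [1000] 1000)
  assumes scaleC_of_real: "complex_of_real r *\<^sub>C x = r *\<^sub>R x"
    and scaleC_mult_left: "(c *\<^sub>C x) * y = c *\<^sub>C (x * y)"
    and scaleC_mult_right: "x * (c *\<^sub>C y) = c *\<^sub>C (x * y)"
    and norm_scaleC: "norm (c *\<^sub>C x) = cmod c * norm x"
    and adj_adj: "x\<^sup>\<star>\<^sup>\<star> = x"
    and adj_add: "(x + y)\<^sup>\<star> = x\<^sup>\<star> + y\<^sup>\<star>"
    and adj_scaleC: "(c *\<^sub>C x)\<^sup>\<star> = cnj c *\<^sub>C x\<^sup>\<star>"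
    and adj_mult: "(x * y)\<^sup>\<star> = y\<^sup>\<star> * x\<^sup>\<star>"
    and cstar_identity: "norm (x\<^sup>\<star> * x) = (norm x)\<^sup>2"

definition faithful_state :: "('a::cstar_algebra \<Rightarrow> complex) \<Rightarrow> bool" where
  "faithful_state \<phi> \<longleftrightarrow>
     Vector_Spaces.linear (*\<^sub>C) (*) \<phi> \<and> \<phi> 1 = 1 \<and>
     (\<forall>x. \<phi> (x\<^sup>\<star> * x) \<in> \<real>\<^sub>\<ge>\<^sub>0) \<and>
     (\<forall>x. \<phi> (x\<^sup>\<star> * x) = 0 \<longrightarrow> x = 0)"

definition selfadjoint_pair :: "'a::cstar_algebra \<times> 'a \<Rightarrow> bool" where
  "selfadjoint_pair p \<longleftrightarrow> (fst p)\<^sup>\<star> = fst p \<and> (snd p)\<^sup>\<star> = snd p"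

definition bipartite_pair :: "'a::cstar_algebra \<times> 'a \<Rightarrow> bool" where
  "bipartite_pair p \<longleftrightarrow> fst p * snd p = snd p * fst p"


section \<open>Vector spaces with a specified state vector\<close>

text \<open>A space of this class is \<open>\<complex>\<xi> \<oplus> X\<degree>\<close>, where \<open>\<xi>\<close> is \<^term>\<open>state_vec\<close> and
  \<open>X\<degree>\<close> is the subspace \<^term>\<open>centered\<close>; uniqueness of the decomposition forces \<open>\<xi> \<noteq> 0\<close>.\<close>

class state_space = complex_vector +
  fixes state_vec :: 'a and centered :: "'a set"
  assumes centered_zero: "0 \<in> centered"
    and centered_add: "x \<in> centered \<Longrightarrow> y \<in> centered \<Longrightarrow> x + y \<in> centered"
    and centered_scaleC: "x \<in> centered \<Longrightarrow> c *\<^sub>C x \<in> centered"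
    and state_decomposition: "\<exists>!(c, y). y \<in> centered \<and> x = c *\<^sub>C state_vec + y"

definition state_coeff :: "'a::state_space \<Rightarrow> complex" where
  "state_coeff x = (THE c. \<exists>y\<in>centered. x = c *\<^sub>C state_vec + y)"

definition center_part :: "'a::state_space \<Rightarrow> 'a" where
  "center_part x = x - state_coeff x *\<^sub>C state_vec"

lemma state_decomposition_unique:
  assumes "y \<in> centered" "x = c *\<^sub>C state_vec + y"
    and "y' \<in> centered" "x = d *\<^sub>C state_vec + y'"
  shows "d = c"
proof -
  obtain p where p: "\<And>q. (case q of (c, y) \<Rightarrow> y \<in> centered \<and> x = c *\<^sub>C state_vec + y) \<Longrightarrow> q = p"
    using state_decomposition[of x] by (elim ex1E) blast
  have "(c, y) = p" by (rule p) (use assms(1,2) in simp)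
  moreover have "(d, y') = p" by (rule p) (use assms(3,4) in simp)
  ultimately show ?thesis by auto
qed

lemma state_coeff_unique:
  assumes "y \<in> centered" "x = c *\<^sub>C state_vec + y"
  shows "state_coeff x = c"
  unfolding state_coeff_def
proof (rule the_equality)
  show "\<exists>y\<in>centered. x = c *\<^sub>C state_vec + y" using assms by (rule bexI[rotated])
next
  fix d assume "\<exists>y\<in>centered. x = d *\<^sub>C state_vec + y"
  then obtain y' where "y' \<in> centered" "x = d *\<^sub>C state_vec + y'" by (rule bexE)
  then show "d = c" by (rule state_decomposition_unique[OF assms])
qed

lemma center_part_centered [simp]: "center_part x \<in> centered"
proof -
  obtain c y where y: "y \<in> centered" and x: "x = c *\<^sub>C state_vec + y"
    using ex1_implies_ex[OF state_decomposition[of x]] by auto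
  have "state_coeff x = c" using y x by (rule state_coeff_unique)
  then have "center_part x = y" unfolding center_part_def using x by (metis add_diff_cancel_left')
  then show ?thesis using y by simp
qed

lemma state_split: "x = state_coeff x *\<^sub>C state_vec + center_part x"
  by (simp add: center_part_def)

lemma state_coeff_lincomb: "state_coeff (x + c *\<^sub>C y) = state_coeff x + c * state_coeff y"
proof (rule state_coeff_unique)
  show "center_part x + c *\<^sub>C center_part y \<in> centered"
    by (simp add: centered_add centered_scaleC)
  show "x + c *\<^sub>C y = (state_coeff x + c * state_coeff y) *\<^sub>C state_vec
      + (center_part x + c *\<^sub>C center_part y)"
    by (simp add: center_part_def algebra_simps scaleC_add_right scaleC_add_left scaleC_scaleC)
qed

lemma center_part_lincomb: "center_part (x + c *\<^sub>C y) = center_part x + c *\<^sub>C center_part y"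
  by (simp add: center_part_def state_coeff_lincomb algebra_simps scaleC_add_left scaleC_scaleC)

lemma state_coeff_centered [simp]: "x \<in> centered \<Longrightarrow> state_coeff x = 0"
  by (rule state_coeff_unique[of x]) auto

lemma center_part_of_centered [simp]: "x \<in> centered \<Longrightarrow> center_part x = x"
  by (simp add: center_part_def)

lemma state_coeff_state_vec [simp]: "state_coeff state_vec = 1"
  by (rule state_coeff_unique[of 0]) (auto simp: centered_zero)

lemma center_part_state_vec [simp]: "center_part state_vec = 0"
  by (simp add: center_part_def)


section \<open>The free product of two vector spaces with state vectors\<close>

text \<open>Letters \<open>Inl x\<close> and \<open>Inr y\<close> are vectors of the first and the second space.  A reduced word
  \<open>[x\<^sub>1, \<dots>, x\<^sub>n]\<close> has centered letters taken alternately from the two spaces; it stands for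
  the elementary tensor \<open>x\<^sub>1 \<otimes> \<dots> \<otimes> x\<^sub>n\<close>, and the empty word for \<open>\<xi>\<close>.  The free product is the
  space of formal linear combinations of reduced words modulo multilinearity, that is, the direct
  sum of \<open>\<complex>\<xi>\<close> and of the alternating algebraic tensor products.\<close>

definition reduced_words :: "('x::state_space + 'y::state_space) list set" where
  "reduced_words =
     {w. successively (\<lambda>p q. isl p \<noteq> isl q) w \<and>
         (\<forall>x. Inl x \<in> set w \<longrightarrow> x \<in> centered) \<and> (\<forall>y. Inr y \<in> set w \<longrightarrow> y \<in> centered)}"

definition scale_formal :: "complex \<Rightarrow> ('w \<Rightarrow>\<^sub>0 complex) \<Rightarrow> ('w \<Rightarrow>\<^sub>0 complex)" where
  "scale_formal c f = Poly_Mapping.map ((*) c) f"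

lemma lookup_scale_formal [simp]: "Poly_Mapping.lookup (scale_formal c f) w = c * Poly_Mapping.lookup f w"
  by (simp add: scale_formal_def Poly_Mapping.map.rep_eq when_def)

global_interpretation formal: vector_space "scale_formal :: complex \<Rightarrow> ('w \<Rightarrow>\<^sub>0 complex) \<Rightarrow> _"
  by unfold_locales (auto intro!: poly_mapping_eqI simp: lookup_add algebra_simps)

definition tensor_relators :: "(('x::state_space + 'y::state_space) list \<Rightarrow>\<^sub>0 complex) set" where
  "tensor_relators =
     {Poly_Mapping.single (u @ Inl (x + c *\<^sub>C x') # v) 1
        - Poly_Mapping.single (u @ Inl x # v) 1 - Poly_Mapping.single (u @ Inl x' # v) c
      | u v x x' c. u @ Inl x # v \<in> reduced_words \<and> u @ Inl x' # v \<in> reduced_words} \<union>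
     {Poly_Mapping.single (u @ Inr (y + c *\<^sub>C y') # v) 1
        - Poly_Mapping.single (u @ Inr y # v) 1 - Poly_Mapping.single (u @ Inr y' # v) c
      | u v y y' c. u @ Inr y # v \<in> reduced_words \<and> u @ Inr y' # v \<in> reduced_words}"

definition tensor_rel ::
  "(('x::state_space + 'y::state_space) list \<Rightarrow>\<^sub>0 complex) \<Rightarrow> (('x + 'y) list \<Rightarrow>\<^sub>0 complex) \<Rightarrow> bool"
  where
  "tensor_rel f g \<longleftrightarrow> Poly_Mapping.keys f \<subseteq> reduced_words \<and> Poly_Mapping.keys g \<subseteq> reduced_words \<and>
     f - g \<in> formal.span tensor_relators"

lemma keys_plus_subset:
  "Poly_Mapping.keys f \<subseteq> S \<Longrightarrow> Poly_Mapping.keys g \<subseteq> S \<Longrightarrow> Poly_Mapping.keys (f + g) \<subseteq> S"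
  using keys_add[of f g] by (meson Un_least subset_trans)

lemma keys_uminus_subset: "Poly_Mapping.keys f \<subseteq> S \<Longrightarrow> Poly_Mapping.keys (- f) \<subseteq> S"
  for f :: "'w \<Rightarrow>\<^sub>0 complex"
  by (simp add: subset_iff in_keys_iff)

lemma keys_minus_subset:
  "Poly_Mapping.keys f \<subseteq> S \<Longrightarrow> Poly_Mapping.keys g \<subseteq> S \<Longrightarrow> Poly_Mapping.keys (f - g) \<subseteq> S"
  for f :: "'w \<Rightarrow>\<^sub>0 complex"
  using keys_plus_subset[OF _ keys_uminus_subset, of f S g] by simp

lemma keys_scale_formal_subset:
  "Poly_Mapping.keys f \<subseteq> S \<Longrightarrow> Poly_Mapping.keys (scale_formal c f) \<subseteq> S"
  by (simp add: subset_iff in_keys_iff)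

lemma tensor_rel_refl: "Poly_Mapping.keys f \<subseteq> reduced_words \<Longrightarrow> tensor_rel f f"
  by (simp add: tensor_rel_def formal.span_zero)

lemma tensor_rel_keys:
  "tensor_rel f g \<Longrightarrow> Poly_Mapping.keys f \<subseteq> reduced_words"
  "tensor_rel f g \<Longrightarrow> Poly_Mapping.keys g \<subseteq> reduced_words"
  by (simp_all add: tensor_rel_def)

lemma tensor_rel_sym: "tensor_rel f g \<Longrightarrow> tensor_rel g f"
  using formal.span_neg[of "f - g" tensor_relators] by (simp add: tensor_rel_def)

lemma tensor_rel_trans: "tensor_rel f g \<Longrightarrow> tensor_rel g h \<Longrightarrow> tensor_rel f h"
  using formal.span_add[of "f - g" tensor_relators "g - h"] by (simp add: tensor_rel_def)

lemma tensor_rel_add: "tensor_rel f f' \<Longrightarrow> tensor_rel g g' \<Longrightarrow> tensor_rel (f + g) (f' + g')"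
  using formal.span_add[of "f - f'" tensor_relators "g - g'"]
  by (simp add: tensor_rel_def keys_plus_subset add_diff_add)

lemma tensor_rel_uminus: "tensor_rel f f' \<Longrightarrow> tensor_rel (- f) (- f')"
  using formal.span_neg[of "f - f'" tensor_relators]
  by (simp add: tensor_rel_def keys_uminus_subset)

lemma tensor_rel_scale: "tensor_rel f f' \<Longrightarrow> tensor_rel (scale_formal c f) (scale_formal c f')"
  using formal.span_scale[of "f - f'" tensor_relators c]
  by (simp add: tensor_rel_def keys_scale_formal_subset formal.scale_right_diff_distrib)

quotient_type (overloaded) ('x, 'y) free_product =
  "('x::state_space + 'y::state_space) list \<Rightarrow>\<^sub>0 complex" / partial: tensor_rel
proof (rule part_equivpI)
  show "\<exists>f. tensor_rel f f"
    by (rule exI[of _ 0]) (simp add: tensor_rel_refl)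
  show "symp tensor_rel"
    by (rule sympI) (rule tensor_rel_sym)
  show "transp tensor_rel"
    by (rule transpI) (rule tensor_rel_trans)
qed

instantiation free_product :: (state_space, state_space) complex_vector
begin

lift_definition zero_free_product :: "('a, 'b) free_product" is 0
  by (simp add: tensor_rel_refl)

lift_definition plus_free_product ::
  "('a, 'b) free_product \<Rightarrow> ('a, 'b) free_product \<Rightarrow> ('a, 'b) free_product" is "(+)"
  by (rule tensor_rel_add)

lift_definition uminus_free_product ::
  "('a, 'b) free_product \<Rightarrow> ('a, 'b) free_product" is uminus
  by (rule tensor_rel_uminus)

definition minus_free_product ::
  "('a, 'b) free_product \<Rightarrow> ('a, 'b) free_product \<Rightarrow> ('a, 'b) free_product" where
  "minus_free_product p q = p + - q"

lift_definition scaleC_free_product ::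
  "complex \<Rightarrow> ('a, 'b) free_product \<Rightarrow> ('a, 'b) free_product" is scale_formal
  by (rule tensor_rel_scale)

instance
proof
  fix p q r :: "('a, 'b) free_product" and c d :: complex
  note kk = tensor_rel_refl keys_plus_subset keys_scale_formal_subset keys_uminus_subset
    tensor_rel_keys(1)
  show "p + q + r = p + (q + r)"
    by transfer (simp add: add.assoc kk)
  show "p + q = q + p"
    by transfer (simp add: add.commute kk)
  show "0 + p = p"
    by transfer simp
  show "- p + p = 0"
    by transfer (simp add: kk)
  show "p - q = p + - q"
    by (simp add: minus_free_product_def)
  show "c *\<^sub>C (p + q) = c *\<^sub>C p + c *\<^sub>C q"
    by transfer (simp add: formal.scale_right_distrib kk)
  show "(c + d) *\<^sub>C p = c *\<^sub>C p + d *\<^sub>C p"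
    by transfer (simp add: formal.scale_left_distrib kk)
  show "c *\<^sub>C d *\<^sub>C p = (c * d) *\<^sub>C p"
    by transfer (simp add: kk)
  show "1 *\<^sub>C p = p"
    by transfer simp
qed

end

definition elem_tensor ::
  "('x::state_space + 'y::state_space) list \<Rightarrow> ('x, 'y) free_product" where
  "elem_tensor w = abs_free_product (Poly_Mapping.single w 1)"

lift_definition vacuum_coeff :: "('x::state_space, 'y::state_space) free_product \<Rightarrow> complex"
  is "\<lambda>f. Poly_Mapping.lookup f []"
proof -
  fix f g :: "('x + 'y) list \<Rightarrow>\<^sub>0 complex"
  assume "tensor_rel f g"
  then have "f - g \<in> formal.span tensor_relators" by (simp add: tensor_rel_def)
  then have "Poly_Mapping.lookup (f - g) [] = 0"
    by (induction rule: formal.span_induct_alt)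
      (auto simp: tensor_relators_def lookup_add lookup_minus lookup_single)
  then show "Poly_Mapping.lookup f [] = Poly_Mapping.lookup g []" by (simp add: lookup_minus)
qed

lemma free_product_sum_elem_tensors:
  fixes f :: "('x::state_space + 'y::state_space) list \<Rightarrow>\<^sub>0 complex"
  assumes "Poly_Mapping.keys f \<subseteq> reduced_words"
  shows "abs_free_product f = (\<Sum>w\<in>Poly_Mapping.keys f. Poly_Mapping.lookup f w *\<^sub>C elem_tensor w)"
proof -
  have abs_sum: "abs_free_product (\<Sum>w\<in>A. scale_formal (c w) (Poly_Mapping.single w 1))
      = (\<Sum>w\<in>A. c w *\<^sub>C elem_tensor w)
      \<and> Poly_Mapping.keys (\<Sum>w\<in>A. scale_formal (c w) (Poly_Mapping.single w 1)) \<subseteq> reduced_words"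
    if "finite A" "A \<subseteq> reduced_words" for A and c :: "('x + 'y) list \<Rightarrow> complex"
    using that
  proof (induction A rule: finite_induct)
    case empty
    then show ?case by (simp add: zero_free_product_def)
  next
    case (insert w A)
    have k: "Poly_Mapping.keys (Poly_Mapping.single w (1::complex)) \<subseteq> reduced_words"
      using insert.prems by simp
    then have k': "Poly_Mapping.keys (scale_formal (c w) (Poly_Mapping.single w 1)) \<subseteq> reduced_words"
      by (rule keys_scale_formal_subset)
    have e: "abs_free_product (scale_formal (c w) (Poly_Mapping.single w 1)) = c w *\<^sub>C elem_tensor w"
      unfolding elem_tensor_def by (rule scaleC_free_product.abs_eq[symmetric, OF tensor_rel_refl[OF k]])
    have IH: "abs_free_product (\<Sum>w\<in>A. scale_formal (c w) (Poly_Mapping.single w 1))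
        = (\<Sum>w\<in>A. c w *\<^sub>C elem_tensor w)"
      "Poly_Mapping.keys (\<Sum>w\<in>A. scale_formal (c w) (Poly_Mapping.single w 1)) \<subseteq> reduced_words"
      using insert by auto
    show ?case
      unfolding sum.insert[OF insert.hyps] IH(1)[symmetric] e[symmetric]
      by (intro conjI keys_plus_subset k' IH(2)
          plus_free_product.abs_eq[symmetric, OF tensor_rel_refl[OF k'] tensor_rel_refl[OF IH(2)]])
  qed
  have "f = (\<Sum>w\<in>Poly_Mapping.keys f. scale_formal (Poly_Mapping.lookup f w) (Poly_Mapping.single w 1))"
    by (rule poly_mapping_eqI)
      (auto simp: lookup_sum lookup_single when_def in_keys_iff if_distrib cong: if_cong)
  then have "abs_free_product f = abs_free_product
      (\<Sum>w\<in>Poly_Mapping.keys f. scale_formal (Poly_Mapping.lookup f w) (Poly_Mapping.single w 1))"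
    by (rule arg_cong)
  also have "\<dots> = (\<Sum>w\<in>Poly_Mapping.keys f. Poly_Mapping.lookup f w *\<^sub>C elem_tensor w)"
    using abs_sum[OF finite_keys assms] by (rule conjunct1)
  finally show ?thesis .
qed

lemma clinear_eq_on_elem_tensors:
  fixes L M :: "('x::state_space, 'y::state_space) free_product \<Rightarrow> 'z::complex_vector"
  assumes "clinear L" "clinear M" "\<And>w. w \<in> reduced_words \<Longrightarrow> L (elem_tensor w) = M (elem_tensor w)"
  shows "L = M"
proof
  fix q :: "('x, 'y) free_product"
  interpret L: Vector_Spaces.linear "(*\<^sub>C)" "(*\<^sub>C)" L by fact
  interpret M: Vector_Spaces.linear "(*\<^sub>C)" "(*\<^sub>C)" M by fact
  define f where "f = rep_free_product q"
  have q: "q = abs_free_product f"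
    unfolding f_def by (rule Quotient_abs_rep[OF Quotient_free_product, symmetric])
  have "tensor_rel f f"
    unfolding f_def by (rule Quotient_rep_reflp[OF Quotient_free_product])
  then have k: "Poly_Mapping.keys f \<subseteq> reduced_words" by (rule tensor_rel_keys)
  show "L q = M q"
    unfolding q free_product_sum_elem_tensors[OF k] L.sum M.sum L.scale M.scale
    by (rule sum.cong) (use k assms(3) in auto)
qed

definition word_multilinear ::
  "(('x::state_space + 'y::state_space) list \<Rightarrow> 'z::complex_vector) \<Rightarrow> bool" where
  "word_multilinear g \<longleftrightarrow>
     (\<forall>u v x x' c. u @ Inl x # v \<in> reduced_words \<longrightarrow> u @ Inl x' # v \<in> reduced_words \<longrightarrow>
        g (u @ Inl (x + c *\<^sub>C x') # v) = g (u @ Inl x # v) + c *\<^sub>C g (u @ Inl x' # v)) \<and>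
     (\<forall>u v y y' c. u @ Inr y # v \<in> reduced_words \<longrightarrow> u @ Inr y' # v \<in> reduced_words \<longrightarrow>
        g (u @ Inr (y + c *\<^sub>C y') # v) = g (u @ Inr y # v) + c *\<^sub>C g (u @ Inr y' # v))"

lemma reduced_words_lincomb:
  "u @ Inl x # v \<in> reduced_words \<Longrightarrow> u @ Inl x' # v \<in> reduced_words
     \<Longrightarrow> u @ Inl (x + c *\<^sub>C x') # v \<in> reduced_words"
  "u @ Inr y # v \<in> reduced_words \<Longrightarrow> u @ Inr y' # v \<in> reduced_words
     \<Longrightarrow> u @ Inr (y + c *\<^sub>C y') # v \<in> reduced_words"
  by (auto simp: reduced_words_def successively_append_iff successively_Cons
      centered_add centered_scaleC)

lemma elem_tensor_lincomb_aux:
  fixes w w' w'' :: "('a::state_space + 'b::state_space) list"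
  assumes "w \<in> reduced_words" "w' \<in> reduced_words" "w'' \<in> reduced_words"
    and "Poly_Mapping.single w 1 - Poly_Mapping.single w' 1 - Poly_Mapping.single w'' c
           \<in> tensor_relators"
  shows "elem_tensor w = elem_tensor w' + c *\<^sub>C elem_tensor w''"
proof -
  have k: "tensor_rel (Poly_Mapping.single v (1::complex)) (Poly_Mapping.single v 1)"
    if "v \<in> reduced_words" for v :: "('a + 'b) list"
    using that by (intro tensor_rel_refl) simp
  have s: "scale_formal c (Poly_Mapping.single w'' 1) = Poly_Mapping.single w'' c"
    by (rule poly_mapping_eqI) (simp add: lookup_single when_def)
  have "elem_tensor w' + c *\<^sub>C elem_tensor w''
      = abs_free_product (Poly_Mapping.single w' 1 + scale_formal c (Poly_Mapping.single w'' 1))"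
    unfolding elem_tensor_def scaleC_free_product.abs_eq[OF k[OF assms(3)]]
    by (rule plus_free_product.abs_eq[OF k[OF assms(2)] tensor_rel_scale[OF k[OF assms(3)]]])
  also have "\<dots> = elem_tensor w"
    unfolding elem_tensor_def s
  proof (rule Quotient_rel_abs[OF Quotient_free_product, symmetric])
    show "tensor_rel (Poly_Mapping.single w 1) (Poly_Mapping.single w' 1 + Poly_Mapping.single w'' c)"
      unfolding tensor_rel_def
    proof (intro conjI keys_plus_subset)
      show "Poly_Mapping.single w 1 - (Poly_Mapping.single w' 1 + Poly_Mapping.single w'' c)
          \<in> formal.span tensor_relators"
        using formal.span_base[OF assms(4)] by (simp only: diff_diff_eq)
    qed (use assms(1-3) in simp_all)
  qed
  finally show ?thesis by simp
qed

lemma tensor_relatorI: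
  "u @ Inl x # v \<in> reduced_words \<Longrightarrow> u @ Inl x' # v \<in> reduced_words \<Longrightarrow>
     Poly_Mapping.single (u @ Inl (x + c *\<^sub>C x') # v) 1 - Poly_Mapping.single (u @ Inl x # v) 1
       - Poly_Mapping.single (u @ Inl x' # v) c \<in> tensor_relators"
  "u @ Inr y # v \<in> reduced_words \<Longrightarrow> u @ Inr y' # v \<in> reduced_words \<Longrightarrow>
     Poly_Mapping.single (u @ Inr (y + c *\<^sub>C y') # v) 1 - Poly_Mapping.single (u @ Inr y # v) 1
       - Poly_Mapping.single (u @ Inr y' # v) c \<in> tensor_relators"
  unfolding tensor_relators_def by blast+

lemma elem_tensor_multilinear: "word_multilinear elem_tensor"
  unfolding word_multilinear_def
proof (intro conjI allI impI)
  show "elem_tensor (u @ Inl (x + c *\<^sub>C x') # v)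
      = elem_tensor (u @ Inl x # v) + c *\<^sub>C elem_tensor (u @ Inl x' # v)"
    if "u @ Inl x # v \<in> reduced_words" "u @ Inl x' # v \<in> reduced_words"
    for u v and x x' :: 'a and c
    using that by (intro elem_tensor_lincomb_aux reduced_words_lincomb tensor_relatorI)
  show "elem_tensor (u @ Inr (x + c *\<^sub>C x') # v)
      = elem_tensor (u @ Inr x # v) + c *\<^sub>C elem_tensor (u @ Inr x' # v)"
    if "u @ Inr x # v \<in> reduced_words" "u @ Inr x' # v \<in> reduced_words"
    for u v and x x' :: 'b and c
    using that by (intro elem_tensor_lincomb_aux reduced_words_lincomb tensor_relatorI)
qed

lemma free_product_lift:
  fixes g :: "('x::state_space + 'y::state_space) list \<Rightarrow> 'z::complex_vector"
  assumes g: "word_multilinear g"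
  shows "\<exists>L. clinear L \<and> (\<forall>w\<in>reduced_words. L (elem_tensor w) = g w)"
proof -
  define E where "E f = (\<Sum>w\<in>Poly_Mapping.keys f. Poly_Mapping.lookup f w *\<^sub>C g w)" for f
  have E_super: "E f = (\<Sum>w\<in>A. Poly_Mapping.lookup f w *\<^sub>C g w)"
    if "finite A" "Poly_Mapping.keys f \<subseteq> A" for f A
    unfolding E_def by (rule sum.mono_neutral_left) (use that in \<open>auto simp: in_keys_iff\<close>)
  have E_add: "E (f + h) = E f + E h" for f h
  proof -
    let ?A = "Poly_Mapping.keys f \<union> Poly_Mapping.keys h"
    have "E (f + h) = (\<Sum>w\<in>?A. Poly_Mapping.lookup (f + h) w *\<^sub>C g w)"
      by (rule E_super) (use keys_add[of f h] in auto)
    also have "\<dots> = (\<Sum>w\<in>?A. Poly_Mapping.lookup f w *\<^sub>C g w) + (\<Sum>w\<in>?A. Poly_Mapping.lookup h w *\<^sub>C g w)"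
      by (simp add: lookup_add scaleC_add_left sum.distrib)
    also have "\<dots> = E f + E h"
      by (subst (1 2) E_super[of ?A]) auto
    finally show ?thesis .
  qed
  have E_scale: "E (scale_formal c f) = c *\<^sub>C E f" for c f
  proof -
    have "E (scale_formal c f)
        = (\<Sum>w\<in>Poly_Mapping.keys f. Poly_Mapping.lookup (scale_formal c f) w *\<^sub>C g w)"
      by (rule E_super) (auto intro: keys_scale_formal_subset[THEN subsetD])
    then show ?thesis
      unfolding E_def by (simp add: complex_vec.scale_sum_right)
  qed
  have E_single: "E (Poly_Mapping.single w c) = c *\<^sub>C g w" for w c
    using E_super[of "{w}" "Poly_Mapping.single w c"] by simp
  have E_diff: "E (f - h) = E f - E h" for f h
    using E_add[of "f - h" h] by simp
  have E_relator: "E r = 0" if "r \<in> tensor_relators" for r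
    using that g unfolding tensor_relators_def word_multilinear_def
    by (auto simp: E_diff E_single)
  have E_rel: "E f = E h" if "tensor_rel f h" for f h
  proof -
    from that have "f - h \<in> formal.span tensor_relators" by (simp add: tensor_rel_def)
    then have "E (f - h) = 0"
      by (induction rule: formal.span_induct_alt)
        (simp_all add: E_add E_scale E_relator, simp add: E_def)
    then show ?thesis by (simp add: E_diff)
  qed
  define L where "L q = E (rep_free_product q)" for q
  have L_abs: "L (abs_free_product f) = E f" if "tensor_rel f f" for f
    unfolding L_def by (rule E_rel) (rule Quotient_rep_abs[OF Quotient_free_product that])
  have abs: "\<exists>f. q = abs_free_product f \<and> tensor_rel f f" for q :: "('x, 'y) free_product"
    by (rule exI[of _ "rep_free_product q"], rule conjI,
        rule Quotient_abs_rep[OF Quotient_free_product, symmetric],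
        rule Quotient_rep_reflp[OF Quotient_free_product])
  have "clinear L"
  proof (unfold_locales)
    fix p q :: "('x, 'y) free_product" and c
    obtain f h where f: "p = abs_free_product f" "tensor_rel f f"
      and h: "q = abs_free_product h" "tensor_rel h h"
      using abs[of p] abs[of q] by (elim exE conjE)
    show "L (p + q) = L p + L q"
      unfolding f h plus_free_product.abs_eq[OF f(2) h(2)] L_abs[OF f(2)] L_abs[OF h(2)]
        L_abs[OF tensor_rel_add[OF f(2) h(2)]] by (rule E_add)
    show "L (c *\<^sub>C p) = c *\<^sub>C L p"
      unfolding f scaleC_free_product.abs_eq[OF f(2)] L_abs[OF f(2)]
        L_abs[OF tensor_rel_scale[OF f(2)]] by (rule E_scale)
  qed
  moreover have "L (elem_tensor w) = g w" if "w \<in> reduced_words" for w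
    unfolding elem_tensor_def using that by (simp add: L_abs tensor_rel_refl E_single)
  ultimately show ?thesis by blast
qed



subsection \<open>Left and right actions\<close>

text \<open>For \<open>j = 1, 2\<close> take \<open>\<iota> = Inl, Inr\<close>.  The classes of the words in \<open>left_words \<iota>\<close> and in
  \<open>right_words \<iota>\<close> span the spaces \<open>X(\<ell>,j)\<close> and \<open>X(r,j)\<close>, and \<open>left_tensor \<iota> x w\<close> and
  \<open>right_tensor \<iota> x w\<close> are the values of the isomorphisms at elementary tensors,
  \<open>V\<^sub>j (x \<otimes> w)\<close> and \<open>W\<^sub>j (w \<otimes> x)\<close>.  Elementary tensors span, so \<open>V\<^sub>j (T \<otimes> I) V\<^sub>j\<inverse>\<close> is the unique
  linear operator sending \<open>V\<^sub>j (x \<otimes> w)\<close> to \<open>V\<^sub>j (T x \<otimes> w)\<close>, and similarly on the right; existence and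
  uniqueness are proved below.\<close>

definition left_words ::
  "('z::state_space \<Rightarrow> 'x + 'y) \<Rightarrow> ('x::state_space + 'y::state_space) list set" where
  "left_words \<iota> = {w \<in> reduced_words. \<forall>x u. w \<noteq> \<iota> x # u}"

definition right_words ::
  "('z::state_space \<Rightarrow> 'x + 'y) \<Rightarrow> ('x::state_space + 'y::state_space) list set" where
  "right_words \<iota> = {w \<in> reduced_words. \<forall>x u. w \<noteq> u @ [\<iota> x]}"

definition left_tensor ::
  "('z::state_space \<Rightarrow> 'x + 'y) \<Rightarrow> 'z \<Rightarrow> ('x::state_space + 'y::state_space) list
     \<Rightarrow> ('x, 'y) free_product" where
  "left_tensor \<iota> x w = state_coeff x *\<^sub>C elem_tensor w + elem_tensor (\<iota> (center_part x) # w)"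

definition right_tensor ::
  "('z::state_space \<Rightarrow> 'x + 'y) \<Rightarrow> 'z \<Rightarrow> ('x::state_space + 'y::state_space) list
     \<Rightarrow> ('x, 'y) free_product" where
  "right_tensor \<iota> x w = state_coeff x *\<^sub>C elem_tensor w + elem_tensor (w @ [\<iota> (center_part x)])"

definition left_op ::
  "('z::state_space \<Rightarrow> 'x::state_space + 'y::state_space) \<Rightarrow> ('z \<Rightarrow> 'z)
     \<Rightarrow> ('x, 'y) free_product \<Rightarrow> ('x, 'y) free_product" where
  "left_op \<iota> T = (THE L. clinear L \<and>
     (\<forall>x. \<forall>w\<in>left_words \<iota>. L (left_tensor \<iota> x w) = left_tensor \<iota> (T x) w))"

definition right_op ::
  "('z::state_space \<Rightarrow> 'x::state_space + 'y::state_space) \<Rightarrow> ('z \<Rightarrow> 'z)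
     \<Rightarrow> ('x, 'y) free_product \<Rightarrow> ('x, 'y) free_product" where
  "right_op \<iota> T = (THE L. clinear L \<and>
     (\<forall>x. \<forall>w\<in>right_words \<iota>. L (right_tensor \<iota> x w) = right_tensor \<iota> (T x) w))"

lemma clinear_lincomb:
  assumes "clinear T"
  shows "T (x + c *\<^sub>C y) = T x + c *\<^sub>C T y"
proof -
  interpret Vector_Spaces.linear "(*\<^sub>C)" "(*\<^sub>C)" T by fact
  show ?thesis by (simp add: add scale)
qed

lemma clinear_comp: "clinear S \<Longrightarrow> clinear T \<Longrightarrow> clinear (\<lambda>x. S (T x))"
  using Vector_Spaces.linear_compose[of "(*\<^sub>C)" "(*\<^sub>C)" T "(*\<^sub>C)" S] by (simp add: o_def)

lemma word_multilinearD:
  assumes "word_multilinear g"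
  shows "u @ Inl x # v \<in> reduced_words \<Longrightarrow> u @ Inl x' # v \<in> reduced_words \<Longrightarrow>
      g (u @ Inl (x + c *\<^sub>C x') # v) = g (u @ Inl x # v) + c *\<^sub>C g (u @ Inl x' # v)"
    and "u @ Inr y # v \<in> reduced_words \<Longrightarrow> u @ Inr y' # v \<in> reduced_words \<Longrightarrow>
      g (u @ Inr (y + c *\<^sub>C y') # v) = g (u @ Inr y # v) + c *\<^sub>C g (u @ Inr y' # v)"
  using assms unfolding word_multilinear_def by blast+

lemmas elem_tensorD = word_multilinearD[OF elem_tensor_multilinear]

lemma reduced_words_Cons:
  "Inl x # w \<in> reduced_words \<longleftrightarrow> x \<in> centered \<and> w \<in> left_words Inl"
  "Inr y # w \<in> reduced_words \<longleftrightarrow> y \<in> centered \<and> w \<in> left_words Inr"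
  by (cases w; cases "hd w";
      auto simp: reduced_words_def left_words_def successively_Cons)+

lemma left_words_reduced: "w \<in> left_words \<iota> \<Longrightarrow> w \<in> reduced_words"
  by (simp add: left_words_def)

lemma reduced_words_rev:
  fixes w :: "('a::state_space + 'b::state_space) list"
  assumes "w \<in> reduced_words"
  shows "rev w \<in> reduced_words"
proof -
  have "(\<lambda>p q :: 'a + 'b. isl q \<noteq> isl p) = (\<lambda>p q. isl p \<noteq> isl q)"
    by (intro ext) (subst eq_commute, rule refl)
  then have "successively (\<lambda>p q. isl p \<noteq> isl q) (rev w)
      \<longleftrightarrow> successively (\<lambda>p q. isl p \<noteq> isl q) w"
    unfolding successively_rev by (rule arg_cong[of _ _ "\<lambda>P. successively P w"])
  then show ?thesis
    using assms unfolding reduced_words_def by (simp del: successively_rev)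
qed

lemma elem_tensor_rev_multilinear: "word_multilinear (\<lambda>w. elem_tensor (rev w))"
  unfolding word_multilinear_def
proof (intro conjI allI impI)
  show "elem_tensor (rev (u @ Inl (x + c *\<^sub>C x') # v))
      = elem_tensor (rev (u @ Inl x # v)) + c *\<^sub>C elem_tensor (rev (u @ Inl x' # v))"
    if "u @ Inl x # v \<in> reduced_words" "u @ Inl x' # v \<in> reduced_words"
    for u v and x x' :: 'a and c
    using elem_tensorD(1)[of "rev v" x "rev u" x' c] that[THEN reduced_words_rev] by simp
  show "elem_tensor (rev (u @ Inr (x + c *\<^sub>C x') # v))
      = elem_tensor (rev (u @ Inr x # v)) + c *\<^sub>C elem_tensor (rev (u @ Inr x' # v))"
    if "u @ Inr x # v \<in> reduced_words" "u @ Inr x' # v \<in> reduced_words"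
    for u v and x x' :: 'b and c
    using elem_tensorD(2)[of "rev v" x "rev u" x' c] that[THEN reduced_words_rev] by simp
qed

lemma right_words_rev: "w \<in> right_words \<iota> \<longleftrightarrow> rev w \<in> left_words \<iota>"
proof -
  have r: "w \<in> reduced_words \<longleftrightarrow> rev w \<in> reduced_words"
    using reduced_words_rev[of w] reduced_words_rev[of "rev w"] by auto
  have "w = u @ [a] \<longleftrightarrow> rev w = a # rev u" for a u
    by (metis rev_eq_Cons_iff rev_rev_ident)
  then have "(\<exists>x u. w = u @ [\<iota> x]) \<longleftrightarrow> (\<exists>x u. rev w = \<iota> x # u)"
    by (metis rev_rev_ident)
  then show ?thesis
    unfolding left_words_def right_words_def mem_Collect_eq r not_ex[symmetric] by (simp only:)
qed

lemma reversal_exists: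
  obtains J :: "('x::state_space, 'y::state_space) free_product \<Rightarrow> ('x, 'y) free_product"
  where "clinear J" "\<And>w. w \<in> reduced_words \<Longrightarrow> J (elem_tensor w) = elem_tensor (rev w)"
    "\<And>p. J (J p) = p"
proof -
  obtain J :: "('x, 'y) free_product \<Rightarrow> ('x, 'y) free_product"
    where J: "clinear J" "\<And>w. w \<in> reduced_words \<Longrightarrow> J (elem_tensor w) = elem_tensor (rev w)"
    using free_product_lift[OF elem_tensor_rev_multilinear] by blast
  have "(\<lambda>p. J (J p)) = (\<lambda>p. p)"
    by (rule clinear_eq_on_elem_tensors)
      (simp_all add: clinear_comp J reduced_words_rev complex_vec.linear_id[unfolded id_def])
  then have "J (J p) = p" for p by (rule fun_cong)
  then show ?thesis using that J by blast
qed


lemma left_tensor_word_lincomb_Inl: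
  fixes z :: "'x::state_space"
  shows "u @ Inl x # v \<in> left_words Inl \<Longrightarrow> u @ Inl x' # v \<in> left_words Inl \<Longrightarrow>
      left_tensor Inl z (u @ Inl (x + c *\<^sub>C x') # v) =
      left_tensor Inl z (u @ Inl x # v) + c *\<^sub>C left_tensor Inl z (u @ Inl x' # v)"
    and "u @ Inr y # v \<in> left_words Inl \<Longrightarrow> u @ Inr y' # v \<in> left_words Inl \<Longrightarrow>
      left_tensor Inl z (u @ Inr (y + c *\<^sub>C y') # v) =
      left_tensor Inl z (u @ Inr y # v) + c *\<^sub>C left_tensor Inl z (u @ Inr y' # v)"
  using elem_tensorD(1)[of u x v x' c] elem_tensorD(1)[of "Inl (center_part z) # u" x v x' c]
    elem_tensorD(2)[of u y v y' c] elem_tensorD(2)[of "Inl (center_part z) # u" y v y' c]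
  by (simp_all add: left_tensor_def left_words_reduced reduced_words_Cons scaleC_add_right
      scaleC_scaleC mult.commute)

lemma left_tensor_lincomb_Inl:
  assumes "w \<in> left_words Inl"
  shows "left_tensor Inl (x + c *\<^sub>C x') w = left_tensor Inl x w + c *\<^sub>C left_tensor Inl x' w"
  using elem_tensorD(1)[of "[]" "center_part x" w "center_part x'" c] assms
  by (simp add: left_tensor_def reduced_words_Cons state_coeff_lincomb center_part_lincomb
      scaleC_add_left scaleC_add_right scaleC_scaleC)

lemma elem_tensor_zero_Inl: "w \<in> left_words Inl \<Longrightarrow> elem_tensor (Inl 0 # w) = 0"
  using elem_tensorD(1)[of "[]" 0 w 0 1] by (simp add: reduced_words_Cons centered_zero)

lemma left_op_unique_Inl:
  fixes L M :: "('x::state_space, 'y::state_space) free_product \<Rightarrow> ('x, 'y) free_product"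
    and T :: "'x::state_space \<Rightarrow> 'x"
  assumes "clinear L" "\<And>x w. w \<in> left_words Inl \<Longrightarrow> L (left_tensor Inl x w) = left_tensor Inl (T x) w"
    and "clinear M" "\<And>x w. w \<in> left_words Inl \<Longrightarrow> M (left_tensor Inl x w) = left_tensor Inl (T x) w"
  shows "L = M"
proof (rule clinear_eq_on_elem_tensors)
  fix w :: "('x + 'y) list"
  assume w: "w \<in> reduced_words"
  show "L (elem_tensor w) = M (elem_tensor w)"
  proof (cases "w \<in> left_words Inl")
    case True
    then have "elem_tensor w = left_tensor Inl state_vec w"
      by (simp add: left_tensor_def elem_tensor_zero_Inl scaleC_one)
    then show ?thesis using assms True by simp
  next
    case False
    then obtain x u where wu: "w = Inl x # u" using w by (auto simp: left_words_def)
    then have x: "x \<in> centered" "u \<in> left_words Inl" using w by (auto simp: reduced_words_Cons)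
    then have "elem_tensor w = left_tensor Inl x u"
      by (simp add: left_tensor_def elem_tensor_zero_Inl wu)
    then show ?thesis using assms x by simp
  qed
qed fact+

lemma left_op_exists_Inl:
  fixes T :: "'x::state_space \<Rightarrow> 'x"
  assumes T: "clinear T"
  obtains L :: "('x::state_space, 'y::state_space) free_product \<Rightarrow> ('x, 'y) free_product"
  where "clinear L" "\<And>x w. w \<in> left_words Inl \<Longrightarrow> L (left_tensor Inl x w) = left_tensor Inl (T x) w"
proof -
  define g :: "('x + 'y) list \<Rightarrow> ('x, 'y) free_product" where
    "g w = (case w of Inl x # u \<Rightarrow> left_tensor Inl (T x) u | _ \<Rightarrow> left_tensor Inl (T state_vec) w)"
    for w
  have g1: "g (Inl x # u) = left_tensor Inl (T x) u" for x u
    by (simp add: g_def)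
  have g2: "g w = left_tensor Inl (T state_vec) w" if "w \<in> left_words Inl" for w
    using that by (auto simp: g_def left_words_def split: list.splits sum.splits)
  have B: "Inr y # w \<in> left_words Inl" if "Inr y # w \<in> reduced_words" for y w
    using that by (simp add: left_words_def)
  have "word_multilinear g"
    unfolding word_multilinear_def
  proof (intro conjI allI impI)
    fix u v :: "('x + 'y) list" and x x' :: 'x and c
    assume r: "u @ Inl x # v \<in> reduced_words" "u @ Inl x' # v \<in> reduced_words"
    note r' = reduced_words_lincomb(1)[OF r, of c]
    show "g (u @ Inl (x + c *\<^sub>C x') # v) = g (u @ Inl x # v) + c *\<^sub>C g (u @ Inl x' # v)"
    proof (cases u)
      case Nil
      show ?thesis using r r' unfolding Nil by (simp add: g1 reduced_words_Cons left_tensor_lincomb_Inl clinear_lincomb[OF T])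
    next
      case (Cons a u')
      show ?thesis
      proof (cases a)
        case (Inl z)
        show ?thesis using r unfolding Cons Inl
          by (simp add: g1 reduced_words_Cons left_tensor_word_lincomb_Inl)
      next
        case (Inr z)
        show ?thesis using B[of z "u' @ Inl x # v"] B[of z "u' @ Inl x' # v"]
            B[of z "u' @ Inl (x + c *\<^sub>C x') # v"] r r'
            left_tensor_word_lincomb_Inl(1)[of u x v x' "T state_vec" c]
          unfolding Cons Inr by (simp add: g2)
      qed
    qed
  next
    fix u v :: "('x + 'y) list" and x x' :: 'y and c
    assume r: "u @ Inr x # v \<in> reduced_words" "u @ Inr x' # v \<in> reduced_words"
    note r' = reduced_words_lincomb(2)[OF r, of c]
    show "g (u @ Inr (x + c *\<^sub>C x') # v) = g (u @ Inr x # v) + c *\<^sub>C g (u @ Inr x' # v)"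
    proof (cases u)
      case Nil
      show ?thesis using r r' unfolding Nil using B[of x v] B[of x' v] B[of "x + c *\<^sub>C x'" v]
          left_tensor_word_lincomb_Inl(2)[of "[]" x v x' "T state_vec" c] by (simp add: g2)
    next
      case (Cons a u')
      show ?thesis
      proof (cases a)
        case (Inl z)
        show ?thesis using r unfolding Cons Inl
          by (simp add: g1 reduced_words_Cons left_tensor_word_lincomb_Inl)
      next
        case (Inr z)
        show ?thesis using B[of z "u' @ Inr x # v"] B[of z "u' @ Inr x' # v"]
            B[of z "u' @ Inr (x + c *\<^sub>C x') # v"] r r'
            left_tensor_word_lincomb_Inl(2)[of u x v x' "T state_vec" c]
          unfolding Cons Inr by (simp add: g2)
      qed
    qed
  qed
  then obtain L where L: "clinear L" "\<And>w. w \<in> reduced_words \<Longrightarrow> L (elem_tensor w) = g w"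
    using free_product_lift by blast
  interpret L: Vector_Spaces.linear "(*\<^sub>C)" "(*\<^sub>C)" L by fact
  show ?thesis
  proof (rule that[OF L(1)])
    fix x :: 'x and w :: "('x + 'y) list"
    assume w: "w \<in> left_words Inl"
    have "L (left_tensor Inl x w)
        = left_tensor Inl (T (center_part x)) w + state_coeff x *\<^sub>C left_tensor Inl (T state_vec) w"
      using w unfolding left_tensor_def[of Inl x]
      by (simp add: L.add L.scale L(2) left_words_reduced reduced_words_Cons g1 g2 add.commute)
    also have "\<dots> = left_tensor Inl (T (center_part x + state_coeff x *\<^sub>C state_vec)) w"
      by (simp only: left_tensor_lincomb_Inl[OF w] clinear_lincomb[OF T])
    also have "center_part x + state_coeff x *\<^sub>C state_vec = x"
      by (simp add: center_part_def)
    finally show "L (left_tensor Inl x w) = left_tensor Inl (T x) w" .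
  qed
qed

lemma left_op_Inl:
  fixes T :: "'x::state_space \<Rightarrow> 'x"
  assumes T: "clinear T"
  shows "clinear (left_op Inl T :: ('x::state_space, 'y::state_space) free_product \<Rightarrow> _)"
    and "w \<in> left_words Inl \<Longrightarrow> left_op Inl T (left_tensor Inl x w)
      = (left_tensor Inl (T x) w :: ('x, 'y) free_product)"
proof -
  obtain L :: "('x, 'y) free_product \<Rightarrow> ('x, 'y) free_product" where L: "clinear L"
      "\<And>x w. w \<in> left_words Inl \<Longrightarrow> L (left_tensor Inl x w) = left_tensor Inl (T x) w"
    using left_op_exists_Inl[OF T] by blast
  have "left_op Inl T = L"
    unfolding left_op_def
  proof (rule the_equality)
    show "clinear L \<and> (\<forall>x. \<forall>w\<in>left_words Inl. L (left_tensor Inl x w) = left_tensor Inl (T x) w)"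
      by (intro conjI allI ballI L)
  next
    fix M :: "('x, 'y) free_product \<Rightarrow> ('x, 'y) free_product"
    assume M: "clinear M \<and>
      (\<forall>x. \<forall>w\<in>left_words Inl. M (left_tensor Inl x w) = left_tensor Inl (T x) w)"
    show "M = L"
      by (rule left_op_unique_Inl[OF _ _ L]) (simp_all add: M)
  qed
  then show "clinear (left_op Inl T :: ('x, 'y) free_product \<Rightarrow> _)"
    "w \<in> left_words Inl \<Longrightarrow> left_op Inl T (left_tensor Inl x w)
      = (left_tensor Inl (T x) w :: ('x, 'y) free_product)"
    using L by simp_all
qed

lemma right_op_Inl:
  fixes T :: "'x::state_space \<Rightarrow> 'x"
  assumes T: "clinear T"
  shows "clinear (right_op Inl T :: ('x::state_space, 'y::state_space) free_product \<Rightarrow> _)"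
    and "w \<in> right_words Inl \<Longrightarrow> right_op Inl T (right_tensor Inl x w)
      = (right_tensor Inl (T x) w :: ('x, 'y) free_product)"
proof -
  obtain L :: "('x, 'y) free_product \<Rightarrow> ('x, 'y) free_product" where L: "clinear L"
      "\<And>x w. w \<in> left_words Inl \<Longrightarrow> L (left_tensor Inl x w) = left_tensor Inl (T x) w"
    using left_op_exists_Inl[OF T] by blast
  obtain J :: "('x, 'y) free_product \<Rightarrow> ('x, 'y) free_product"
    where J: "clinear J" "\<And>w. w \<in> reduced_words \<Longrightarrow> J (elem_tensor w) = elem_tensor (rev w)"
      "\<And>p. J (J p) = p"
    using reversal_exists by blast
  interpret J: Vector_Spaces.linear "(*\<^sub>C)" "(*\<^sub>C)" J by fact
  have J_left: "J (left_tensor Inl x w) = right_tensor Inl x (rev w)"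
    if "w \<in> left_words Inl" for x :: 'x and w
    using that by (simp add: left_tensor_def right_tensor_def J.add J.scale J(2)
        left_words_reduced reduced_words_Cons)
  have J_right: "J (right_tensor Inl x w) = left_tensor Inl x (rev w)"
    if "w \<in> right_words Inl" for x :: 'x and w
  proof -
    have "J (left_tensor Inl x (rev w)) = right_tensor Inl x (rev (rev w))"
      by (rule J_left) (use that in \<open>simp only: right_words_rev\<close>)
    then show ?thesis using J(3)[of "left_tensor Inl x (rev w)"] by simp
  qed
  define R where "R p = J (L (J p))" for p
  have R: "clinear R"
    unfolding R_def by (rule clinear_comp[OF J(1) clinear_comp[OF L(1) J(1)]])
  have R': "R (right_tensor Inl x w) = right_tensor Inl (T x) w" if "w \<in> right_words Inl" for x w
    using that J_left[of "rev w" "T x"] by (simp add: R_def J_right L(2) right_words_rev)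
  have "right_op Inl T = R"
    unfolding right_op_def
  proof (rule the_equality)
    show "clinear R \<and>
        (\<forall>x. \<forall>w\<in>right_words Inl. R (right_tensor Inl x w) = right_tensor Inl (T x) w)"
      by (intro conjI allI ballI R R')
  next
    fix M :: "('x, 'y) free_product \<Rightarrow> ('x, 'y) free_product"
    assume M: "clinear M \<and>
      (\<forall>x. \<forall>w\<in>right_words Inl. M (right_tensor Inl x w) = right_tensor Inl (T x) w)"
    have "(\<lambda>p. J (M (J p))) = L"
    proof (rule left_op_unique_Inl[OF _ _ L])
      show "clinear (\<lambda>p. J (M (J p)))" 
        by (rule clinear_comp[OF J(1) clinear_comp[OF conjunct1[OF M] J(1)]])
      show "J (M (J (left_tensor Inl x w))) = left_tensor Inl (T x) w"
        if "w \<in> left_words Inl" for x w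
      proof -
        from that have w: "rev w \<in> right_words Inl" by (simp add: right_words_rev)
        then have "M (right_tensor Inl x (rev w)) = right_tensor Inl (T x) (rev w)"
          using M by (elim conjE) (drule spec, drule bspec, assumption+)
        then show ?thesis unfolding J_left[OF that] by (simp only: J_right[OF w] rev_rev_ident)
      qed
    qed
    then have "L q = J (M (J q))" for q by (rule fun_cong[symmetric])
    then have "R p = M p" for p by (simp add: R_def J(3))
    then show "M = R" by (intro ext) simp
  qed
  then show "clinear (right_op Inl T :: ('x, 'y) free_product \<Rightarrow> _)"
    "w \<in> right_words Inl \<Longrightarrow> right_op Inl T (right_tensor Inl x w)
      = (right_tensor Inl (T x) w :: ('x, 'y) free_product)"
    using R R' by simp_all
qed

lemma left_tensor_word_lincomb_Inr:
  fixes z :: "'y::state_space"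
  shows "u @ Inl x # v \<in> left_words Inr \<Longrightarrow> u @ Inl x' # v \<in> left_words Inr \<Longrightarrow>
      left_tensor Inr z (u @ Inl (x + c *\<^sub>C x') # v) =
      left_tensor Inr z (u @ Inl x # v) + c *\<^sub>C left_tensor Inr z (u @ Inl x' # v)"
    and "u @ Inr y # v \<in> left_words Inr \<Longrightarrow> u @ Inr y' # v \<in> left_words Inr \<Longrightarrow>
      left_tensor Inr z (u @ Inr (y + c *\<^sub>C y') # v) =
      left_tensor Inr z (u @ Inr y # v) + c *\<^sub>C left_tensor Inr z (u @ Inr y' # v)"
  using elem_tensorD(1)[of u x v x' c] elem_tensorD(1)[of "Inr (center_part z) # u" x v x' c]
    elem_tensorD(2)[of u y v y' c] elem_tensorD(2)[of "Inr (center_part z) # u" y v y' c]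
  by (simp_all add: left_tensor_def left_words_reduced reduced_words_Cons scaleC_add_right
      scaleC_scaleC mult.commute)

lemma left_tensor_lincomb_Inr:
  assumes "w \<in> left_words Inr"
  shows "left_tensor Inr (x + c *\<^sub>C x') w = left_tensor Inr x w + c *\<^sub>C left_tensor Inr x' w"
  using elem_tensorD(2)[of "[]" "center_part x" w "center_part x'" c] assms
  by (simp add: left_tensor_def reduced_words_Cons state_coeff_lincomb center_part_lincomb
      scaleC_add_left scaleC_add_right scaleC_scaleC)

lemma elem_tensor_zero_Inr: "w \<in> left_words Inr \<Longrightarrow> elem_tensor (Inr 0 # w) = 0"
  using elem_tensorD(2)[of "[]" 0 w 0 1] by (simp add: reduced_words_Cons centered_zero)

lemma left_op_unique_Inr:
  fixes L M :: "('x::state_space, 'y::state_space) free_product \<Rightarrow> ('x, 'y) free_product"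
    and T :: "'y::state_space \<Rightarrow> 'y"
  assumes "clinear L" "\<And>x w. w \<in> left_words Inr \<Longrightarrow> L (left_tensor Inr x w) = left_tensor Inr (T x) w"
    and "clinear M" "\<And>x w. w \<in> left_words Inr \<Longrightarrow> M (left_tensor Inr x w) = left_tensor Inr (T x) w"
  shows "L = M"
proof (rule clinear_eq_on_elem_tensors)
  fix w :: "('x + 'y) list"
  assume w: "w \<in> reduced_words"
  show "L (elem_tensor w) = M (elem_tensor w)"
  proof (cases "w \<in> left_words Inr")
    case True
    then have "elem_tensor w = left_tensor Inr state_vec w"
      by (simp add: left_tensor_def elem_tensor_zero_Inr scaleC_one)
    then show ?thesis using assms True by simp
  next
    case False
    then obtain x u where wu: "w = Inr x # u" using w by (auto simp: left_words_def)
    then have x: "x \<in> centered" "u \<in> left_words Inr" using w by (auto simp: reduced_words_Cons)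
    then have "elem_tensor w = left_tensor Inr x u"
      by (simp add: left_tensor_def elem_tensor_zero_Inr wu)
    then show ?thesis using assms x by simp
  qed
qed fact+

lemma left_op_exists_Inr:
  fixes T :: "'y::state_space \<Rightarrow> 'y"
  assumes T: "clinear T"
  obtains L :: "('x::state_space, 'y::state_space) free_product \<Rightarrow> ('x, 'y) free_product"
  where "clinear L" "\<And>x w. w \<in> left_words Inr \<Longrightarrow> L (left_tensor Inr x w) = left_tensor Inr (T x) w"
proof -
  define g :: "('x + 'y) list \<Rightarrow> ('x, 'y) free_product" where
    "g w = (case w of Inr x # u \<Rightarrow> left_tensor Inr (T x) u | _ \<Rightarrow> left_tensor Inr (T state_vec) w)"
    for w
  have g1: "g (Inr x # u) = left_tensor Inr (T x) u" for x u
    by (simp add: g_def)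
  have g2: "g w = left_tensor Inr (T state_vec) w" if "w \<in> left_words Inr" for w
    using that by (auto simp: g_def left_words_def split: list.splits sum.splits)
  have B: "Inl y # w \<in> left_words Inr" if "Inl y # w \<in> reduced_words" for y w
    using that by (simp add: left_words_def)
  have "word_multilinear g"
    unfolding word_multilinear_def
  proof (intro conjI allI impI)
    fix u v :: "('x + 'y) list" and x x' :: 'x and c
    assume r: "u @ Inl x # v \<in> reduced_words" "u @ Inl x' # v \<in> reduced_words"
    note r' = reduced_words_lincomb(1)[OF r, of c]
    show "g (u @ Inl (x + c *\<^sub>C x') # v) = g (u @ Inl x # v) + c *\<^sub>C g (u @ Inl x' # v)"
    proof (cases u)
      case Nil
      show ?thesis using r r' unfolding Nil using B[of x v] B[of x' v] B[of "x + c *\<^sub>C x'" v]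
          left_tensor_word_lincomb_Inr(1)[of "[]" x v x' "T state_vec" c] by (simp add: g2)
    next
      case (Cons a u')
      show ?thesis
      proof (cases a)
        case (Inr z)
        show ?thesis using r unfolding Cons Inr
          by (simp add: g1 reduced_words_Cons left_tensor_word_lincomb_Inr)
      next
        case (Inl z)
        show ?thesis using B[of z "u' @ Inl x # v"] B[of z "u' @ Inl x' # v"]
            B[of z "u' @ Inl (x + c *\<^sub>C x') # v"] r r'
            left_tensor_word_lincomb_Inr(1)[of u x v x' "T state_vec" c]
          unfolding Cons Inl by (simp add: g2)
      qed
    qed
  next
    fix u v :: "('x + 'y) list" and x x' :: 'y and c
    assume r: "u @ Inr x # v \<in> reduced_words" "u @ Inr x' # v \<in> reduced_words"
    note r' = reduced_words_lincomb(2)[OF r, of c]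
    show "g (u @ Inr (x + c *\<^sub>C x') # v) = g (u @ Inr x # v) + c *\<^sub>C g (u @ Inr x' # v)"
    proof (cases u)
      case Nil
      show ?thesis using r r' unfolding Nil by (simp add: g1 reduced_words_Cons left_tensor_lincomb_Inr clinear_lincomb[OF T])
    next
      case (Cons a u')
      show ?thesis
      proof (cases a)
        case (Inr z)
        show ?thesis using r unfolding Cons Inr
          by (simp add: g1 reduced_words_Cons left_tensor_word_lincomb_Inr)
      next
        case (Inl z)
        show ?thesis using B[of z "u' @ Inr x # v"] B[of z "u' @ Inr x' # v"]
            B[of z "u' @ Inr (x + c *\<^sub>C x') # v"] r r'
            left_tensor_word_lincomb_Inr(2)[of u x v x' "T state_vec" c]
          unfolding Cons Inl by (simp add: g2)
      qed
    qed
  qed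
  then obtain L where L: "clinear L" "\<And>w. w \<in> reduced_words \<Longrightarrow> L (elem_tensor w) = g w"
    using free_product_lift by blast
  interpret L: Vector_Spaces.linear "(*\<^sub>C)" "(*\<^sub>C)" L by fact
  show ?thesis
  proof (rule that[OF L(1)])
    fix x :: 'y and w :: "('x + 'y) list"
    assume w: "w \<in> left_words Inr"
    have "L (left_tensor Inr x w)
        = left_tensor Inr (T (center_part x)) w + state_coeff x *\<^sub>C left_tensor Inr (T state_vec) w"
      using w unfolding left_tensor_def[of Inr x]
      by (simp add: L.add L.scale L(2) left_words_reduced reduced_words_Cons g1 g2 add.commute)
    also have "\<dots> = left_tensor Inr (T (center_part x + state_coeff x *\<^sub>C state_vec)) w"
      by (simp only: left_tensor_lincomb_Inr[OF w] clinear_lincomb[OF T])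
    also have "center_part x + state_coeff x *\<^sub>C state_vec = x"
      by (simp add: center_part_def)
    finally show "L (left_tensor Inr x w) = left_tensor Inr (T x) w" .
  qed
qed

lemma left_op_Inr:
  fixes T :: "'y::state_space \<Rightarrow> 'y"
  assumes T: "clinear T"
  shows "clinear (left_op Inr T :: ('x::state_space, 'y::state_space) free_product \<Rightarrow> _)"
    and "w \<in> left_words Inr \<Longrightarrow> left_op Inr T (left_tensor Inr x w)
      = (left_tensor Inr (T x) w :: ('x, 'y) free_product)"
proof -
  obtain L :: "('x, 'y) free_product \<Rightarrow> ('x, 'y) free_product" where L: "clinear L"
      "\<And>x w. w \<in> left_words Inr \<Longrightarrow> L (left_tensor Inr x w) = left_tensor Inr (T x) w"
    using left_op_exists_Inr[OF T] by blast
  have "left_op Inr T = L"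
    unfolding left_op_def
  proof (rule the_equality)
    show "clinear L \<and> (\<forall>x. \<forall>w\<in>left_words Inr. L (left_tensor Inr x w) = left_tensor Inr (T x) w)"
      by (intro conjI allI ballI L)
  next
    fix M :: "('x, 'y) free_product \<Rightarrow> ('x, 'y) free_product"
    assume M: "clinear M \<and>
      (\<forall>x. \<forall>w\<in>left_words Inr. M (left_tensor Inr x w) = left_tensor Inr (T x) w)"
    show "M = L"
      by (rule left_op_unique_Inr[OF _ _ L]) (simp_all add: M)
  qed
  then show "clinear (left_op Inr T :: ('x, 'y) free_product \<Rightarrow> _)"
    "w \<in> left_words Inr \<Longrightarrow> left_op Inr T (left_tensor Inr x w)
      = (left_tensor Inr (T x) w :: ('x, 'y) free_product)"
    using L by simp_all
qed

lemma right_op_Inr: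
  fixes T :: "'y::state_space \<Rightarrow> 'y"
  assumes T: "clinear T"
  shows "clinear (right_op Inr T :: ('x::state_space, 'y::state_space) free_product \<Rightarrow> _)"
    and "w \<in> right_words Inr \<Longrightarrow> right_op Inr T (right_tensor Inr x w)
      = (right_tensor Inr (T x) w :: ('x, 'y) free_product)"
proof -
  obtain L :: "('x, 'y) free_product \<Rightarrow> ('x, 'y) free_product" where L: "clinear L"
      "\<And>x w. w \<in> left_words Inr \<Longrightarrow> L (left_tensor Inr x w) = left_tensor Inr (T x) w"
    using left_op_exists_Inr[OF T] by blast
  obtain J :: "('x, 'y) free_product \<Rightarrow> ('x, 'y) free_product"
    where J: "clinear J" "\<And>w. w \<in> reduced_words \<Longrightarrow> J (elem_tensor w) = elem_tensor (rev w)"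
      "\<And>p. J (J p) = p"
    using reversal_exists by blast
  interpret J: Vector_Spaces.linear "(*\<^sub>C)" "(*\<^sub>C)" J by fact
  have J_left: "J (left_tensor Inr x w) = right_tensor Inr x (rev w)"
    if "w \<in> left_words Inr" for x :: 'y and w
    using that by (simp add: left_tensor_def right_tensor_def J.add J.scale J(2)
        left_words_reduced reduced_words_Cons)
  have J_right: "J (right_tensor Inr x w) = left_tensor Inr x (rev w)"
    if "w \<in> right_words Inr" for x :: 'y and w
  proof -
    have "J (left_tensor Inr x (rev w)) = right_tensor Inr x (rev (rev w))"
      by (rule J_left) (use that in \<open>simp only: right_words_rev\<close>)
    then show ?thesis using J(3)[of "left_tensor Inr x (rev w)"] by simp
  qed
  define R where "R p = J (L (J p))" for p
  have R: "clinear R"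
    unfolding R_def by (rule clinear_comp[OF J(1) clinear_comp[OF L(1) J(1)]])
  have R': "R (right_tensor Inr x w) = right_tensor Inr (T x) w" if "w \<in> right_words Inr" for x w
    using that J_left[of "rev w" "T x"] by (simp add: R_def J_right L(2) right_words_rev)
  have "right_op Inr T = R"
    unfolding right_op_def
  proof (rule the_equality)
    show "clinear R \<and>
        (\<forall>x. \<forall>w\<in>right_words Inr. R (right_tensor Inr x w) = right_tensor Inr (T x) w)"
      by (intro conjI allI ballI R R')
  next
    fix M :: "('x, 'y) free_product \<Rightarrow> ('x, 'y) free_product"
    assume M: "clinear M \<and>
      (\<forall>x. \<forall>w\<in>right_words Inr. M (right_tensor Inr x w) = right_tensor Inr (T x) w)"
    have "(\<lambda>p. J (M (J p))) = L"
    proof (rule left_op_unique_Inr[OF _ _ L])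
      show "clinear (\<lambda>p. J (M (J p)))" 
        by (rule clinear_comp[OF J(1) clinear_comp[OF conjunct1[OF M] J(1)]])
      show "J (M (J (left_tensor Inr x w))) = left_tensor Inr (T x) w"
        if "w \<in> left_words Inr" for x w
      proof -
        from that have w: "rev w \<in> right_words Inr" by (simp add: right_words_rev)
        then have "M (right_tensor Inr x (rev w)) = right_tensor Inr (T x) (rev w)"
          using M by (elim conjE) (drule spec, drule bspec, assumption+)
        then show ?thesis unfolding J_left[OF that] by (simp only: J_right[OF w] rev_rev_ident)
      qed
    qed
    then have "L q = J (M (J q))" for q by (rule fun_cong[symmetric])
    then have "R p = M p" for p by (simp add: R_def J(3))
    then show "M = R" by (intro ext) simp
  qed
  then show "clinear (right_op Inr T :: ('x, 'y) free_product \<Rightarrow> _)"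
    "w \<in> right_words Inr \<Longrightarrow> right_op Inr T (right_tensor Inr x w)
      = (right_tensor Inr (T x) w :: ('x, 'y) free_product)"
    using R R' by simp_all
qed


section \<open>Bi-freeness\<close>

datatype variable = A1 | A2 | B1 | B2

text \<open>The existential quantification over the two vector spaces is split: the carrier types are the
  parameters \<open>'x\<close> and \<open>'y\<close>.  As free type variables in a hypothesis they express that some
  pair of spaces exists.  Every word in the four variables is a joint moment.\<close>

definition bi_free ::
  "'x::state_space itself \<Rightarrow> 'y::state_space itself \<Rightarrow> ('a::cstar_algebra \<Rightarrow> complex)
     \<Rightarrow> 'a \<times> 'a \<Rightarrow> 'a \<times> 'a \<Rightarrow> bool" where
  "bi_free X Y \<phi> p\<^sub>1 p\<^sub>2 \<longleftrightarrow>
     (\<exists>(T\<^sub>1 :: 'x \<Rightarrow> 'x) (S\<^sub>1 :: 'x \<Rightarrow> 'x) (T\<^sub>2 :: 'y \<Rightarrow> 'y) (S\<^sub>2 :: 'y \<Rightarrow> 'y).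
        clinear T\<^sub>1 \<and> clinear S\<^sub>1 \<and> clinear T\<^sub>2 \<and> clinear S\<^sub>2 \<and>
        (\<forall>ws :: variable list.
           \<phi> (prod_list (map (case_variable (fst p\<^sub>1) (fst p\<^sub>2) (snd p\<^sub>1) (snd p\<^sub>2)) ws)) =
           vacuum_coeff
             (foldr (\<circ>)
                (map (case_variable (left_op Inl T\<^sub>1) (left_op Inr T\<^sub>2)
                                    (right_op Inl S\<^sub>1) (right_op Inr S\<^sub>2)) ws)
                id (elem_tensor []))))"


section \<open>Distributions and Cauchy transforms\<close>

definition pair_distribution ::
  "('a::cstar_algebra \<Rightarrow> complex) \<Rightarrow> 'a \<times> 'a \<Rightarrow> (real \<times> real) measure \<Rightarrow> bool" where
  "pair_distribution \<phi> p \<eta> \<longleftrightarrow>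
     prob_space \<eta> \<and> sets \<eta> = sets borel \<and> (\<exists>K. compact K \<and> emeasure \<eta> (- K) = 0) \<and>
     (\<forall>m n. \<phi> (fst p ^ m * snd p ^ n) = complex_of_real (\<integral>x. fst x ^ m * snd x ^ n \<partial>\<eta>))"

definition first_marginal :: "(real \<times> real) measure \<Rightarrow> real measure" where
  "first_marginal \<eta> = distr \<eta> borel fst"

definition second_marginal :: "(real \<times> real) measure \<Rightarrow> real measure" where
  "second_marginal \<eta> = distr \<eta> borel snd"

definition upper_half_plane :: "complex set" where
  "upper_half_plane = {z. Im z > 0}"

definition cauchy_transform :: "real measure \<Rightarrow> complex \<Rightarrow> complex" where
  "cauchy_transform \<mu> z = (\<integral>t. 1 / (z - complex_of_real t) \<partial>\<mu>)"

definition cauchy_transform2 :: "(real \<times> real) measure \<Rightarrow> complex \<Rightarrow> complex \<Rightarrow> complex" where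
  "cauchy_transform2 \<eta> z w =
     (\<integral>x. 1 / ((z - complex_of_real (fst x)) * (w - complex_of_real (snd x))) \<partial>\<eta>)"

definition unbounded_cauchy_transform :: "real measure \<Rightarrow> bool" where
  "unbounded_cauchy_transform \<mu> \<longleftrightarrow> \<not> bounded (cauchy_transform \<mu> ` upper_half_plane)"

end

theory Submission
  imports Defs
begin

text \<open>By the Cauchy--Schwarz inequality and \<open>\<integral> 1 / |z - t|\<^sup>2 d\<mu>(t) = - Im G\<^sub>\<mu>(z) / Im z\<close>, the quantity
  \<open>\<surd>(Im z Im w) |G\<^sub>\<eta>(z, w)|\<close> is at most \<open>\<surd>(|G\<^sub>\<mu>(z)| |G\<^sub>\<nu>(w)|)\<close>, so one of the marginals has an
  unbounded Cauchy transform.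

  Each face of a bi-free pair of pairs is a free pair, and for a free pair \<open>\<mu> = \<mu>\<^sub>1 \<boxplus> \<mu>\<^sub>2\<close> has
  subordination functions: \<open>G\<^sub>\<mu>(z) = G\<^sub>1(\<omega>\<^sub>1) = G\<^sub>2(\<omega>\<^sub>2)\<close> with \<open>\<omega>\<^sub>1 + \<omega>\<^sub>2 = z + 1 / G\<^sub>\<mu>(z)\<close>.  Here a pair
  \<open>(\<omega>\<^sub>1, \<omega>\<^sub>2)\<close> with \<open>G\<^sub>1(\<omega>\<^sub>1) = G\<^sub>2(\<omega>\<^sub>2) = 1 / b\<close> and \<open>\<omega>\<^sub>1 + \<omega>\<^sub>2 = z + b\<close> comes from Brouwer's theorem, and it
  computes \<open>G\<^sub>\<mu>(z)\<close> because, with the centered elements \<open>u\<^sub>i = b (\<omega>\<^sub>i - a\<^sub>i)\<inverse> - 1\<close>,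
  \<open>b (z - a\<^sub>1 - a\<^sub>2)\<inverse> = \<Sum>\<^sub>n (1 + u\<^sub>2) (u\<^sub>1 u\<^sub>2)\<^sup>n (1 + u\<^sub>1)\<close>.  By freeness the terms with \<open>n > 0\<close> have
  expectation \<open>0\<close> and the series converges in \<open>L\<^sup>2\<close> as soon as \<open>\<parallel>u\<^sub>1\<parallel>\<^sub>2 \<parallel>u\<^sub>2\<parallel>\<^sub>2 < 1\<close>, which holds for every
  \<open>z\<close> in the upper half-plane since \<open>\<parallel>u\<^sub>i\<parallel>\<^sub>2\<^sup>2 = Im b / Im \<omega>\<^sub>i - 1\<close>.

  If \<open>|G\<^sub>\<mu>(z\<^sub>n)| \<rightarrow> \<infinity>\<close>, then along a subsequence \<open>\<omega>\<^sub>1 \<rightarrow> \<alpha>\<close> and \<open>\<omega>\<^sub>2 \<rightarrow> \<beta>\<close> with \<open>\<alpha>, \<beta>\<close> real.  Then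
  \<open>limsup Im \<omega>\<^sub>1 / Im b \<le> \<mu>\<^sub>1 {\<alpha>}\<close> and \<open>limsup Im \<omega>\<^sub>2 / Im b \<le> \<mu>\<^sub>2 {\<beta>}\<close>, while
  \<open>Im \<omega>\<^sub>1 + Im \<omega>\<^sub>2 = Im z + Im b > Im b\<close>.\<close>

section \<open>Cauchy transforms of compactly supported distributions\<close>

text \<open>Transfers the inequality for nonnegative integrals, applied to |f| and |g|, to Bochner
  integrals.\<close>

lemma Cauchy_Schwarz_integral:
  fixes f g :: "'a \<Rightarrow> complex"
  assumes [measurable]: "f \<in> borel_measurable M" "g \<in> borel_measurable M"
    and f: "integrable M (\<lambda>x. (cmod (f x))\<^sup>2)" and g: "integrable M (\<lambda>x. (cmod (g x))\<^sup>2)"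
  shows "(cmod (\<integral>x. f x * g x \<partial>M))\<^sup>2 \<le> (\<integral>x. (cmod (f x))\<^sup>2 \<partial>M) * (\<integral>x. (cmod (g x))\<^sup>2 \<partial>M)"
proof (cases "integrable M (\<lambda>x. f x * g x)")
  case True
  then have fg: "integrable M (\<lambda>x. cmod (f x) * cmod (g x))"
    by (auto dest: integrable_norm simp: norm_mult)
  have "(\<integral>\<^sup>+x. ennreal (cmod (f x)) * ennreal (cmod (g x)) \<partial>M)\<^sup>2
      \<le> (\<integral>\<^sup>+x. (ennreal (cmod (f x)))\<^sup>2 \<partial>M) * (\<integral>\<^sup>+x. (ennreal (cmod (g x)))\<^sup>2 \<partial>M)"
    by (rule Cauchy_Schwarz_nn_integral) auto
  then have "(\<integral>\<^sup>+x. ennreal (cmod (f x) * cmod (g x)) \<partial>M)\<^sup>2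
      \<le> (\<integral>\<^sup>+x. ennreal ((cmod (f x))\<^sup>2) \<partial>M) * (\<integral>\<^sup>+x. ennreal ((cmod (g x))\<^sup>2) \<partial>M)"
    by (simp add: ennreal_mult'' ennreal_power)
  moreover have "(\<integral>\<^sup>+x. ennreal (cmod (f x) * cmod (g x)) \<partial>M)\<^sup>2
      = ennreal ((\<integral>x. cmod (f x) * cmod (g x) \<partial>M)\<^sup>2)"
    by (subst nn_integral_eq_integral[OF fg]) (auto simp: ennreal_power)
  moreover have "(\<integral>\<^sup>+x. ennreal ((cmod (f x))\<^sup>2) \<partial>M) * (\<integral>\<^sup>+x. ennreal ((cmod (g x))\<^sup>2) \<partial>M)
      = ennreal ((\<integral>x. (cmod (f x))\<^sup>2 \<partial>M) * (\<integral>x. (cmod (g x))\<^sup>2 \<partial>M))"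
    by (subst (1 2) nn_integral_eq_integral) (auto simp: f g ennreal_mult'')
  ultimately have "ennreal ((\<integral>x. cmod (f x) * cmod (g x) \<partial>M)\<^sup>2)
      \<le> ennreal ((\<integral>x. (cmod (f x))\<^sup>2 \<partial>M) * (\<integral>x. (cmod (g x))\<^sup>2 \<partial>M))"
    by simp
  then have "(\<integral>x. cmod (f x) * cmod (g x) \<partial>M)\<^sup>2
      \<le> (\<integral>x. (cmod (f x))\<^sup>2 \<partial>M) * (\<integral>x. (cmod (g x))\<^sup>2 \<partial>M)"
    by (subst (asm) ennreal_le_iff) auto
  moreover have "cmod (\<integral>x. f x * g x \<partial>M) \<le> (\<integral>x. cmod (f x) * cmod (g x) \<partial>M)"
    using integral_norm_bound[of M "\<lambda>x. f x * g x"] by (simp add: norm_mult)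
  ultimately show ?thesis
    by (meson norm_ge_zero order_trans power_mono)
next
  case False
  \<comment> \<open>The Bochner integral of a non-integrable function is 0 by convention.\<close>
  then show ?thesis by (simp add: not_integrable_integral_eq)
qed

lemma Im_le_cmod_diff_of_real: "Im w \<le> cmod (w - complex_of_real t)"
  using abs_Im_le_cmod[of "w - complex_of_real t"] by simp

lemma diff_of_real_nonzero: "Im w > 0 \<Longrightarrow> w - complex_of_real t \<noteq> 0"
  by (auto simp: complex_eq_iff)

lemma cmod_inverse_diff_le: "Im w > 0 \<Longrightarrow> cmod (1 / (w - complex_of_real t)) \<le> 1 / Im w"
  using Im_le_cmod_diff_of_real[of w t] by (simp add: norm_divide frac_le)

lemma measurable_inverse_diff [measurable]:
  "(\<lambda>t. 1 / (w - complex_of_real t)) \<in> borel_measurable borel"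
  by measurable

text \<open>A probability measure carried by [-M, M]. The radius is a parameter, so that several
  measures can share one.\<close>

locale bounded_distribution = prob_space \<mu> for \<mu> :: "real measure" +
  fixes M :: real
  assumes sets_borel [measurable_cong]: "sets \<mu> = sets borel"
    and AE_bounded: "AE t in \<mu>. \<bar>t\<bar> \<le> M"
begin

text \<open>The squared L2 norm of the resolvent kernel; it equals - Im G(w) / Im w.\<close>

definition energy :: "complex \<Rightarrow> real" where
  "energy w = (\<integral>t. (cmod (1 / (w - complex_of_real t)))\<^sup>2 \<partial>\<mu>)"

lemma bound_nonneg: "M \<ge> 0"
proof -
  have "AE t in \<mu>. M \<ge> 0" using AE_bounded by eventually_elim auto
  then show ?thesis by simp
qed

lemma integrable_inverse_diff: "Im w > 0 \<Longrightarrow> integrable \<mu> (\<lambda>t. 1 / (w - complex_of_real t))"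
  by (rule integrable_const_bound[of _ "1 / Im w"]) (auto intro!: AE_I2 cmod_inverse_diff_le)

lemma integrable_energy: "Im w > 0 \<Longrightarrow> integrable \<mu> (\<lambda>t. (cmod (1 / (w - complex_of_real t)))\<^sup>2)"
proof (rule integrable_const_bound[of _ "(1 / Im w)\<^sup>2"])
  assume "Im w > 0"
  then show "AE t in \<mu>. norm ((cmod (1 / (w - complex_of_real t)))\<^sup>2) \<le> (1 / Im w)\<^sup>2"
    by (intro AE_I2) (auto intro!: power_mono cmod_inverse_diff_le simp del: norm_divide)
qed measurable

lemma Im_cauchy_transform:
  assumes "Im w > 0"
  shows "Im (cauchy_transform \<mu> w) = - (Im w * energy w)"
proof -
  have "Im (1 / (w - complex_of_real t)) = - Im w * (cmod (1 / (w - complex_of_real t)))\<^sup>2" for t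
    using diff_of_real_nonzero[OF assms, of t]
    by (simp add: Im_divide norm_divide power_divide cmod_power2)
  then have "Im (cauchy_transform \<mu> w) = (\<integral>t. - Im w * (cmod (1 / (w - complex_of_real t)))\<^sup>2 \<partial>\<mu>)"
    unfolding cauchy_transform_def
    by (subst integral_Im[symmetric]) (use assms in \<open>simp_all add: integrable_inverse_diff\<close>)
  then show ?thesis unfolding energy_def by simp
qed

text \<open>Cauchy-Schwarz against the constant function 1, which has norm 1.\<close>

lemma cmod_cauchy_transform_le_energy:
  assumes "Im w > 0"
  shows "(cmod (cauchy_transform \<mu> w))\<^sup>2 \<le> energy w"
  using Cauchy_Schwarz_integral[of "\<lambda>t. 1 / (w - complex_of_real t)" \<mu> "\<lambda>_. 1"]
    integrable_energy[OF assms]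
  by (simp add: cauchy_transform_def energy_def prob_space)

lemma energy_lower_bound:
  assumes "Im w > 0"
  shows "energy w \<ge> 1 / (cmod w + M)\<^sup>2"
proof -
  have "(\<integral>t. 1 / (cmod w + M)\<^sup>2 \<partial>\<mu>) \<le> energy w"
    unfolding energy_def
  proof (rule integral_mono_AE)
    show "AE t in \<mu>. 1 / (cmod w + M)\<^sup>2 \<le> (cmod (1 / (w - complex_of_real t)))\<^sup>2"
      using AE_bounded
    proof eventually_elim
      fix t assume "\<bar>t\<bar> \<le> M"
      then have "cmod (w - complex_of_real t) \<le> cmod w + M"
        using norm_triangle_ineq4[of w "complex_of_real t"] by simp
      moreover have "cmod (w - complex_of_real t) > 0"
        using diff_of_real_nonzero[OF assms] by simp
      ultimately show "1 / (cmod w + M)\<^sup>2 \<le> (cmod (1 / (w - complex_of_real t)))\<^sup>2"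
        by (auto simp: norm_divide power_divide intro!: frac_le power_mono zero_less_power)
    qed
  qed (use integrable_energy[OF assms] in auto)
  then show ?thesis by (simp add: prob_space)
qed

lemma energy_pos: "Im w > 0 \<Longrightarrow> energy w > 0"
  using energy_lower_bound[of w] bound_nonneg
  by (smt (verit) complex_eq_0 divide_pos_pos norm_le_zero_iff zero_complex.simps(2) zero_less_power)

lemma cauchy_transform_nonzero: "Im w > 0 \<Longrightarrow> cauchy_transform \<mu> w \<noteq> 0"
  using Im_cauchy_transform[of w] energy_pos[of w] by auto

lemma Im_reciprocal_cauchy_transform:
  assumes "Im w > 0"
  shows "Im (1 / cauchy_transform \<mu> w) = Im w * energy w / (cmod (cauchy_transform \<mu> w))\<^sup>2"
  using Im_cauchy_transform[OF assms] by (simp add: Im_divide cmod_power2)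

text \<open>For F = 1 / G one has Im F(w) = Im w * energy(w) / |G(w)|^2, and the energy dominates
  |G|^2. So F - id has nonnegative imaginary part, which keeps the subordination map inside a
  half-plane.\<close>

lemma Im_le_Im_reciprocal:
  assumes "Im w > 0"
  shows "Im w \<le> Im (1 / cauchy_transform \<mu> w)"
  unfolding Im_reciprocal_cauchy_transform[OF assms]
  using cmod_cauchy_transform_le_energy[OF assms] cauchy_transform_nonzero[OF assms] assms
  by (simp add: pos_le_divide_eq)

text \<open>The resolvent identity makes G Lipschitz with constant 1 / y^2 on this
  half-plane.\<close>

lemma continuous_cauchy_transform:
  assumes "y > 0"
  shows "continuous_on {w. Im w \<ge> y} (cauchy_transform \<mu>)"
proof (rule lipschitz_on_continuous_on[OF lipschitz_onI])
  fix v w assume "v \<in> {w. Im w \<ge> y}" "w \<in> {w. Im w \<ge> y}"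
  then have v: "Im v > 0" "Im v \<ge> y" and w: "Im w > 0" "Im w \<ge> y" using assms by auto
  have "cauchy_transform \<mu> v - cauchy_transform \<mu> w
      = (\<integral>t. 1 / (v - complex_of_real t) - 1 / (w - complex_of_real t) \<partial>\<mu>)"
    unfolding cauchy_transform_def by (simp add: integrable_inverse_diff v w)
  also have "norm \<dots> \<le> (\<integral>t. 1 / y\<^sup>2 * dist v w \<partial>\<mu>)"
  proof (rule Bochner_Integration.integral_norm_bound_integral)
    fix t
    have "1 / (v - complex_of_real t) - 1 / (w - complex_of_real t)
        = (1 / (v - complex_of_real t)) * (1 / (w - complex_of_real t)) * (w - v)"
      using diff_of_real_nonzero[OF v(1), of t] diff_of_real_nonzero[OF w(1), of t]
      by (simp add: field_simps)
    also have "norm \<dots> \<le> (1 / y) * (1 / y) * dist v w"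
      unfolding norm_mult dist_norm norm_minus_commute[of v w]
    proof (intro mult_mono)
      show "cmod (1 / (v - complex_of_real t)) \<le> 1 / y" "cmod (1 / (w - complex_of_real t)) \<le> 1 / y"
        using cmod_inverse_diff_le[OF v(1), of t] cmod_inverse_diff_le[OF w(1), of t] v w assms
        by (smt (verit) frac_le)+
    qed (use assms in auto)
    finally show "norm (1 / (v - complex_of_real t) - 1 / (w - complex_of_real t)) \<le> 1 / y\<^sup>2 * dist v w"
      by (simp add: power2_eq_square)
  qed (auto simp: integrable_inverse_diff v w)
  finally show "dist (cauchy_transform \<mu> v) (cauchy_transform \<mu> w) \<le> 1 / y\<^sup>2 * dist v w"
    by (simp add: dist_norm prob_space)
qed (use assms in auto)

text \<open>F(w) - w = (1 - w G(w)) / G(w). For |w| <= 3M + 1 the numerator is bounded and |G| is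
  bounded below; for larger |w| the numerator is at most M / (|w| - M) and |G| at least 1 / (3 (|w|
  - M)). The bound supplies the compact set for Brouwer's theorem.\<close>

lemma reciprocal_minus_id_bounded:
  assumes y: "y > 0"
  obtains K where "K > 0" "\<And>w. Im w \<ge> y \<Longrightarrow> cmod (1 / cauchy_transform \<mu> w - w) \<le> K"
proof -
  have M: "M \<ge> 0" by (rule bound_nonneg)
  \<comment> \<open>1 - w G(w) is the integral of - t / (w - t), and |t| <= M almost
    everywhere.\<close>
  have numerator: "cmod (1 - w * cauchy_transform \<mu> w) \<le> M * B"
    if w: "Im w > 0" and B: "\<And>t. \<bar>t\<bar> \<le> M \<Longrightarrow> cmod (1 / (w - complex_of_real t)) \<le> B" for w B
  proof -
    have "1 - w * cauchy_transform \<mu> w = (\<integral>t. 1 - w * (1 / (w - complex_of_real t)) \<partial>\<mu>)"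
      unfolding cauchy_transform_def using integrable_inverse_diff[OF w]
      by (simp add: prob_space del: times_divide_eq_right)
    also have "cmod \<dots> \<le> (\<integral>t. cmod (1 - w * (1 / (w - complex_of_real t))) \<partial>\<mu>)"
      by (rule integral_norm_bound)
    also have "\<dots> \<le> (\<integral>t. M * B \<partial>\<mu>)"
    proof (rule integral_mono_AE)
      show "AE t in \<mu>. cmod (1 - w * (1 / (w - complex_of_real t))) \<le> M * B"
        using AE_bounded
      proof eventually_elim
        fix t assume t: "\<bar>t\<bar> \<le> M"
        have "1 - w * (1 / (w - complex_of_real t)) = - complex_of_real t * (1 / (w - complex_of_real t))"
          using diff_of_real_nonzero[OF w, of t] by (simp add: field_simps)
        then show "cmod (1 - w * (1 / (w - complex_of_real t))) \<le> M * B"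
          using t B[OF t] by (simp only: norm_mult norm_minus_cancel norm_of_real) (intro mult_mono, auto)
      qed
    qed (use integrable_inverse_diff[OF w] in \<open>auto simp del: times_divide_eq_right\<close>)
    finally show ?thesis by (simp add: prob_space)
  qed
  \<comment> \<open>\<open>3 * M\<close> serves the far regime and the product the near one, where
    |w| + M <= 4M + 1; the final 1 keeps K positive when M = 0.\<close>
  define K where "K = 3 * M + (M / y) * ((4 * M + 1)\<^sup>2 / y) + 1"
  show thesis
  proof (rule that[of K])
    show "K > 0" using M y unfolding K_def by (auto intro!: add_nonneg_pos add_nonneg_nonneg)
  next
    fix w assume wy: "Im w \<ge> y"
    then have w: "Im w > 0" using y by simp
    let ?G = "cauchy_transform \<mu> w"
    have G0: "?G \<noteq> 0" using cauchy_transform_nonzero[OF w] .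
    have eq: "1 / ?G - w = (1 - w * ?G) / ?G" using G0 by (simp add: field_simps)
    show "cmod (1 / ?G - w) \<le> K"
    proof (cases "cmod w \<le> 3 * M + 1")
      case True
      have "cmod w + M \<le> 4 * M + 1" "cmod w + M > 0" using True M w
        by (auto intro!: add_pos_nonneg simp: complex_eq_iff)
      then have "y / (4 * M + 1)\<^sup>2 \<le> Im w * (1 / (cmod w + M)\<^sup>2)"
        using wy y by (auto intro!: frac_le power_mono)
      also have "\<dots> \<le> Im w * energy w" using energy_lower_bound[OF w] w by (intro mult_left_mono) auto
      also have "\<dots> \<le> cmod ?G" using abs_Im_le_cmod[of ?G] Im_cauchy_transform[OF w] by simp
      finally have G: "y / (4 * M + 1)\<^sup>2 \<le> cmod ?G" .
      have "cmod (1 - w * ?G) \<le> M * (1 / y)"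
      proof (rule numerator[OF w])
        show "cmod (1 / (w - complex_of_real t)) \<le> 1 / y" for t
          using cmod_inverse_diff_le[OF w, of t] wy y by (smt (verit) frac_le)
      qed
      then have "cmod (1 - w * ?G) / cmod ?G \<le> (M * (1 / y)) / (y / (4 * M + 1)\<^sup>2)"
        by (intro frac_le) (use G M y in auto)
      then show ?thesis using M unfolding eq norm_divide K_def by simp
    next
      case False
      let ?r = "cmod w"
      have r: "?r > 3 * M + 1" using False by simp
      have "cmod (1 - w * ?G) \<le> M * (1 / (?r - M))"
      proof (rule numerator[OF w])
        fix t assume "\<bar>t\<bar> \<le> M"
        then have "?r - M \<le> cmod (w - complex_of_real t)"
          using norm_triangle_ineq2[of w "complex_of_real t"] by simp
        then show "cmod (1 / (w - complex_of_real t)) \<le> 1 / (?r - M)"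
          using r M by (auto simp: norm_divide intro!: frac_le)
      qed
      then have n: "cmod (1 - w * ?G) * (?r - M) \<le> M" using r M by (simp add: field_simps)
      have "1 \<le> cmod (1 - w * ?G) + ?r * cmod ?G"
        using norm_triangle_ineq[of "1 - w * ?G" "w * ?G"] by (simp add: norm_mult)
      then have "1 * (?r - M) \<le> (cmod (1 - w * ?G) + ?r * cmod ?G) * (?r - M)"
        using r M by (intro mult_right_mono) auto
      then have "?r - M \<le> M + ?r * (cmod ?G * (?r - M))"
        using n by (simp add: algebra_simps)
      \<comment> \<open>Since |w| > 3M, also |w| - 2M >= |w| / 3.\<close>
      then have "?r / 3 \<le> ?r * (cmod ?G * (?r - M))" using r M by linarith
      then have "?r * 1 \<le> ?r * (3 * (cmod ?G * (?r - M)))" by simp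
      moreover have "?r > 0" using r M by linarith
      ultimately have g: "1 \<le> 3 * (cmod ?G * (?r - M))" by (simp only: mult_le_cancel_left_pos)
      have "M * 1 \<le> M * (3 * (cmod ?G * (?r - M)))" using g M by (intro mult_left_mono)
      then have "cmod (1 - w * ?G) * (?r - M) \<le> (3 * M * cmod ?G) * (?r - M)"
        using n by (simp add: mult_ac)
      then have "cmod (1 - w * ?G) \<le> 3 * M * cmod ?G" using r M by simp
      then have "cmod (1 / ?G - w) \<le> 3 * M"
        unfolding eq norm_divide using G0 by (simp add: field_simps)
      then show ?thesis using M y unfolding K_def
        by (smt (verit) divide_nonneg_nonneg mult_nonneg_nonneg zero_le_power2)
    qed
  qed
qed

end

section \<open>Solving the subordination equations\<close>

text \<open>Let H_i = F_i - id with F_i the reciprocal Cauchy transforms. A fixed point w of the map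
  w -> z + H2(z + H1 w) gives the solution \<open>\<omega>\<^sub>1\<close> = w,
  \<open>\<omega>\<^sub>2\<close> = z + H1 w: the fixed point equation becomes F1 = F2 at these
  points, and the definition of H1 gives their sum.\<close>

lemma subordination_fixed_point:
  assumes "bounded_distribution \<mu>\<^sub>1 M" and "bounded_distribution \<mu>\<^sub>2 M" and z: "Im z > 0"
  obtains \<omega>\<^sub>1 \<omega>\<^sub>2 where "Im \<omega>\<^sub>1 \<ge> Im z" "Im \<omega>\<^sub>2 \<ge> Im z"
    "cauchy_transform \<mu>\<^sub>1 \<omega>\<^sub>1 = cauchy_transform \<mu>\<^sub>2 \<omega>\<^sub>2"
    "\<omega>\<^sub>1 + \<omega>\<^sub>2 = z + 1 / cauchy_transform \<mu>\<^sub>1 \<omega>\<^sub>1"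
proof -
  interpret m1: bounded_distribution \<mu>\<^sub>1 M by fact
  interpret m2: bounded_distribution \<mu>\<^sub>2 M by fact
  define H1 where "H1 w = 1 / cauchy_transform \<mu>\<^sub>1 w - w" for w
  define H2 where "H2 w = 1 / cauchy_transform \<mu>\<^sub>2 w - w" for w
  obtain K where K: "K > 0" "\<And>w. Im w \<ge> Im z \<Longrightarrow> cmod (H2 w) \<le> K"
    using m2.reciprocal_minus_id_bounded[OF z] unfolding H2_def by blast
  let ?U = "{w. Im w \<ge> Im z}"
  let ?S = "cball z K \<inter> ?U"
  have H1: "Im (H1 w) \<ge> 0" "Im (H2 w) \<ge> 0" if "w \<in> ?U" for w
    using m1.Im_le_Im_reciprocal[of w] m2.Im_le_Im_reciprocal[of w] that z
    unfolding H1_def H2_def by auto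
  have c: "continuous_on ?U H1" "continuous_on ?U H2"
    unfolding H1_def H2_def using z m1.cauchy_transform_nonzero m2.cauchy_transform_nonzero
    by (intro continuous_intros m1.continuous_cauchy_transform m2.continuous_cauchy_transform;
        force)+
  \<comment> \<open>The bound |H2| <= K keeps the image in the ball, and Im H1, Im H2 >= 0 keep it
    in the half-plane.\<close>
  obtain w where w: "w \<in> ?S" "z + H2 (z + H1 w) = w"
  proof (rule brouwer[of ?S "\<lambda>w. z + H2 (z + H1 w)"])
    have U: "?U = {w. Im z \<le> inner \<i> w}" by (auto simp: inner_complex_def)
    have "closed ?U" "convex ?U" by (simp_all only: U closed_halfspace_ge convex_halfspace_ge)
    then show "compact ?S" "convex ?S" by (auto intro: convex_Int)
    have "z \<in> ?S" using K(1) by simp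
    then show "?S \<noteq> {}" by blast
    show "continuous_on ?S (\<lambda>w. z + H2 (z + H1 w))"
      by (intro continuous_intros continuous_on_compose2[OF c(2)] continuous_on_subset[OF c(1)])
        (use H1 in auto)
    show "(\<lambda>w. z + H2 (z + H1 w)) \<in> ?S \<rightarrow> ?S"
      using H1 K by (auto simp: dist_norm)
  qed blast
  have "Im w \<ge> Im z" "Im (z + H1 w) \<ge> Im z" using w H1 by auto
  moreover have "1 / cauchy_transform \<mu>\<^sub>1 w = 1 / cauchy_transform \<mu>\<^sub>2 (z + H1 w)"
    using w(2) unfolding H1_def[of w] H2_def by (simp add: algebra_simps)
  moreover have "w + (z + H1 w) = z + 1 / cauchy_transform \<mu>\<^sub>1 w" by (simp add: H1_def)
  ultimately show thesis by (intro that[of w "z + H1 w"]) auto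
qed


section \<open>States and free self-adjoint pairs\<close>

lemma adj_zero [simp]: "(0::'a::cstar_algebra)\<^sup>\<star> = 0"
  using adj_add[of "0::'a" 0] by simp

lemma adj_one [simp]: "(1::'a::cstar_algebra)\<^sup>\<star> = 1"
  using adj_mult[of "1::'a" "1\<^sup>\<star>"] by (simp add: adj_adj)

lemma scaleC_one_mult: "(c *\<^sub>C 1) * x = c *\<^sub>C x" for x :: "'a::cstar_algebra"
  by (simp add: scaleC_mult_left)

lemma mult_scaleC_one: "x * (c *\<^sub>C 1) = c *\<^sub>C x" for x :: "'a::cstar_algebra"
  by (simp add: scaleC_mult_right)

definition poly_eval :: "'a::cstar_algebra \<Rightarrow> complex poly \<Rightarrow> 'a" where
  "poly_eval a p = fold_coeffs (\<lambda>c x. c *\<^sub>C 1 + a * x) p 0"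

lemma poly_eval_0 [simp]: "poly_eval a 0 = 0"
  by (simp add: poly_eval_def)

lemma poly_eval_pCons [simp]: "poly_eval a (pCons c p) = c *\<^sub>C 1 + a * poly_eval a p"
  by (cases "p = 0 \<and> c = 0") (auto simp: poly_eval_def)

lemma poly_eval_1 [simp]: "poly_eval a 1 = 1"
  by (simp add: one_pCons scaleC_one)

lemma poly_eval_add: "poly_eval a (p + q) = poly_eval a p + poly_eval a q"
  by (induction p q rule: poly_induct2) (simp_all add: scaleC_add_left algebra_simps)

lemma poly_eval_smult: "poly_eval a (smult c p) = c *\<^sub>C poly_eval a p"
  by (induction p) (simp_all add: scaleC_add_right scaleC_scaleC scaleC_mult_right)

lemma poly_eval_minus: "poly_eval a (- p) = - poly_eval a p"
  using poly_eval_add[of a p "- p"] by (simp add: eq_neg_iff_add_eq_0 add.commute)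

lemma poly_eval_diff: "poly_eval a (p - q) = poly_eval a p - poly_eval a q"
  using poly_eval_add[of a p "- q"] by (simp add: poly_eval_minus)

lemma poly_eval_mult: "poly_eval a (p * q) = poly_eval a p * poly_eval a q"
  by (induction p) (simp_all add: poly_eval_add poly_eval_smult scaleC_mult_left algebra_simps)

lemma poly_eval_commute: "a * poly_eval a p = poly_eval a p * a"
proof (induction p)
  case (pCons c p)
  have "a * (a * poly_eval a p) = a * (poly_eval a p * a)" by (simp only: pCons.IH)
  then have "a * (a * poly_eval a p) = a * poly_eval a p * a" by (simp only: mult.assoc)
  then show ?case by (simp add: distrib_left distrib_right scaleC_mult_left scaleC_mult_right)
qed simp

lemma adj_poly_eval:
  assumes "a\<^sup>\<star> = a"
  shows "(poly_eval a p)\<^sup>\<star> = poly_eval a (map_poly cnj p)"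
proof (induction p)
  case (pCons c p)
  then show ?case
    by (simp add: map_poly_pCons adj_add adj_mult adj_scaleC assms poly_eval_commute)
qed simp

section \<open>The L2 seminorm of a state\<close>

locale positive_state =
  fixes \<phi> :: "'a::cstar_algebra \<Rightarrow> complex"
  assumes linear: "Vector_Spaces.linear (*\<^sub>C) (*) \<phi>"
    and unital: "\<phi> 1 = 1"
    and positive: "\<phi> (x\<^sup>\<star> * x) \<in> \<real>\<^sub>\<ge>\<^sub>0"
begin

interpretation \<phi>: Vector_Spaces.linear "(*\<^sub>C)" "(*)" \<phi> by (rule linear)

lemmas state_add = \<phi>.add and state_diff = \<phi>.diff and state_scaleC = \<phi>.scale
  and state_zero = \<phi>.zero and state_sum = \<phi>.sum

text \<open>The seminorm of the GNS construction.\<close>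

definition nrm :: "'a \<Rightarrow> real" where
  "nrm x = sqrt (Re (\<phi> (x\<^sup>\<star> * x)))"

lemma nrm_nonneg [simp]: "nrm x \<ge> 0"
  using positive[of x] by (auto simp: nrm_def nonneg_Reals_def)

lemma state_square: "\<phi> (x\<^sup>\<star> * x) = of_real ((nrm x)\<^sup>2)"
  using positive[of x] by (auto simp: nrm_def nonneg_Reals_def simp flip: of_real_power)

lemma nrm_square: "(nrm x)\<^sup>2 = Re (\<phi> (x\<^sup>\<star> * x))"
  using state_square[of x] by simp

lemma nrm_eqI: "\<phi> (x\<^sup>\<star> * x) = of_real (c\<^sup>2) \<Longrightarrow> c \<ge> 0 \<Longrightarrow> nrm x = c"
  by (simp add: nrm_def)

lemma state_expand:
  "\<phi> ((x + c *\<^sub>C y)\<^sup>\<star> * (x + c *\<^sub>C y))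
     = \<phi> (x\<^sup>\<star> * x) + c * \<phi> (x\<^sup>\<star> * y) + cnj c * \<phi> (y\<^sup>\<star> * x) + c * cnj c * \<phi> (y\<^sup>\<star> * y)"
  by (simp add: adj_add adj_scaleC distrib_left distrib_right state_add state_scaleC
      scaleC_mult_left scaleC_mult_right scaleC_scaleC)

text \<open>Polarization: the state is real on squares of x + c y, and c = 1 and c = i give the two
  real equations needed.\<close>

lemma state_hermitian: "\<phi> (x\<^sup>\<star> * y) = cnj (\<phi> (y\<^sup>\<star> * x))"
proof -
  have *: "Im (c * \<phi> (x\<^sup>\<star> * y) + cnj c * \<phi> (y\<^sup>\<star> * x)) = 0" if "cmod c = 1" for c
  proof -
    have "c * cnj c = 1" using that complex_norm_square[of c] by simp
    then have "of_real ((nrm (x + c *\<^sub>C y))\<^sup>2)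
        = of_real ((nrm x)\<^sup>2) + (c * \<phi> (x\<^sup>\<star> * y) + cnj c * \<phi> (y\<^sup>\<star> * x)) + of_real ((nrm y)\<^sup>2)"
      using state_expand[of x c y] by (simp add: state_square)
    then have "Im (of_real ((nrm (x + c *\<^sub>C y))\<^sup>2))
        = Im (of_real ((nrm x)\<^sup>2) + (c * \<phi> (x\<^sup>\<star> * y) + cnj c * \<phi> (y\<^sup>\<star> * x)) + of_real ((nrm y)\<^sup>2))"
      by (rule arg_cong)
    then show ?thesis by (simp del: of_real_power)
  qed
  show ?thesis using *[of 1] *[of \<i>] by (simp add: complex_eq_iff)
qed

lemma state_Cauchy_Schwarz: "cmod (\<phi> (x\<^sup>\<star> * y)) \<le> nrm x * nrm y"
proof -
  let ?s = "\<phi> (x\<^sup>\<star> * y)"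
  have ineq: "2 * r * (cmod ?s)\<^sup>2 \<le> (nrm x)\<^sup>2 + r\<^sup>2 * (cmod ?s)\<^sup>2 * (nrm y)\<^sup>2" for r :: real
  proof -
    \<comment> \<open>This choice removes the phase of the inner product and leaves a real quadratic
      inequality in r.\<close>
    define c where "c = - of_real r * cnj ?s"
    have "Re (\<phi> ((x + c *\<^sub>C y)\<^sup>\<star> * (x + c *\<^sub>C y))) \<ge> 0"
      using positive[of "x + c *\<^sub>C y"] by (auto simp: nonneg_Reals_def)
    moreover have "\<phi> ((x + c *\<^sub>C y)\<^sup>\<star> * (x + c *\<^sub>C y))
        = of_real ((nrm x)\<^sup>2 - 2 * r * (cmod ?s)\<^sup>2 + r\<^sup>2 * (cmod ?s)\<^sup>2 * (nrm y)\<^sup>2)"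
      using complex_norm_square[of ?s]
      by (subst state_expand)
        (simp add: state_hermitian[of y x] state_square[of x] state_square[of y] c_def
          power2_eq_square mult_ac)
    ultimately show ?thesis by (simp del: of_real_power)
  qed
  have "(cmod ?s)\<^sup>2 \<le> (nrm x)\<^sup>2 * (nrm y)\<^sup>2"
  proof (cases "nrm y = 0")
    case True
    have "(cmod ?s)\<^sup>2 = 0"
    proof (rule ccontr)
      assume "(cmod ?s)\<^sup>2 \<noteq> 0"
      \<comment> \<open>If y is a null vector, the inequality is linear in r, and this large r
        contradicts it.\<close>
      moreover have "2 * (((nrm x)\<^sup>2 + 1) / (2 * (cmod ?s)\<^sup>2)) * (cmod ?s)\<^sup>2 \<le> (nrm x)\<^sup>2"
        using ineq[of "((nrm x)\<^sup>2 + 1) / (2 * (cmod ?s)\<^sup>2)"] True by simp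
      ultimately show False by simp
    qed
    then show ?thesis by simp
  next
    case False
    then have "(nrm y)\<^sup>2 > 0" by simp
    \<comment> \<open>The optimal value of r.\<close>
    moreover have "2 * (1 / (nrm y)\<^sup>2) * (cmod ?s)\<^sup>2 \<le> (nrm x)\<^sup>2 + (cmod ?s)\<^sup>2 / (nrm y)\<^sup>2"
      using ineq[of "1 / (nrm y)\<^sup>2"] False by (simp add: field_simps power2_eq_square)
    ultimately show ?thesis by (simp add: field_simps)
  qed
  then show ?thesis
    by (metis abs_norm_cancel nrm_nonneg mult_nonneg_nonneg power_mult_distrib power2_le_imp_le)
qed

lemma nrm_add: "nrm (x + y) \<le> nrm x + nrm y"
proof (rule power2_le_imp_le)
  have "(nrm (x + y))\<^sup>2 = (nrm x)\<^sup>2 + 2 * Re (\<phi> (x\<^sup>\<star> * y)) + (nrm y)\<^sup>2"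
    using state_expand[of x 1 y] state_hermitian[of y x] by (simp add: scaleC_one nrm_square)
  also have "Re (\<phi> (x\<^sup>\<star> * y)) \<le> nrm x * nrm y"
    using state_Cauchy_Schwarz[of x y] complex_Re_le_cmod order_trans by blast
  finally show "(nrm (x + y))\<^sup>2 \<le> (nrm x + nrm y)\<^sup>2" by (simp add: power2_sum)
qed simp

lemma nrm_minus [simp]: "nrm (- x) = nrm x"
proof -
  have "(- x)\<^sup>\<star> = - (x\<^sup>\<star>)"
    using adj_add[of x "- x"] by (simp add: eq_neg_iff_add_eq_0 add.commute)
  then show ?thesis by (simp add: nrm_def)
qed

lemma nrm_zero [simp]: "nrm 0 = 0"
  by (simp add: nrm_def state_zero)

lemma nrm_sum: "nrm (\<Sum>n\<in>N. f n) \<le> (\<Sum>n\<in>N. nrm (f n))"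
proof (induction N rule: infinite_finite_induct)
  case (insert n N)
  then show ?case using nrm_add[of "f n" "sum f N"] by simp
qed auto

text \<open>p(a) is normal, since it commutes with its adjoint, again a polynomial in a.\<close>

lemma nrm_adj_poly_eval:
  assumes "a\<^sup>\<star> = a"
  shows "nrm ((poly_eval a p)\<^sup>\<star>) = nrm (poly_eval a p)"
  by (simp only: nrm_def adj_adj)
    (simp add: adj_poly_eval assms poly_eval_mult[symmetric] mult.commute)

text \<open>Cauchy-Schwarz with the adjoint of p(a) as left vector, whose seminorm is that of
  p(a).\<close>

lemma state_poly_eval_mult_le:
  assumes "a\<^sup>\<star> = a"
  shows "cmod (\<phi> (poly_eval a p * x)) \<le> nrm (poly_eval a p) * nrm x"
  using state_Cauchy_Schwarz[of "(poly_eval a p)\<^sup>\<star>" x] assms by (simp add: nrm_adj_poly_eval adj_adj)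

end

section \<open>Alternating words in a free pair\<close>

text \<open>The Boolean tags the algebra, \<open>True\<close> for the first. Keeping the polynomial
  instead of its value lets adjoints, products and centering act on letters.\<close>

definition letter :: "'a::cstar_algebra \<Rightarrow> 'a \<Rightarrow> bool \<times> complex poly \<Rightarrow> 'a" where
  "letter a\<^sub>1 a\<^sub>2 l = poly_eval (if fst l then a\<^sub>1 else a\<^sub>2) (snd l)"

definition alternating :: "(bool \<times> 'b) list \<Rightarrow> bool" where
  "alternating = successively (\<lambda>k l. fst k \<noteq> fst l)"

text \<open>Freeness, in moment form, of the unital polynomial algebras generated by the two
  elements.\<close>

definition free_pair :: "('a::cstar_algebra \<Rightarrow> complex) \<Rightarrow> 'a \<Rightarrow> 'a \<Rightarrow> bool" where
  "free_pair \<phi> a\<^sub>1 a\<^sub>2 \<longleftrightarrow> (\<forall>ws. ws \<noteq> [] \<longrightarrow> alternating ws \<longrightarrow>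
     (\<forall>l\<in>set ws. \<phi> (letter a\<^sub>1 a\<^sub>2 l) = 0) \<longrightarrow> \<phi> (prod_list (map (letter a\<^sub>1 a\<^sub>2) ws)) = 0)"

lemma alternating_Cons: "alternating (l # ws) \<longleftrightarrow> (ws = [] \<or> fst l \<noteq> fst (hd ws) \<and> alternating ws)"
  by (cases ws) (auto simp: alternating_def)

lemma alternating_append:
  "alternating (us @ ws) \<longleftrightarrow> alternating us \<and> alternating ws \<and>
     (us = [] \<or> ws = [] \<or> fst (last us) \<noteq> fst (hd ws))"
  by (auto simp: alternating_def successively_append_iff)

lemma alternating_rev: "alternating (rev ws) \<longleftrightarrow> alternating ws"
  unfolding alternating_def successively_rev
  by (intro arg_cong2[where f = successively] ext) auto

lemma alternating_map:
  assumes "\<And>l. fst (f l) = fst l"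
  shows "alternating (map f ws) \<longleftrightarrow> alternating ws"
  by (simp only: alternating_def successively_map assms)

locale free_selfadjoint_pair = positive_state \<phi> for \<phi> :: "'a::cstar_algebra \<Rightarrow> complex" +
  fixes a\<^sub>1 a\<^sub>2 :: 'a
  assumes selfadjoint: "a\<^sub>1\<^sup>\<star> = a\<^sub>1" "a\<^sub>2\<^sup>\<star> = a\<^sub>2"
    and free: "free_pair \<phi> a\<^sub>1 a\<^sub>2"
begin

abbreviation L :: "bool \<times> complex poly \<Rightarrow> 'a" where "L \<equiv> letter a\<^sub>1 a\<^sub>2"

abbreviation wprod :: "(bool \<times> complex poly) list \<Rightarrow> 'a" where "wprod ws \<equiv> prod_list (map L ws)"

definition adj_letter :: "bool \<times> complex poly \<Rightarrow> bool \<times> complex poly" where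
  "adj_letter l = (fst l, map_poly cnj (snd l))"

lemma fst_adj_letter [simp]: "fst (adj_letter l) = fst l"
  by (simp add: adj_letter_def)

lemma letter_adj: "L (adj_letter l) = (L l)\<^sup>\<star>"
  by (simp add: letter_def adj_letter_def adj_poly_eval selfadjoint)

lemma wprod_adj: "(wprod ws)\<^sup>\<star> = wprod (rev (map adj_letter ws))"
  by (induction ws) (simp_all add: adj_mult letter_adj)

lemma state_adj: "\<phi> (x\<^sup>\<star>) = cnj (\<phi> x)"
  using state_hermitian[of x 1] by simp

definition center_letter :: "bool \<times> complex poly \<Rightarrow> bool \<times> complex poly" where
  "center_letter l = (fst l, snd l - [:\<phi> (L l):])"

lemma fst_center_letter [simp]: "fst (center_letter l) = fst l"
  by (simp add: center_letter_def)

lemma letter_center: "L (center_letter l) = L l - \<phi> (L l) *\<^sub>C 1"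
  by (simp add: letter_def center_letter_def poly_eval_diff)

lemma state_center_letter [simp]: "\<phi> (L (center_letter l)) = 0"
  by (simp add: letter_center state_diff state_scaleC unital)

lemma letter_split: "L l = L (center_letter l) + \<phi> (L l) *\<^sub>C 1"
  by (simp add: letter_center)

lemma free_wprod:
  "ws \<noteq> [] \<Longrightarrow> alternating ws \<Longrightarrow> \<forall>l\<in>set ws. \<phi> (L l) = 0 \<Longrightarrow> \<phi> (wprod ws) = 0"
  using free by (auto simp: free_pair_def)

text \<open>Split the first letter into its centered part and a scalar. The scalar part leaves
  \<open>ws\<close>, which is still a nonempty centered alternating word; so the first letter may be
  arbitrary.\<close>

lemma free_wprod_Cons:
  assumes "ws \<noteq> []" "alternating (f # ws)" "\<forall>l\<in>set ws. \<phi> (L l) = 0"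
  shows "\<phi> (wprod (f # ws)) = 0"
proof -
  have "wprod (f # ws) = wprod (center_letter f # ws) + \<phi> (L f) *\<^sub>C wprod ws"
    by (simp add: letter_center left_diff_distrib scaleC_one_mult)
  moreover have "\<phi> (wprod (center_letter f # ws)) = 0"
  proof (rule free_wprod)
    show "alternating (center_letter f # ws)" using assms(2) by (simp add: alternating_Cons)
    show "\<forall>l\<in>set (center_letter f # ws). \<phi> (L l) = 0"
      using assms(3) by auto
  qed simp
  moreover have "\<phi> (wprod ws) = 0"
    using assms by (intro free_wprod) (simp_all add: alternating_Cons)
  ultimately show ?thesis by (simp only: state_add state_scaleC) simp
qed

text \<open>The same splitting at the right end: both outer letters may be uncentered as long as a
  centered letter lies between them.\<close>

lemma free_wprod_interior:
  assumes "ws \<noteq> []" "alternating (f # ws @ [h])" "\<forall>l\<in>set ws. \<phi> (L l) = 0"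
  shows "\<phi> (wprod (f # ws @ [h])) = 0"
proof -
  have "wprod (f # ws @ [h]) = wprod (f # ws @ [center_letter h]) + \<phi> (L h) *\<^sub>C wprod (f # ws)"
    by (simp add: letter_center right_diff_distrib mult_scaleC_one scaleC_mult_right)
  moreover have "\<phi> (wprod (f # ws @ [center_letter h])) = 0"
  proof (rule free_wprod_Cons)
    show "alternating (f # ws @ [center_letter h])" using assms(1,2)
      by (simp add: alternating_Cons alternating_append)
    show "\<forall>l\<in>set (ws @ [center_letter h]). \<phi> (L l) = 0"
      using assms(3) by auto
  qed simp
  moreover have "\<phi> (wprod (f # ws)) = 0"
    using assms by (intro free_wprod_Cons) (simp_all add: alternating_Cons alternating_append)
  ultimately show ?thesis by (simp only: state_add state_scaleC) simp
qed

text \<open>With Y the rest of the word, the square of the norm is the state at Y^* (f^* f) Y. The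
  centered part of f^* f contributes 0 by freeness, and its mean factors out. This replaces operator
  norm bounds by exact L2 identities.\<close>

lemma nrm_wprod_Cons:
  assumes alt: "alternating (f # ws @ [h])" and c: "\<forall>l\<in>set ws. \<phi> (L l) = 0"
  shows "nrm (wprod (f # ws @ [h])) = nrm (L f) * nrm (wprod (ws @ [h]))"
proof (rule nrm_eqI)
  \<comment> \<open>The polynomial of f^* f, a single letter in the algebra of f.\<close>
  define g where "g = (fst f, map_poly cnj (snd f) * snd f)"
  have g: "L g = (L f)\<^sup>\<star> * L f"
    by (simp add: g_def letter_def poly_eval_mult adj_poly_eval selfadjoint)
  let ?Y = "wprod (ws @ [h])"
  let ?us = "rev (map adj_letter ws) @ center_letter g # ws"
  have "?Y\<^sup>\<star> * L (center_letter g) * ?Y = wprod (adj_letter h # ?us @ [h])"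
    unfolding wprod_adj by (simp add: mult.assoc)
  moreover have "\<phi> (wprod (adj_letter h # ?us @ [h])) = 0"
  \<comment> \<open>Only the outer letters h^* and h can fail to be centered.\<close>
  proof (rule free_wprod_interior)
    have 1: "alternating (ws @ [h])" "fst f \<noteq> fst (hd (ws @ [h]))" using alt by (auto simp: alternating_Cons)
    have "alternating (rev (map adj_letter (ws @ [h])))" 
      unfolding alternating_rev using 1 by (subst alternating_map) auto
    moreover have "last (rev (map adj_letter (ws @ [h]))) = adj_letter (hd (ws @ [h]))"
      by (cases ws) auto
    ultimately have "alternating (rev (map adj_letter (ws @ [h])) @ center_letter g # ws @ [h])"
      using 1 by (subst alternating_append) (auto simp: alternating_Cons g_def)
    then show "alternating (adj_letter h # ?us @ [h])" by simp
    show "\<forall>l\<in>set ?us. \<phi> (L l) = 0"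
      using c by (auto simp: letter_adj state_adj)
  qed simp
  ultimately have 0: "\<phi> (?Y\<^sup>\<star> * L (center_letter g) * ?Y) = 0" by simp
  have "(wprod (f # ws @ [h]))\<^sup>\<star> * wprod (f # ws @ [h]) = ?Y\<^sup>\<star> * L g * ?Y"
    unfolding g by (simp add: adj_mult mult.assoc)
  also have "\<dots> = ?Y\<^sup>\<star> * L (center_letter g) * ?Y + \<phi> (L g) *\<^sub>C (?Y\<^sup>\<star> * ?Y)"
    by (subst letter_split[of g])
      (simp add: distrib_left distrib_right mult_scaleC_one scaleC_mult_left)
  finally show "\<phi> ((wprod (f # ws @ [h]))\<^sup>\<star> * wprod (f # ws @ [h])) = of_real ((nrm (L f) * nrm ?Y)\<^sup>2)"
    using 0 by (simp add: state_add state_scaleC state_square g power_mult_distrib)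
qed simp

end


section \<open>Polynomial approximation\<close>

context bounded_distribution
begin

lemma integrable_continuous_fun:
  fixes f :: "real \<Rightarrow> 'b::euclidean_space"
  assumes "continuous_on UNIV f"
  shows "integrable \<mu> f"
proof -
  have [measurable]: "f \<in> borel_measurable borel" by (rule borel_measurable_continuous_onI[OF assms])
  have "bounded (f ` {-M..M})"
    by (intro compact_imp_bounded compact_continuous_image continuous_on_subset[OF assms]) auto
  then obtain B where B: "\<And>t. t \<in> {-M..M} \<Longrightarrow> norm (f t) \<le> B"
    unfolding bounded_iff by blast
  show ?thesis
  proof (rule integrable_const_bound[of _ B])
    show "AE t in \<mu>. norm (f t) \<le> B" using AE_bounded by eventually_elim (auto intro!: B)
  qed measurable
qed

lemma uniform_limit_integral:
  fixes f :: "real \<Rightarrow> 'b::euclidean_space"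
  assumes h: "\<And>k. continuous_on UNIV (h k)" and f: "continuous_on UNIV f"
    and lim: "uniform_limit {-M..M} h f sequentially"
  shows "(\<lambda>k. \<integral>t. h k t \<partial>\<mu>) \<longlonglongrightarrow> (\<integral>t. f t \<partial>\<mu>)"
proof (rule tendstoI)
  fix e :: real assume e: "e > 0"
  then have "\<forall>\<^sub>F k in sequentially. \<forall>t\<in>{-M..M}. dist (h k t) (f t) < e / 2"
    using lim by (auto dest!: uniform_limitD[of _ _ _ _ "e / 2"])
  then show "\<forall>\<^sub>F k in sequentially. dist (\<integral>t. h k t \<partial>\<mu>) (\<integral>t. f t \<partial>\<mu>) < e"
  proof eventually_elim
    fix k assume k: "\<forall>t\<in>{-M..M}. dist (h k t) (f t) < e / 2"
    have int: "integrable \<mu> (h k)" "integrable \<mu> f" using h f by (auto intro: integrable_continuous_fun)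
    have "norm (\<integral>t. h k t - f t \<partial>\<mu>) \<le> (\<integral>t. norm (h k t - f t) \<partial>\<mu>)" by (rule integral_norm_bound)
    also have "\<dots> \<le> (\<integral>t. e / 2 \<partial>\<mu>)"
    proof (rule integral_mono_AE)
      show "AE t in \<mu>. norm (h k t - f t) \<le> e / 2"
        using AE_bounded by eventually_elim (use k in \<open>force simp: dist_norm abs_le_iff intro!: less_imp_le\<close>)
    qed (use int in auto)
    finally show "dist (\<integral>t. h k t \<partial>\<mu>) (\<integral>t. f t \<partial>\<mu>) < e"
      using e int by (simp add: dist_norm prob_space)
  qed
qed

text \<open>Uniform convergence is asked on [-M, M], which carries the measure; continuity on the
  whole line makes f measurable.\<close>

definition poly_limit :: "(nat \<Rightarrow> complex poly) \<Rightarrow> (real \<Rightarrow> complex) \<Rightarrow> bool" where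
  "poly_limit p f \<longleftrightarrow> continuous_on UNIV f \<and>
     uniform_limit {-M..M} (\<lambda>k t. poly (p k) (complex_of_real t)) f sequentially"

definition l2 :: "(real \<Rightarrow> complex) \<Rightarrow> real" where
  "l2 f = sqrt (\<integral>t. (cmod (f t))\<^sup>2 \<partial>\<mu>)"

lemma poly_limit_integral:
  "poly_limit p f \<Longrightarrow> (\<lambda>k. \<integral>t. poly (p k) (complex_of_real t) \<partial>\<mu>) \<longlonglongrightarrow> (\<integral>t. f t \<partial>\<mu>)"
  unfolding poly_limit_def by (intro uniform_limit_integral continuous_intros) auto

lemma bounded_continuous_image:
  "continuous_on UNIV f \<Longrightarrow> bounded (f ` {-M..M})" for f :: "real \<Rightarrow> 'b::metric_space"
  by (intro compact_imp_bounded compact_continuous_image) (auto intro: continuous_on_subset)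

lemma poly_limit_l2:
  assumes "poly_limit p f"
  shows "(\<lambda>k. l2 (\<lambda>t. poly (p k) (complex_of_real t))) \<longlonglongrightarrow> l2 f"
  unfolding l2_def
proof (intro tendsto_real_sqrt uniform_limit_integral)
  have f: "continuous_on UNIV f" using assms by (simp add: poly_limit_def)
  then show c: "continuous_on UNIV (\<lambda>t. (cmod (f t))\<^sup>2)" by (intro continuous_intros)
  show "continuous_on UNIV (\<lambda>t. (cmod (poly (p k) (complex_of_real t)))\<^sup>2)" for k
    by (intro continuous_intros)
  have "bounded ((\<lambda>t. cmod (f t)) ` {-M..M})"
    by (intro bounded_continuous_image continuous_intros f)
  moreover have "uniform_limit {-M..M} (\<lambda>k t. cmod (poly (p k) (complex_of_real t)))
      (\<lambda>t. cmod (f t)) sequentially"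
    using assms unfolding poly_limit_def by (intro uniform_limit_norm) auto
  ultimately show "uniform_limit {-M..M} (\<lambda>k t. (cmod (poly (p k) (complex_of_real t)))\<^sup>2)
      (\<lambda>t. (cmod (f t))\<^sup>2) sequentially"
    unfolding power2_eq_square by (intro uniform_lim_mult)
qed

lemma poly_limit_add: "poly_limit p f \<Longrightarrow> poly_limit (\<lambda>k. p k + q) (\<lambda>t. f t + poly q (complex_of_real t))"
  unfolding poly_limit_def by (auto intro!: continuous_intros uniform_limit_intros)

lemma poly_limit_mult:
  assumes "poly_limit p f"
  shows "poly_limit (\<lambda>k. q * p k) (\<lambda>t. poly q (complex_of_real t) * f t)"
  using assms unfolding poly_limit_def poly_mult
  by (intro conjI continuous_intros uniform_lim_mult uniform_limit_const bounded_continuous_image) auto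

text \<open>Stone-Weierstrass gives polynomial functions of a real variable; their real and
  imaginary parts combine into one complex polynomial.\<close>

lemma poly_limit_exists:
  assumes f: "continuous_on UNIV f"
  obtains p where "poly_limit p f"
proof -
  have *: "\<exists>p::complex poly. \<forall>t. poly p (complex_of_real t) = complex_of_real (g t)"
    if g: "real_polynomial_function g" for g :: "real \<Rightarrow> real"
  proof -
    obtain c n where c: "g = (\<lambda>x. \<Sum>i\<le>n. c i * x ^ i)" using real_polynomial_function_imp_sum[OF g] by auto
    show ?thesis
      by (rule exI[of _ "\<Sum>i\<le>n. monom (complex_of_real (c i)) i"]) (simp add: c poly_sum poly_monom)
  qed
  have "\<exists>p. \<forall>t\<in>{-M..M}. cmod (f t - poly p (complex_of_real t)) < 1 / Suc k" for k
  proof -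
    obtain g where g: "polynomial_function g" "\<forall>t\<in>{-M..M}. norm (f t - g t) < 1 / Suc k"
      using Stone_Weierstrass_polynomial_function[of "{-M..M}" f "1 / Suc k"]
        continuous_on_subset[OF f] by auto
    obtain p where p: "\<And>t. poly p (complex_of_real t) = complex_of_real (Re (g t))"
      using *[of "Re \<circ> g"] g(1) bounded_linear_Re unfolding polynomial_function_def by auto
    obtain q where q: "\<And>t. poly q (complex_of_real t) = complex_of_real (Im (g t))"
      using *[of "Im \<circ> g"] g(1) bounded_linear_Im unfolding polynomial_function_def by auto
    have "poly (p + smult \<i> q) (complex_of_real t) = g t" for t
      by (simp add: p q complex_eq_iff)
    then show ?thesis using g(2) by (intro exI[of _ "p + smult \<i> q"]) (simp del: poly_add poly_smult)
  qed
  then obtain p where p: "\<And>k t. t \<in> {-M..M} \<Longrightarrow> cmod (f t - poly (p k) (complex_of_real t)) < 1 / Suc k"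
    by metis
  have "poly_limit p f"
    unfolding poly_limit_def
  proof (intro conjI f uniform_limitI)
    fix e :: real assume "e > 0"
    then have "\<forall>\<^sub>F k in sequentially. 1 / real (Suc k) < e"
      using order_tendstoD(2)[OF LIMSEQ_inverse_real_of_nat] by (simp add: inverse_eq_divide)
    then show "\<forall>\<^sub>F k in sequentially. \<forall>t\<in>{-M..M}. dist (poly (p k) (complex_of_real t)) (f t) < e"
    proof eventually_elim
      fix k assume "1 / real (Suc k) < e"
      then have "cmod (f t - poly (p k) (complex_of_real t)) < e" if "t \<in> {-M..M}" for t
        using p[OF that, of k] by linarith
      then show "\<forall>t\<in>{-M..M}. dist (poly (p k) (complex_of_real t)) (f t) < e"
        by (simp add: dist_norm norm_minus_commute)
    qed
  qed
  then show thesis by (rule that)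
qed

text \<open>Freeness needs approximants that are exactly centered. Their means tend to the mean of
  f, which is 0, so subtracting them preserves the limit.\<close>

lemma poly_limit_centered_exists:
  assumes f: "continuous_on UNIV f" "(\<integral>t. f t \<partial>\<mu>) = 0"
  obtains p where "poly_limit p f" "\<And>k. (\<integral>t. poly (p k) (complex_of_real t) \<partial>\<mu>) = 0"
proof -
  obtain p where p: "poly_limit p f" using poly_limit_exists[OF f(1)] .
  define c where "c k = (\<integral>t. poly (p k) (complex_of_real t) \<partial>\<mu>)" for k
  have "c \<longlonglongrightarrow> 0" using poly_limit_integral[OF p] f(2) by (simp add: c_def[abs_def])
  then have "uniform_limit {-M..M} (\<lambda>k (_::real). c k) (\<lambda>_. 0) sequentially"
    by (auto intro!: uniform_limitI dest: tendstoD)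
  then have "uniform_limit {-M..M} (\<lambda>k t. poly (p k) (complex_of_real t) - c k) (\<lambda>t. f t - 0) sequentially"
    using p unfolding poly_limit_def by (intro uniform_limit_intros) auto
  then have "poly_limit (\<lambda>k. p k - [:c k:]) f"
    using f(1) by (simp add: poly_limit_def)
  moreover have "integrable \<mu> (\<lambda>t. poly (p k) (complex_of_real t))" for k
    by (intro integrable_continuous_fun continuous_intros)
  then have "(\<integral>t. poly (p k - [:c k:]) (complex_of_real t) \<partial>\<mu>) = 0" for k
    by (simp add: c_def prob_space)
  ultimately show thesis by (rule that)
qed

end

section \<open>Passing from polynomials in an element to functions on the line\<close>

definition has_moments :: "('a::cstar_algebra \<Rightarrow> complex) \<Rightarrow> 'a \<Rightarrow> real measure \<Rightarrow> bool" where
  "has_moments \<phi> a \<mu> \<longleftrightarrow> (\<forall>n. \<phi> (a ^ n) = complex_of_real (\<integral>t. t ^ n \<partial>\<mu>))"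

locale moment_distribution = positive_state \<phi> + bounded_distribution \<mu> M
  for \<phi> :: "'a::cstar_algebra \<Rightarrow> complex" and a :: 'a and \<mu> M +
  assumes selfadjoint: "a\<^sup>\<star> = a" and moments: "has_moments \<phi> a \<mu>"
begin

lemma state_poly_eval: "\<phi> (poly_eval a p) = (\<integral>t. poly p (complex_of_real t) \<partial>\<mu>)"
proof -
  \<comment> \<open>The extra power of a makes the induction on p go through: each step moves one
    factor a into it.\<close>
  have "\<phi> (a ^ n * poly_eval a p) = (\<integral>t. complex_of_real t ^ n * poly p (complex_of_real t) \<partial>\<mu>)" for n
  proof (induction p arbitrary: n)
    case 0
    then show ?case by (simp add: state_zero)
  next
    case (pCons c p)
    have int: "integrable \<mu> (\<lambda>t. c * complex_of_real t ^ n)"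
      "integrable \<mu> (\<lambda>t. complex_of_real t ^ Suc n * poly p (complex_of_real t))"
      by (intro integrable_continuous_fun continuous_intros)+
    have "\<phi> (a ^ n * poly_eval a (pCons c p)) = c * \<phi> (a ^ n) + \<phi> (a ^ Suc n * poly_eval a p)"
      by (simp add: distrib_left mult_scaleC_one state_add state_scaleC power_commutes mult.assoc[symmetric])
    also have "\<dots> = c * (\<integral>t. complex_of_real t ^ n \<partial>\<mu>)
        + (\<integral>t. complex_of_real t ^ Suc n * poly p (complex_of_real t) \<partial>\<mu>)"
      using moments unfolding pCons.IH has_moments_def by (simp flip: of_real_power)
    also have "\<dots> = (\<integral>t. complex_of_real t ^ n * poly (pCons c p) (complex_of_real t) \<partial>\<mu>)"
      using int
        by (simp add: distrib_left mult_ac flip: Bochner_Integration.integral_add integral_mult_right_zero)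
    finally show ?case .
  qed
  from this[of 0] show ?thesis by simp
qed

text \<open>For self-adjoint a, p(a)^* p(a) is a polynomial in a whose value at real t is
  |p(t)|^2.\<close>

lemma nrm_poly_eval: "nrm (poly_eval a p) = l2 (\<lambda>t. poly p (complex_of_real t))"
proof -
  have "\<phi> ((poly_eval a p)\<^sup>\<star> * poly_eval a p) = complex_of_real (\<integral>t. (cmod (poly p (complex_of_real t)))\<^sup>2 \<partial>\<mu>)"
    unfolding adj_poly_eval[OF selfadjoint] poly_eval_mult[symmetric] state_poly_eval
      integral_complex_of_real[symmetric]
    by (simp add: complex_norm_square[symmetric] mult.commute)
  then show ?thesis by (simp add: nrm_def l2_def)
qed

lemma nrm_poly_limit: "poly_limit p f \<Longrightarrow> (\<lambda>k. nrm (poly_eval a (p k))) \<longlonglongrightarrow> l2 f"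
  unfolding nrm_poly_eval by (rule poly_limit_l2)

end


section \<open>The truncated Neumann series of the resolvent\<close>

text \<open>To be read with X_i = \<open>\<omega>\<^sub>i - a\<^sub>i\<close>, b a scalar, 1 + x and
  1 + y approximating b times the inverses of X_1 and X_2, and d_i the defects. The sum telescopes
  up to the last power and the defect terms.\<close>

lemma resolvent_expansion:
  fixes x y X\<^sub>1 X\<^sub>2 d\<^sub>1 d\<^sub>2 b :: "'a::ring_1"
  assumes central: "\<And>u. u * b = b * u"
    and x: "X\<^sub>1 * (1 + x) = b + d\<^sub>1" and y: "X\<^sub>2 * (1 + y) = b + d\<^sub>2"
  shows "(X\<^sub>1 + X\<^sub>2 - b) * (\<Sum>n<N. (1 + y) * ((x * y) ^ n * (1 + x)))
    = b + d\<^sub>1 - X\<^sub>1 * (x * y) ^ N * (1 + x)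
        + (\<Sum>n<N. d\<^sub>1 * (y * ((x * y) ^ n * (1 + x))) + d\<^sub>2 * ((x * y) ^ n * (1 + x)))"
proof -
  have X1: "X\<^sub>1 = b + d\<^sub>1 - X\<^sub>1 * x" and X2: "X\<^sub>2 * y = b + d\<^sub>2 - X\<^sub>2"
    using x y by (simp_all add: algebra_simps)
  have "b * y = X\<^sub>1 * y + X\<^sub>1 * x * y - d\<^sub>1 * y"
    using arg_cong[OF X1, of "\<lambda>u. u * y"] by (simp add: algebra_simps)
  \<comment> \<open>This identity is the source of the telescoping: the factor 1 - x y turns each
    summand into a difference of consecutive powers.\<close>
  then have E: "(X\<^sub>1 + X\<^sub>2 - b) * (1 + y) = X\<^sub>1 * (1 - x * y) + d\<^sub>1 * y + d\<^sub>2"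
    using X2 by (simp add: algebra_simps)
  have "(X\<^sub>1 + X\<^sub>2 - b) * ((1 + y) * ((x * y) ^ n * (1 + x)))
      = (X\<^sub>1 * (x * y) ^ n * (1 + x) - X\<^sub>1 * (x * y) ^ Suc n * (1 + x))
        + (d\<^sub>1 * (y * ((x * y) ^ n * (1 + x))) + d\<^sub>2 * ((x * y) ^ n * (1 + x)))" for n
    unfolding mult.assoc[symmetric] E
    by (simp add: algebra_simps)
  then have "(X\<^sub>1 + X\<^sub>2 - b) * (\<Sum>n<N. (1 + y) * ((x * y) ^ n * (1 + x)))
      = (X\<^sub>1 * (x * y) ^ 0 * (1 + x) - X\<^sub>1 * (x * y) ^ N * (1 + x))
        + (\<Sum>n<N. d\<^sub>1 * (y * ((x * y) ^ n * (1 + x))) + d\<^sub>2 * ((x * y) ^ n * (1 + x)))"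
    using sum_lessThan_telescope'[of "\<lambda>n. X\<^sub>1 * (x * y) ^ n * (1 + x)" N]
    by (simp only: sum_distrib_left sum.distrib)
  then show ?thesis using x by simp
qed

text \<open>The head is tracked so that the induction can put another block in front.\<close>

lemma alternating_concat_replicate:
  assumes "fst k \<noteq> fst l" "fst h = fst k"
  shows "alternating (concat (replicate n [k, l]) @ [h]) \<and>
    fst (hd (concat (replicate n [k, l]) @ [h])) = fst k"
proof (induction n)
  case 0
  then show ?case using assms by (simp add: alternating_def)
next
  case (Suc n)
  then show ?case using assms by (auto simp: alternating_Cons)
qed

context free_selfadjoint_pair
begin

context
  fixes p q :: "complex poly" and x y :: 'a and Y :: "nat \<Rightarrow> 'a"
  defines "x \<equiv> poly_eval a\<^sub>1 p" and "y \<equiv> poly_eval a\<^sub>2 q"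
    and "Y \<equiv> (\<lambda>n. (x * y) ^ n * (1 + x))"
  assumes centered: "\<phi> x = 0" "\<phi> y = 0"
begin

definition xy_word :: "nat \<Rightarrow> (bool \<times> complex poly) list" where
  "xy_word n = concat (replicate n [(True, p), (False, q)])"

lemma xy_word_centered: "\<forall>l\<in>set (xy_word n). \<phi> (L l) = 0"
  using centered by (auto simp: xy_word_def letter_def x_def y_def split: if_splits)

lemma alternating_xy_word: "alternating ((False, r) # xy_word n @ [(True, s)])"
  using alternating_concat_replicate[of "(True, p)" "(False, q)" "(True, s)" n]
  by (simp add: xy_word_def alternating_Cons)

text \<open>Displays \<open>Y n\<close> as a word in which only the last letter, 1 + p, need not be
  centered, the shape required by \<open>nrm_wprod_Cons\<close>.\<close>

lemma Y_eq: "Y n = wprod (xy_word n @ [(True, 1 + p)])"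
proof -
  have "wprod (xy_word n) = (x * y) ^ n"
    by (induction n) (simp_all add: xy_word_def letter_def x_def y_def mult.assoc)
  then show ?thesis by (simp add: Y_def letter_def poly_eval_add x_def)
qed

lemma nrm_left_Y: "nrm (poly_eval a\<^sub>2 r * Y n) = nrm (poly_eval a\<^sub>2 r) * nrm (Y n)"
  using nrm_wprod_Cons[OF alternating_xy_word xy_word_centered, of r n "1 + p"]
  unfolding Y_eq by (simp add: letter_def)

lemma nrm_left_yY:
  "nrm (poly_eval a\<^sub>1 r * (y * Y n)) = nrm (poly_eval a\<^sub>1 r) * (nrm y * nrm (Y n))"
proof -
  have "nrm (wprod ((True, r) # ((False, q) # xy_word n) @ [(True, 1 + p)]))
      = nrm (L (True, r)) * nrm (wprod (((False, q) # xy_word n) @ [(True, 1 + p)]))"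
  proof (rule nrm_wprod_Cons)
    show "alternating ((True, r) # ((False, q) # xy_word n) @ [(True, 1 + p)])"
      using alternating_xy_word[of q n "1 + p"] by (simp add: alternating_Cons[of "(True, r)"])
    show "\<forall>l\<in>set ((False, q) # xy_word n). \<phi> (L l) = 0"
      using xy_word_centered centered by (auto simp: letter_def y_def)
  qed
  moreover have "wprod (((False, q) # xy_word n) @ [(True, 1 + p)]) = y * Y n"
    unfolding Y_eq by (simp add: letter_def y_def)
  ultimately show ?thesis
    using nrm_left_Y[of q n] by (simp add: letter_def y_def)
qed

text \<open>Peeling off one letter at a time multiplies the norms, so the terms form a geometric
  sequence.\<close>

lemma nrm_Y: "nrm (Y n) = (nrm x * nrm y) ^ n * nrm (1 + x)"
proof (induction n)
  case (Suc n)
  have "Y (Suc n) = x * (y * Y n)" by (simp add: Y_def mult.assoc)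
  then have "nrm (Y (Suc n)) = nrm x * (nrm y * nrm (Y n))"
    using nrm_left_yY[of p n] by (simp add: x_def)
  then show ?case using Suc by simp
qed (simp add: Y_def)

text \<open>Only the term n = 0 has nonzero expectation; for n > 0 there are centered letters
  between the two uncentered ends.\<close>

lemma state_neumann_sum: "\<phi> (\<Sum>n<Suc N. (1 + y) * Y n) = 1"
proof -
  have 0: "\<phi> ((1 + y) * Y 0) = 1"
  proof -
    have "(1 + y) * Y 0 = 1 + x + y + y * x" by (simp add: Y_def algebra_simps)
    moreover have "\<phi> (y * x) = 0"
      using free_wprod[of "[(False, q), (True, p)]"] centered
      by (simp add: alternating_def letter_def x_def y_def)
    ultimately show ?thesis using centered by (simp add: state_add unital)
  qed
  have "\<phi> ((1 + y) * Y (Suc n)) = 0" for n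
  proof -
    have "\<phi> (wprod ((False, 1 + q) # xy_word (Suc n) @ [(True, 1 + p)])) = 0"
      by (intro free_wprod_interior alternating_xy_word xy_word_centered) (simp add: xy_word_def)
    then show ?thesis unfolding Y_eq by (simp add: letter_def poly_eval_add y_def)
  qed
  then show ?thesis using 0 unfolding sum.lessThan_Suc_shift by (simp add: state_add state_sum)
qed

text \<open>\<open>A P\<close> plays the role of the resolvent of the sum at
  \<open>\<omega>\<^sub>1 + \<omega>\<^sub>2 - b\<close>, with error e. Multiplying the truncated
  expansion by it and applying the state, which is 1 on the truncated sum, leaves only error terms.
  Each is bounded by Cauchy-Schwarz and the factorization of norms.\<close>

lemma approximate_resolvent_bound:
  fixes \<omega>\<^sub>1 \<omega>\<^sub>2 b :: complex and r\<^sub>1 r\<^sub>2 e P :: "complex poly"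
  defines "r\<^sub>1 \<equiv> [:\<omega>\<^sub>1, -1:] * (1 + p) - [:b:]" and "r\<^sub>2 \<equiv> [:\<omega>\<^sub>2, -1:] * (1 + q) - [:b:]"
    and "e \<equiv> [:\<omega>\<^sub>1 + \<omega>\<^sub>2 - b, -1:] * P - 1"
  assumes sa: "(a\<^sub>1 + a\<^sub>2)\<^sup>\<star> = a\<^sub>1 + a\<^sub>2"
  defines "A \<equiv> poly_eval (a\<^sub>1 + a\<^sub>2)" and "\<rho> \<equiv> nrm x * nrm y" and "c \<equiv> nrm (1 + x)"
  shows "cmod (b * \<phi> (A P) - 1)
    \<le> nrm (A e) * (\<Sum>n<Suc N. nrm (1 + y) * (\<rho> ^ n * c))
      + nrm (A P) * (nrm (poly_eval a\<^sub>1 r\<^sub>1) + nrm (poly_eval a\<^sub>1 ([:\<omega>\<^sub>1, -1:] * p)) * (nrm y * (\<rho> ^ N * c))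
        + (\<Sum>n<Suc N. nrm (poly_eval a\<^sub>1 r\<^sub>1) * (nrm y * (\<rho> ^ n * c))
              + nrm (poly_eval a\<^sub>2 r\<^sub>2) * (\<rho> ^ n * c)))"
proof -
  define v where "v = (\<Sum>n<Suc N. (1 + y) * Y n)"
  define X\<^sub>1 X\<^sub>2 where "X\<^sub>1 = poly_eval a\<^sub>1 [:\<omega>\<^sub>1, -1:]" and "X\<^sub>2 = poly_eval a\<^sub>2 [:\<omega>\<^sub>2, -1:]"
  define d\<^sub>1 d\<^sub>2 where "d\<^sub>1 = poly_eval a\<^sub>1 r\<^sub>1" and "d\<^sub>2 = poly_eval a\<^sub>2 r\<^sub>2"
  \<comment> \<open>The total error: the defect of the leading term, the truncation tail and the
    defects of all summands.\<close>
  define R where "R = d\<^sub>1 - X\<^sub>1 * (x * y) ^ Suc N * (1 + x) + (\<Sum>n<Suc N. d\<^sub>1 * (y * Y n) + d\<^sub>2 * Y n)"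
  have b: "u * (b *\<^sub>C 1) = (b *\<^sub>C 1) * u" for u :: 'a
    by (simp add: scaleC_one_mult mult_scaleC_one)
  have "(X\<^sub>1 + X\<^sub>2 - b *\<^sub>C 1) * v = b *\<^sub>C 1 + R"
  proof -
    have "X\<^sub>1 * (1 + x) = b *\<^sub>C 1 + d\<^sub>1" "X\<^sub>2 * (1 + y) = b *\<^sub>C 1 + d\<^sub>2"
      unfolding X\<^sub>1_def X\<^sub>2_def d\<^sub>1_def d\<^sub>2_def r\<^sub>1_def r\<^sub>2_def x_def y_def poly_eval_diff
        poly_eval_mult poly_eval_add by simp_all
    from resolvent_expansion[OF b this, of "Suc N"] show ?thesis
      unfolding v_def R_def Y_def by (simp only: diff_conv_add_uminus add.assoc)
  qed
  moreover have "A [:\<omega>\<^sub>1 + \<omega>\<^sub>2 - b, -1:] = X\<^sub>1 + X\<^sub>2 - b *\<^sub>C 1"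
    by (simp add: A_def X\<^sub>1_def X\<^sub>2_def scaleC_add_left 
        complex_vec.scale_left_diff_distrib mult_scaleC_one distrib_right
        complex_vec.scale_right_distrib algebra_simps)
  ultimately have v: "A [:\<omega>\<^sub>1 + \<omega>\<^sub>2 - b, -1:] * v = b *\<^sub>C 1 + R" by simp
  \<comment> \<open>Polynomials in the same element commute, so the approximate inverse may be put
    on the left.\<close>
  have "A e = A P * A [:\<omega>\<^sub>1 + \<omega>\<^sub>2 - b, -1:] - 1"
    unfolding e_def A_def poly_eval_diff
    by (subst mult.commute) (simp only: poly_eval_mult poly_eval_1)
  then have "A P * (A [:\<omega>\<^sub>1 + \<omega>\<^sub>2 - b, -1:] * v) = v + A e * v"
    by (simp only: left_diff_distrib mult.assoc mult_1_left add_diff_cancel_left' add_diff_eq)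
  then have "\<phi> (b *\<^sub>C A P + A P * R) = \<phi> (v + A e * v)"
    unfolding v by (simp only: distrib_left mult_scaleC_one)
  then have "b * \<phi> (A P) + \<phi> (A P * R) = 1 + \<phi> (A e * v)"
    using state_neumann_sum[of N] by (simp only: state_add state_scaleC v_def[symmetric])
  then have "b * \<phi> (A P) - 1 = \<phi> (A e * v) - \<phi> (A P * R)"
    by (simp add: algebra_simps)
  then have "cmod (b * \<phi> (A P) - 1) \<le> cmod (\<phi> (A e * v)) + cmod (\<phi> (A P * R))"
    using norm_triangle_ineq4 by metis
  also have "\<dots> \<le> nrm (A e) * nrm v + nrm (A P) * nrm R"
    unfolding A_def by (intro add_mono state_poly_eval_mult_le sa)
  also have "\<dots> \<le> nrm (A e) * (\<Sum>n<Suc N. nrm (1 + y) * (\<rho> ^ n * c))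
      + nrm (A P) * (nrm d\<^sub>1 + nrm (poly_eval a\<^sub>1 ([:\<omega>\<^sub>1, -1:] * p)) * (nrm y * (\<rho> ^ N * c))
        + (\<Sum>n<Suc N. nrm d\<^sub>1 * (nrm y * (\<rho> ^ n * c)) + nrm d\<^sub>2 * (\<rho> ^ n * c)))"
  proof (intro add_mono[OF mult_left_mono[OF _ nrm_nonneg] mult_left_mono[OF _ nrm_nonneg]])
    show "nrm v \<le> (\<Sum>n<Suc N. nrm (1 + y) * (\<rho> ^ n * c))"
    proof -
      have "nrm ((1 + y) * Y n) = nrm (1 + y) * (\<rho> ^ n * c)" for n
        using nrm_left_Y[of "1 + q" n] by (simp add: poly_eval_add y_def[symmetric] nrm_Y \<rho>_def c_def)
      then show ?thesis unfolding v_def using nrm_sum[of "\<lambda>n. (1 + y) * Y n" "{..<Suc N}"] by simp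
    qed
    show "nrm R \<le> nrm d\<^sub>1 + nrm (poly_eval a\<^sub>1 ([:\<omega>\<^sub>1, -1:] * p)) * (nrm y * (\<rho> ^ N * c))
        + (\<Sum>n<Suc N. nrm d\<^sub>1 * (nrm y * (\<rho> ^ n * c)) + nrm d\<^sub>2 * (\<rho> ^ n * c))"
    proof -
      \<comment> \<open>Absorbing \<open>X\<^sub>1\<close> into the leading x keeps the tail an
        alternating word, so its norm factors.\<close>
      have "X\<^sub>1 * (x * y) ^ Suc N * (1 + x) = poly_eval a\<^sub>1 ([:\<omega>\<^sub>1, -1:] * p) * (y * Y N)"
        unfolding poly_eval_mult X\<^sub>1_def Y_def by (simp add: x_def mult.assoc del: poly_eval_pCons)
      then have 1: "nrm (- (X\<^sub>1 * (x * y) ^ Suc N * (1 + x)))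
          = nrm (poly_eval a\<^sub>1 ([:\<omega>\<^sub>1, -1:] * p)) * (nrm y * (\<rho> ^ N * c))"
        by (simp only: nrm_minus nrm_left_yY nrm_Y \<rho>_def c_def)
      have 2: "nrm (d\<^sub>1 * (y * Y n) + d\<^sub>2 * Y n)
          \<le> nrm d\<^sub>1 * (nrm y * (\<rho> ^ n * c)) + nrm d\<^sub>2 * (\<rho> ^ n * c)" for n
        using nrm_add[of "d\<^sub>1 * (y * Y n)" "d\<^sub>2 * Y n"]
        by (simp add: d\<^sub>1_def d\<^sub>2_def nrm_left_yY nrm_left_Y nrm_Y \<rho>_def c_def)
      have "nrm (\<Sum>n<Suc N. d\<^sub>1 * (y * Y n) + d\<^sub>2 * Y n)
          \<le> (\<Sum>n<Suc N. nrm d\<^sub>1 * (nrm y * (\<rho> ^ n * c)) + nrm d\<^sub>2 * (\<rho> ^ n * c))"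
        by (rule order_trans[OF nrm_sum]) (rule sum_mono, rule 2)
      then show ?thesis unfolding R_def diff_conv_add_uminus
        by (intro order_trans[OF nrm_add] add_mono) (auto simp only: 1 order_refl)
    qed
  qed
  finally show ?thesis unfolding d\<^sub>1_def d\<^sub>2_def .
qed

end

end


section \<open>Freeness of the two faces of a bi-free pair\<close>

lemma vacuum_coeff_add: "vacuum_coeff (u + v) = vacuum_coeff u + vacuum_coeff v"
  by transfer (simp add: lookup_add)

lemma vacuum_coeff_scaleC: "vacuum_coeff (c *\<^sub>C u) = c * vacuum_coeff u"
  by transfer simp

lemma vacuum_coeff_elem_tensor:
  assumes "w \<in> reduced_words"
  shows "vacuum_coeff (elem_tensor w) = (if w = [] then 1 else 0)"
  unfolding elem_tensor_def using assms
  by (subst vacuum_coeff.abs_eq) (auto intro!: tensor_rel_refl simp: lookup_single)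

text \<open>The vector p(T) v, in Horner form.\<close>

definition op_eval :: "('v::complex_vector \<Rightarrow> 'v) \<Rightarrow> complex poly \<Rightarrow> 'v \<Rightarrow> 'v" where
  "op_eval T p v = fold_coeffs (\<lambda>c u. c *\<^sub>C v + T u) p 0"

lemma op_eval_0 [simp]: "op_eval T 0 v = 0"
  by (simp add: op_eval_def)

lemma clinear_zero: "clinear T \<Longrightarrow> T 0 = 0"
  using clinear_lincomb[of T 0 1 0] by (simp add: scaleC_one)

lemma op_eval_pCons:
  "clinear T \<Longrightarrow> op_eval T (pCons c p) v = c *\<^sub>C v + T (op_eval T p v)"
  by (cases "p = 0 \<and> c = 0") (auto simp: op_eval_def clinear_zero)

text \<open>A linear map J that intertwines T with S also intertwines p(T) with p(S).\<close>

lemma op_eval_intertwine: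
  assumes "clinear S" "clinear T"
    and lin: "\<And>x c y. J (x + c *\<^sub>C y) = J x + c *\<^sub>C J y" and J: "\<And>x. S (J x) = J (T x)"
  shows "op_eval S p (J x) = J (op_eval T p x)"
proof (induction p)
  case 0
  show ?case using lin[of 0 1 0] by (simp add: scaleC_one)
next
  case (pCons c p)
  have "J (c *\<^sub>C x + T (op_eval T p x)) = J (T (op_eval T p x)) + c *\<^sub>C J x"
    by (subst add.commute) (rule lin)
  then show ?case using assms(1,2) pCons.IH by (simp add: op_eval_pCons J add.commute)
qed

text \<open>The left and the right action on the free product differ only in the order of the letters,
  so both faces are instances of one model: \<open>E\<close> is the elementary tensor of a word, or of the
  reversed word.\<close>

locale free_product_model =
  fixes \<phi> :: "'a::cstar_algebra \<Rightarrow> complex" and a\<^sub>1 a\<^sub>2 :: 'a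
    and T\<^sub>1 :: "'x::state_space \<Rightarrow> 'x" and T\<^sub>2 :: "'y::state_space \<Rightarrow> 'y"
    and O\<^sub>1 O\<^sub>2 :: "('x, 'y) free_product \<Rightarrow> ('x, 'y) free_product"
    and E :: "('x + 'y) list \<Rightarrow> ('x, 'y) free_product"
  assumes linear_state: "Vector_Spaces.linear (*\<^sub>C) (*) \<phi>"
    and linear_T: "clinear T\<^sub>1" "clinear T\<^sub>2" and linear_O: "clinear O\<^sub>1" "clinear O\<^sub>2"
    and multilinear: "word_multilinear E"
    and vacuum: "\<And>w. w \<in> reduced_words \<Longrightarrow> vacuum_coeff (E w) = (if w = [] then 1 else 0)"
    and O\<^sub>1: "\<And>x w. w \<in> left_words Inl \<Longrightarrow>
      O\<^sub>1 (state_coeff x *\<^sub>C E w + E (Inl (center_part x) # w))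
        = state_coeff (T\<^sub>1 x) *\<^sub>C E w + E (Inl (center_part (T\<^sub>1 x)) # w)"
    and O\<^sub>2: "\<And>x w. w \<in> left_words Inr \<Longrightarrow>
      O\<^sub>2 (state_coeff x *\<^sub>C E w + E (Inr (center_part x) # w))
        = state_coeff (T\<^sub>2 x) *\<^sub>C E w + E (Inr (center_part (T\<^sub>2 x)) # w)"
    and moments: "\<And>ws. \<phi> (prod_list (map (\<lambda>i. if i then a\<^sub>1 else a\<^sub>2) ws))
      = vacuum_coeff (foldr (\<lambda>i. if i then O\<^sub>1 else O\<^sub>2) ws (E []))"
begin

interpretation \<phi>: Vector_Spaces.linear "(*\<^sub>C)" "(*)" \<phi> by (rule linear_state)

definition act :: "bool \<times> complex poly \<Rightarrow> ('x, 'y) free_product \<Rightarrow> ('x, 'y) free_product" where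
  "act l = op_eval (if fst l then O\<^sub>1 else O\<^sub>2) (snd l)"

text \<open>The vector p(T_i) \<xi>, as a letter of a tensor; it lies in the centered subspace when
  the corresponding element has expectation 0.\<close>

definition tensor_letter :: "bool \<times> complex poly \<Rightarrow> 'x + 'y" where
  "tensor_letter l = (if fst l then Inl (op_eval T\<^sub>1 (snd l) state_vec)
     else Inr (op_eval T\<^sub>2 (snd l) state_vec))"

abbreviation gen_word :: "bool list \<Rightarrow> 'a" where
  "gen_word ws \<equiv> prod_list (map (\<lambda>i. if i then a\<^sub>1 else a\<^sub>2) ws)"

abbreviation op_word :: "bool list \<Rightarrow> ('x, 'y) free_product \<Rightarrow> ('x, 'y) free_product" where
  "op_word ws \<equiv> foldr (\<lambda>i. if i then O\<^sub>1 else O\<^sub>2) ws"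

lemma op_word_lincomb: "op_word ws (u + c *\<^sub>C v) = op_word ws u + c *\<^sub>C op_word ws v"
  by (induction ws) (simp_all add: clinear_lincomb[OF linear_O(1)] clinear_lincomb[OF linear_O(2)])

text \<open>The model prescribes moments of words in the generators only. Linearity extends them to
  polynomial letters; the generator prefix \<open>ws\<close> collects the powers produced while a
  polynomial is expanded.\<close>

lemma moments_letters:
  "\<phi> (gen_word ws * prod_list (map (letter a\<^sub>1 a\<^sub>2) ls)) = vacuum_coeff (op_word ws (foldr act ls (E [])))"
proof (induction ls arbitrary: ws)
  case Nil
  show ?case using moments[of ws] by simp
next
  case (Cons l ls)
  let ?Z = "prod_list (map (letter a\<^sub>1 a\<^sub>2) ls)" and ?V = "foldr act ls (E [])"
  have lin: "clinear (if i then O\<^sub>1 else O\<^sub>2)" for i using linear_O by simp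
  obtain i p where l: "l = (i, p)" by (cases l)
  have "\<phi> (gen_word ws * (poly_eval (if i then a\<^sub>1 else a\<^sub>2) p * ?Z))
      = vacuum_coeff (op_word ws (op_eval (if i then O\<^sub>1 else O\<^sub>2) p ?V))"
  proof (induction p arbitrary: ws)
    case 0
    have "op_word ws 0 = 0" using op_word_lincomb[of ws 0 1 0] by (simp add: scaleC_one)
    moreover have "vacuum_coeff (0 :: ('x, 'y) free_product) = 0"
      using vacuum_coeff_add[of "0 :: ('x, 'y) free_product" 0] by simp
    ultimately show ?case by (simp add: \<phi>.zero)
  next
    case (pCons c p)
    have "gen_word ws * (poly_eval (if i then a\<^sub>1 else a\<^sub>2) (pCons c p) * ?Z)
        = gen_word (ws @ [i]) * (poly_eval (if i then a\<^sub>1 else a\<^sub>2) p * ?Z) + c *\<^sub>C (gen_word ws * ?Z)"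
      by (simp add: distrib_left distrib_right scaleC_one_mult scaleC_mult_right mult.assoc)
    then have "\<phi> (gen_word ws * (poly_eval (if i then a\<^sub>1 else a\<^sub>2) (pCons c p) * ?Z))
        = vacuum_coeff (op_word (ws @ [i]) (op_eval (if i then O\<^sub>1 else O\<^sub>2) p ?V))
          + c * vacuum_coeff (op_word ws ?V)"
      by (simp only: \<phi>.add \<phi>.scale pCons.IH Cons.IH)
    also have "\<dots> = vacuum_coeff (op_word ws (op_eval (if i then O\<^sub>1 else O\<^sub>2) (pCons c p) ?V))"
      unfolding op_eval_pCons[OF lin]
      by (subst (2) add.commute)
        (simp only: op_word_lincomb vacuum_coeff_add vacuum_coeff_scaleC foldr_append foldr.simps
          o_apply id_apply)
    finally show ?case .
  qed
  moreover have "letter a\<^sub>1 a\<^sub>2 l = poly_eval (if i then a\<^sub>1 else a\<^sub>2) p"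
    "act l = op_eval (if i then O\<^sub>1 else O\<^sub>2) p"
    by (simp_all add: l letter_def act_def)
  ultimately show ?case by simp
qed

text \<open>J sends x to the tensor of x with w and intertwines \<open>T\<^sub>1\<close> with
  \<open>O\<^sub>1\<close>. At the state vector its value is \<open>E w\<close>, because a tensor
  with a zero letter vanishes.\<close>

lemma act_tensor_Inl:
  assumes w: "w \<in> left_words Inl"
  shows "op_eval O\<^sub>1 p (E w) = state_coeff (op_eval T\<^sub>1 p state_vec) *\<^sub>C E w
    + E (Inl (center_part (op_eval T\<^sub>1 p state_vec)) # w)"
proof -
  define J where "J x = state_coeff x *\<^sub>C E w + E (Inl (center_part x) # w)" for x
  have r: "Inl (center_part x) # w \<in> reduced_words" for x using w by (simp add: reduced_words_Cons)
  have "op_eval O\<^sub>1 p (J state_vec) = J (op_eval T\<^sub>1 p state_vec)"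
  proof (rule op_eval_intertwine[OF linear_O(1) linear_T(1)])
    show "J (x + c *\<^sub>C y) = J x + c *\<^sub>C J y" for x c y
      using word_multilinearD(1)[OF multilinear, of "[]" "center_part x" w "center_part y" c] r
      by (simp add: J_def state_coeff_lincomb center_part_lincomb scaleC_add_left scaleC_add_right
          scaleC_scaleC)
    show "O\<^sub>1 (J x) = J (T\<^sub>1 x)" for x unfolding J_def by (rule O\<^sub>1[OF w])
  qed
  moreover have "E (Inl 0 # w) = 0"
    using word_multilinearD(1)[OF multilinear, of "[]" 0 w 0 1] w
    by (simp add: reduced_words_Cons centered_zero scaleC_one)
  ultimately show ?thesis by (simp add: J_def scaleC_one)
qed

lemma act_tensor_Inr:
  assumes w: "w \<in> left_words Inr"
  shows "op_eval O\<^sub>2 p (E w) = state_coeff (op_eval T\<^sub>2 p state_vec) *\<^sub>C E w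
    + E (Inr (center_part (op_eval T\<^sub>2 p state_vec)) # w)"
proof -
  define J where "J x = state_coeff x *\<^sub>C E w + E (Inr (center_part x) # w)" for x
  have r: "Inr (center_part x) # w \<in> reduced_words" for x using w by (simp add: reduced_words_Cons)
  have "op_eval O\<^sub>2 p (J state_vec) = J (op_eval T\<^sub>2 p state_vec)"
  proof (rule op_eval_intertwine[OF linear_O(2) linear_T(2)])
    show "J (x + c *\<^sub>C y) = J x + c *\<^sub>C J y" for x c y
      using word_multilinearD(2)[OF multilinear, of "[]" "center_part x" w "center_part y" c] r
      by (simp add: J_def state_coeff_lincomb center_part_lincomb scaleC_add_left scaleC_add_right
          scaleC_scaleC)
    show "O\<^sub>2 (J x) = J (T\<^sub>2 x)" for x unfolding J_def by (rule O\<^sub>2[OF w])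
  qed
  moreover have "E (Inr 0 # w) = 0"
    using word_multilinearD(2)[OF multilinear, of "[]" 0 w 0 1] w
    by (simp add: reduced_words_Cons centered_zero scaleC_one)
  ultimately show ?thesis by (simp add: J_def scaleC_one)
qed

lemma Nil_left_words: "[] \<in> left_words \<iota>"
  by (simp add: left_words_def reduced_words_def)

text \<open>The expectation of the letter is the \<xi>-coefficient of p(T_i) \<xi>.\<close>

lemma centered_letter:
  assumes "\<phi> (letter a\<^sub>1 a\<^sub>2 l) = 0"
  shows "fst l \<Longrightarrow> op_eval T\<^sub>1 (snd l) state_vec \<in> centered"
    and "\<not> fst l \<Longrightarrow> op_eval T\<^sub>2 (snd l) state_vec \<in> centered"
proof -
  have c: "x \<in> centered" if "state_coeff x = 0" for x :: "'z::state_space"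
    using state_split[of x] that center_part_centered[of x] by simp
  have "vacuum_coeff (act l (E [])) = 0" using moments_letters[of "[]" "[l]"] assms by simp
  then show "fst l \<Longrightarrow> op_eval T\<^sub>1 (snd l) state_vec \<in> centered"
    "\<not> fst l \<Longrightarrow> op_eval T\<^sub>2 (snd l) state_vec \<in> centered"
    by (auto intro!: c simp: act_def act_tensor_Inl act_tensor_Inr Nil_left_words vacuum_coeff_add
        vacuum_coeff_scaleC vacuum reduced_words_Cons)
      (simp_all add: left_words_reduced[OF Nil_left_words] vacuum)
qed

text \<open>A centered letter acting on a word that starts in the other space has no scalar
  component and only prepends a tensor factor.\<close>

lemma act_letters:
  assumes "alternating ls" "\<forall>l\<in>set ls. \<phi> (letter a\<^sub>1 a\<^sub>2 l) = 0"
  shows "map tensor_letter ls \<in> reduced_words \<and> foldr act ls (E []) = E (map tensor_letter ls)"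
  using assms
proof (induction ls)
  case Nil
  then show ?case by (simp add: reduced_words_def)
next
  case (Cons l ls)
  let ?w = "map tensor_letter ls"
  have IH: "?w \<in> reduced_words" "foldr act ls (E []) = E ?w"
    using Cons.IH Cons.prems by (cases ls; simp add: alternating_def)+
  have hd: "ls = [] \<or> fst (hd ls) \<noteq> fst l" using Cons.prems by (auto simp: alternating_Cons)
  have c: "\<phi> (letter a\<^sub>1 a\<^sub>2 l) = 0" using Cons.prems by simp
  show ?case
  proof (cases "fst l")
    case True
    have w: "?w \<in> left_words Inl"
      using IH(1) hd True by (cases ls) (auto simp: left_words_def tensor_letter_def split: if_splits)
    have "tensor_letter l = Inl (op_eval T\<^sub>1 (snd l) state_vec)" "act l = op_eval O\<^sub>1 (snd l)"
      using True by (simp_all add: tensor_letter_def act_def)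
    then show ?thesis using w centered_letter(1)[OF c True] IH
      by (simp add: reduced_words_Cons act_tensor_Inl)
  next
    case False
    have w: "?w \<in> left_words Inr"
      using IH(1) hd False by (cases ls) (auto simp: left_words_def tensor_letter_def split: if_splits)
    have "tensor_letter l = Inr (op_eval T\<^sub>2 (snd l) state_vec)" "act l = op_eval O\<^sub>2 (snd l)"
      using False by (simp_all add: tensor_letter_def act_def)
    then show ?thesis using w centered_letter(2)[OF c False] IH
      by (simp add: reduced_words_Cons act_tensor_Inr)
  qed
qed

text \<open>The letters build a nonempty reduced tensor out of \<xi>, and such a tensor has vacuum
  coefficient 0.\<close>

lemma model_free_pair: "free_pair \<phi> a\<^sub>1 a\<^sub>2"
  unfolding free_pair_def
proof (intro allI impI)
  fix ls :: "(bool \<times> complex poly) list"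
  assume ls: "ls \<noteq> []" "alternating ls" "\<forall>l\<in>set ls. \<phi> (letter a\<^sub>1 a\<^sub>2 l) = 0"
  have "\<phi> (prod_list (map (letter a\<^sub>1 a\<^sub>2) ls)) = vacuum_coeff (E (map tensor_letter ls))"
    using moments_letters[of "[]" ls] act_letters[OF ls(2,3)] by simp
  also have "\<dots> = 0" using act_letters[OF ls(2,3)] ls(1) vacuum by auto
  finally show "\<phi> (prod_list (map (letter a\<^sub>1 a\<^sub>2) ls)) = 0" .
qed

end

lemma foldr_comp_map: "foldr (\<circ>) (map f xs) id v = foldr f xs v"
  by (induction xs) auto

text \<open>Joint moments are restricted to words in the two left, or the two right,
  variables.\<close>

lemma bi_free_imp_free_pairs:
  fixes \<phi> :: "'a::cstar_algebra \<Rightarrow> complex"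
  assumes lin: "Vector_Spaces.linear (*\<^sub>C) (*) \<phi>"
    and "bi_free TYPE('x::state_space) TYPE('y::state_space) \<phi> (a\<^sub>1, b\<^sub>1) (a\<^sub>2, b\<^sub>2)"
  shows "free_pair \<phi> a\<^sub>1 a\<^sub>2" and "free_pair \<phi> b\<^sub>1 b\<^sub>2"
proof -
  obtain T\<^sub>1 S\<^sub>1 :: "'x \<Rightarrow> 'x" and T\<^sub>2 S\<^sub>2 :: "'y \<Rightarrow> 'y"
    where T: "clinear T\<^sub>1" "clinear T\<^sub>2" and S: "clinear S\<^sub>1" "clinear S\<^sub>2"
    and mom: "\<And>ws. \<phi> (prod_list (map (case_variable a\<^sub>1 a\<^sub>2 b\<^sub>1 b\<^sub>2) ws)) =
      vacuum_coeff (foldr (\<circ>) (map (case_variable (left_op Inl T\<^sub>1) (left_op Inr T\<^sub>2)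
        (right_op Inl S\<^sub>1) (right_op Inr S\<^sub>2)) ws) id (elem_tensor []))"
    using assms(2) unfolding bi_free_def by (auto simp del: foldr_map)
  have if_comp: "case_variable x y z u \<circ> (\<lambda>i. if i then A1 else A2) = (\<lambda>i. if i then x else y)"
    "case_variable x y z u \<circ> (\<lambda>i. if i then B1 else B2) = (\<lambda>i. if i then z else u)"
    for x y z u :: 'c by auto
  show "free_pair \<phi> a\<^sub>1 a\<^sub>2"
  proof (rule free_product_model.model_free_pair[OF free_product_model.intro[
        where T\<^sub>1 = T\<^sub>1 and T\<^sub>2 = T\<^sub>2 and
          O\<^sub>1 = "left_op Inl T\<^sub>1" and O\<^sub>2 = "left_op Inr T\<^sub>2" and E = elem_tensor]])
    show "clinear T\<^sub>1" "clinear T\<^sub>2" "clinear (left_op Inl T\<^sub>1)" "clinear (left_op Inr T\<^sub>2)"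
      "Vector_Spaces.linear (*\<^sub>C) (*) \<phi>"
      using T lin by (simp_all add: left_op_Inl(1) left_op_Inr(1))
    show "word_multilinear (elem_tensor :: ('x + 'y) list \<Rightarrow> _)" by (rule elem_tensor_multilinear)
    show "left_op Inl T\<^sub>1 (state_coeff x *\<^sub>C elem_tensor w + elem_tensor (Inl (center_part x) # w))
        = state_coeff (T\<^sub>1 x) *\<^sub>C elem_tensor w + elem_tensor (Inl (center_part (T\<^sub>1 x)) # w)"
      if "w \<in> left_words Inl" for x and w :: "('x + 'y) list"
      using left_op_Inl(2)[OF T(1) that, of x] by (simp add: left_tensor_def)
    show "left_op Inr T\<^sub>2 (state_coeff x *\<^sub>C elem_tensor w + elem_tensor (Inr (center_part x) # w))
        = state_coeff (T\<^sub>2 x) *\<^sub>C elem_tensor w + elem_tensor (Inr (center_part (T\<^sub>2 x)) # w)"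
      if "w \<in> left_words Inr" for x and w :: "('x + 'y) list"
      using left_op_Inr(2)[OF T(2) that, of x] by (simp add: left_tensor_def)
    show "\<phi> (prod_list (map (\<lambda>i. if i then a\<^sub>1 else a\<^sub>2) ws))
      = vacuum_coeff (foldr (\<lambda>i. if i then left_op Inl T\<^sub>1 else left_op Inr T\<^sub>2) ws (elem_tensor []))" for ws
      using mom[of "map (\<lambda>i. if i then A1 else A2) ws"]
      by (simp only: list.map_comp if_comp foldr_comp_map)
  qed (rule vacuum_coeff_elem_tensor)
  \<comment> \<open>Right operators act at the end of a tensor; on reversed words they act in front,
    as the model requires.\<close>
  show "free_pair \<phi> b\<^sub>1 b\<^sub>2"
  proof (rule free_product_model.model_free_pair[OF free_product_model.intro[
        where T\<^sub>1 = S\<^sub>1 and T\<^sub>2 = S\<^sub>2 and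
          O\<^sub>1 = "right_op Inl S\<^sub>1" and O\<^sub>2 = "right_op Inr S\<^sub>2" and E = "\<lambda>w. elem_tensor (rev w)"]])
    show "clinear S\<^sub>1" "clinear S\<^sub>2" "clinear (right_op Inl S\<^sub>1)" "clinear (right_op Inr S\<^sub>2)"
      "Vector_Spaces.linear (*\<^sub>C) (*) \<phi>"
      using S lin by (simp_all add: right_op_Inl(1) right_op_Inr(1))
    show "word_multilinear (\<lambda>w :: ('x + 'y) list. elem_tensor (rev w))" by (rule elem_tensor_rev_multilinear)
    show "vacuum_coeff (elem_tensor (rev w)) = (if w = [] then 1 else 0)"
      if "w \<in> reduced_words" for w :: "('x + 'y) list"
      using that by (simp add: vacuum_coeff_elem_tensor reduced_words_rev)
    show "right_op Inl S\<^sub>1 (state_coeff x *\<^sub>C elem_tensor (rev w) + elem_tensor (rev (Inl (center_part x) # w)))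
        = state_coeff (S\<^sub>1 x) *\<^sub>C elem_tensor (rev w) + elem_tensor (rev (Inl (center_part (S\<^sub>1 x)) # w))"
      if "w \<in> left_words Inl" for x and w :: "('x + 'y) list"
      using right_op_Inl(2)[OF S(1), of "rev w" x] that by (simp add: right_tensor_def right_words_rev)
    show "right_op Inr S\<^sub>2 (state_coeff x *\<^sub>C elem_tensor (rev w) + elem_tensor (rev (Inr (center_part x) # w)))
        = state_coeff (S\<^sub>2 x) *\<^sub>C elem_tensor (rev w) + elem_tensor (rev (Inr (center_part (S\<^sub>2 x)) # w))"
      if "w \<in> left_words Inr" for x and w :: "('x + 'y) list"
      using right_op_Inr(2)[OF S(2), of "rev w" x] that by (simp add: right_tensor_def right_words_rev)
    show "\<phi> (prod_list (map (\<lambda>i. if i then b\<^sub>1 else b\<^sub>2) ws))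
      = vacuum_coeff (foldr (\<lambda>i. if i then right_op Inl S\<^sub>1 else right_op Inr S\<^sub>2) ws (elem_tensor (rev [])))" for ws
      using mom[of "map (\<lambda>i. if i then B1 else B2) ws"]
      by (simp only: list.map_comp if_comp foldr_comp_map rev.simps)
  qed
qed


section \<open>Subordination\<close>

context bounded_distribution
begin

text \<open>Expand |u - 1|^2 = |u|^2 - 2 Re u + 1 for u = b / (\<omega> - t): the integral of u is b
  G(\<omega>) = 1, and that of |u|^2 is |b|^2 energy(\<omega>) = Im b / Im \<omega>.\<close>

lemma l2_resolvent:
  assumes \<omega>: "Im \<omega> > 0"
  defines "b \<equiv> 1 / cauchy_transform \<mu> \<omega>"
  shows "(l2 (\<lambda>t. b / (\<omega> - complex_of_real t) - 1))\<^sup>2 = Im b / Im \<omega> - 1"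
proof -
  let ?h = "\<lambda>t. 1 / (\<omega> - complex_of_real t)"
  have G: "cauchy_transform \<mu> \<omega> \<noteq> 0" by (rule cauchy_transform_nonzero[OF \<omega>])
  have sq: "(cmod (b / (\<omega> - complex_of_real t) - 1))\<^sup>2
      = (cmod b)\<^sup>2 * (cmod (?h t))\<^sup>2 - 2 * Re (b * ?h t) + 1" for t
  proof -
    have "(cmod (u - 1))\<^sup>2 = (cmod u)\<^sup>2 - 2 * Re u + 1" for u
      unfolding cmod_power2 by (simp add: power2_eq_square algebra_simps)
    from this[of "b * ?h t"] show ?thesis
      by (simp add: norm_mult power_mult_distrib norm_divide power_divide)
  qed
  have int: "integrable \<mu> (\<lambda>t. (cmod b)\<^sup>2 * (cmod (?h t))\<^sup>2)" "integrable \<mu> (\<lambda>t. b * ?h t)"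
    using integrable_energy[OF \<omega>] integrable_inverse_diff[OF \<omega>]
    by (auto simp del: times_divide_eq_right)
  have "(l2 (\<lambda>t. b / (\<omega> - complex_of_real t) - 1))\<^sup>2
      = (\<integral>t. (cmod b)\<^sup>2 * (cmod (?h t))\<^sup>2 - 2 * Re (b * ?h t) + 1 \<partial>\<mu>)"
    unfolding l2_def sq[symmetric] by simp
  also have "\<dots> = (cmod b)\<^sup>2 * energy \<omega> - 2 * Re (\<integral>t. b * ?h t \<partial>\<mu>) + 1"
  proof -
    have "integrable \<mu> (\<lambda>t. 2 * Re (b * ?h t))" using integrable_Re[OF int(2)] by auto
    then show ?thesis
      using int
      by (simp add: energy_def prob_space integral_Re[OF int(2), symmetric]
          del: times_divide_eq_right times_complex.sel)
  qed
  also have "(\<integral>t. b * ?h t \<partial>\<mu>) = 1"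
  proof -
    have "(\<integral>t. b * ?h t \<partial>\<mu>) = b * cauchy_transform \<mu> \<omega>"
      unfolding cauchy_transform_def by (rule integral_mult_right_zero)
    then show ?thesis using G by (simp add: b_def)
  qed
  also have "(cmod b)\<^sup>2 * energy \<omega> = Im b / Im \<omega>"
    using Im_reciprocal_cauchy_transform[OF \<omega>] \<omega> by (simp add: b_def norm_divide power_divide)
  finally show ?thesis by simp
qed

lemma integral_resolvent_zero:
  assumes \<omega>: "Im \<omega> > 0" and b: "b = 1 / cauchy_transform \<mu> \<omega>"
  shows "(\<integral>t. b / (\<omega> - complex_of_real t) - 1 \<partial>\<mu>) = 0"
proof -
  have "(\<integral>t. b * (1 / (\<omega> - complex_of_real t)) - 1 \<partial>\<mu>) = b * cauchy_transform \<mu> \<omega> - 1"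
    unfolding cauchy_transform_def using integrable_inverse_diff[OF \<omega>]
    by (simp add: prob_space del: times_divide_eq_right)
  then show ?thesis using cauchy_transform_nonzero[OF \<omega>] by (simp add: b)
qed

lemma l2_zero [simp]: "l2 (\<lambda>_. 0) = 0"
  by (simp add: l2_def)

end

text \<open>For fixed N all approximation errors in \<open>approximate_resolvent_bound\<close>
  vanish in the limit, leaving a truncation error of order \<rho>^N. Since \<rho> < 1, this forces b
  G(z) = 1.\<close>

lemma free_subordination:
  assumes "free_selfadjoint_pair \<phi> a\<^sub>1 a\<^sub>2"
    and "moment_distribution \<phi> a\<^sub>1 \<mu>\<^sub>1 M" and "moment_distribution \<phi> a\<^sub>2 \<mu>\<^sub>2 M"
    and "moment_distribution \<phi> (a\<^sub>1 + a\<^sub>2) \<mu> M"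
    and z: "Im z > 0" and \<omega>: "Im \<omega>\<^sub>1 > 0" "Im \<omega>\<^sub>2 > 0"
    and G: "cauchy_transform \<mu>\<^sub>1 \<omega>\<^sub>1 = cauchy_transform \<mu>\<^sub>2 \<omega>\<^sub>2"
    and sum: "\<omega>\<^sub>1 + \<omega>\<^sub>2 = z + 1 / cauchy_transform \<mu>\<^sub>1 \<omega>\<^sub>1"
  shows "cauchy_transform \<mu> z = cauchy_transform \<mu>\<^sub>1 \<omega>\<^sub>1"
proof -
  interpret f: free_selfadjoint_pair \<phi> a\<^sub>1 a\<^sub>2 by fact
  interpret m1: moment_distribution \<phi> a\<^sub>1 \<mu>\<^sub>1 M by fact
  interpret m2: moment_distribution \<phi> a\<^sub>2 \<mu>\<^sub>2 M by fact
  interpret m: moment_distribution \<phi> "a\<^sub>1 + a\<^sub>2" \<mu> M by fact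
  define b where "b = 1 / cauchy_transform \<mu>\<^sub>1 \<omega>\<^sub>1"
  have b2: "b = 1 / cauchy_transform \<mu>\<^sub>2 \<omega>\<^sub>2" by (simp add: b_def G)
  have zb: "\<omega>\<^sub>1 + \<omega>\<^sub>2 - b = z" using sum by (simp add: b_def)
  define u\<^sub>1 u\<^sub>2 where "u\<^sub>1 t = b / (\<omega>\<^sub>1 - complex_of_real t) - 1"
    and "u\<^sub>2 t = b / (\<omega>\<^sub>2 - complex_of_real t) - 1" for t
  have nz: "\<omega>\<^sub>1 - complex_of_real t \<noteq> 0" "\<omega>\<^sub>2 - complex_of_real t \<noteq> 0" "z - complex_of_real t \<noteq> 0" for t
    using diff_of_real_nonzero \<omega> z by auto
  have c: "continuous_on UNIV u\<^sub>1" "continuous_on UNIV u\<^sub>2"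
      "continuous_on UNIV (\<lambda>t. 1 / (z - complex_of_real t))"
    unfolding u\<^sub>1_def u\<^sub>2_def using nz by (auto intro!: continuous_intros)
  have "(\<integral>t. u\<^sub>1 t \<partial>\<mu>\<^sub>1) = 0" "(\<integral>t. u\<^sub>2 t \<partial>\<mu>\<^sub>2) = 0"
    unfolding u\<^sub>1_def u\<^sub>2_def using \<omega> b_def b2
    by (intro m1.integral_resolvent_zero m2.integral_resolvent_zero; simp)+
  then obtain p q where p: "m1.poly_limit p u\<^sub>1" "\<And>k. (\<integral>t. poly (p k) (complex_of_real t) \<partial>\<mu>\<^sub>1) = 0"
    and q: "m2.poly_limit q u\<^sub>2" "\<And>k. (\<integral>t. poly (q k) (complex_of_real t) \<partial>\<mu>\<^sub>2) = 0"
    using m1.poly_limit_centered_exists[OF c(1)] m2.poly_limit_centered_exists[OF c(2)] by metis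
  obtain P where P: "m.poly_limit P (\<lambda>t. 1 / (z - complex_of_real t))"
    using m.poly_limit_exists[OF c(3)] .
  have centered: "\<phi> (poly_eval a\<^sub>1 (p k)) = 0" "\<phi> (poly_eval a\<^sub>2 (q k)) = 0" for k
    by (simp_all add: m1.state_poly_eval m2.state_poly_eval p q)
  define \<rho> where "\<rho> = m1.l2 u\<^sub>1 * m2.l2 u\<^sub>2"
  define C where "C = m1.l2 (\<lambda>t. u\<^sub>1 t + 1)"
  define B where "B N = m.l2 (\<lambda>t. 1 / (z - complex_of_real t)) * (m1.l2 (\<lambda>t. (\<omega>\<^sub>1 - complex_of_real t) * u\<^sub>1 t)
      * (m2.l2 u\<^sub>2 * (\<rho> ^ N * C)))" for N :: nat
  \<comment> \<open>The polynomials approximate \<open>u\<^sub>1\<close> and \<open>u\<^sub>2\<close> for a fixed truncation \<open>N\<close>; only afterwards \<open>N \<rightarrow> \<infinity>\<close>.\<close>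
  have bound: "cmod (b * cauchy_transform \<mu> z - 1) \<le> B N" for N
  proof -
    have lim_r1: "(\<lambda>k. f.nrm (poly_eval a\<^sub>1 ([:\<omega>\<^sub>1, -1:] * (1 + p k) - [:b:]))) \<longlonglongrightarrow> 0"
    proof -
      \<comment> \<open>The limit of the defect polynomials is (\<omega> - t)(u + 1) - b for
        \<omega> = \<open>\<omega>\<^sub>1\<close>, u = \<open>u\<^sub>1\<close>, which vanishes
        identically.\<close>
      have "(\<lambda>t. poly [:\<omega>\<^sub>1, -1:] (complex_of_real t) * (u\<^sub>1 t + poly 1 (complex_of_real t))
          + poly (- [:b:]) (complex_of_real t)) = (\<lambda>_. 0)"
        using nz(1) by (auto simp: u\<^sub>1_def fun_eq_iff)
      with m1.nrm_poly_limit[OF m1.poly_limit_add[OF m1.poly_limit_mult[OF m1.poly_limit_add[OF p(1), of 1],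
            of "[:\<omega>\<^sub>1, -1:]"], of "- [:b:]"]]
      show ?thesis by (simp only: m1.l2_zero add.commute[of "p _" 1] diff_conv_add_uminus)
    qed
    have lim_r2: "(\<lambda>k. f.nrm (poly_eval a\<^sub>2 ([:\<omega>\<^sub>2, -1:] * (1 + q k) - [:b:]))) \<longlonglongrightarrow> 0"
    proof -
      have "(\<lambda>t. poly [:\<omega>\<^sub>2, -1:] (complex_of_real t) * (u\<^sub>2 t + poly 1 (complex_of_real t))
          + poly (- [:b:]) (complex_of_real t)) = (\<lambda>_. 0)"
        using nz(2) by (auto simp: u\<^sub>2_def fun_eq_iff)
      with m2.nrm_poly_limit[OF m2.poly_limit_add[OF m2.poly_limit_mult[OF m2.poly_limit_add[OF q(1), of 1],
            of "[:\<omega>\<^sub>2, -1:]"], of "- [:b:]"]]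
      show ?thesis by (simp only: m2.l2_zero add.commute[of "q _" 1] diff_conv_add_uminus)
    qed
    have lim_e: "(\<lambda>k. f.nrm (poly_eval (a\<^sub>1 + a\<^sub>2) ([:\<omega>\<^sub>1 + \<omega>\<^sub>2 - b, -1:] * P k - 1))) \<longlonglongrightarrow> 0"
    proof -
      have "(\<lambda>t. poly [:\<omega>\<^sub>1 + \<omega>\<^sub>2 - b, -1:] (complex_of_real t) * (1 / (z - complex_of_real t))
          + poly (- 1) (complex_of_real t)) = (\<lambda>_. 0)"
        using nz(3) unfolding zb by (auto simp: fun_eq_iff)
      with m.nrm_poly_limit[OF m.poly_limit_add[OF m.poly_limit_mult[OF P, of "[:\<omega>\<^sub>1 + \<omega>\<^sub>2 - b, -1:]"], of "- 1"]]
      show ?thesis by (simp only: m.l2_zero diff_conv_add_uminus)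
    qed
    have lim_X: "(\<lambda>k. f.nrm (poly_eval a\<^sub>1 ([:\<omega>\<^sub>1, -1:] * p k)))
        \<longlonglongrightarrow> m1.l2 (\<lambda>t. (\<omega>\<^sub>1 - complex_of_real t) * u\<^sub>1 t)"
      using m1.nrm_poly_limit[OF m1.poly_limit_mult[OF p(1), of "[:\<omega>\<^sub>1, -1:]"]] by simp
    have lim_1: "(\<lambda>k. f.nrm (1 + poly_eval a\<^sub>1 (p k))) \<longlonglongrightarrow> C"
      using m1.nrm_poly_limit[OF m1.poly_limit_add[OF p(1), of 1]]
      by (simp add: C_def poly_eval_add add.commute)
    have lim_2: "(\<lambda>k. f.nrm (1 + poly_eval a\<^sub>2 (q k))) \<longlonglongrightarrow> m2.l2 (\<lambda>t. u\<^sub>2 t + 1)"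
      using m2.nrm_poly_limit[OF m2.poly_limit_add[OF q(1), of 1]]
      by (simp add: poly_eval_add add.commute)
    define x y x1 y1 r1 r2 e X W where "x k = f.nrm (poly_eval a\<^sub>1 (p k))"
      and "y k = f.nrm (poly_eval a\<^sub>2 (q k))"
      and "x1 k = f.nrm (1 + poly_eval a\<^sub>1 (p k))" and "y1 k = f.nrm (1 + poly_eval a\<^sub>2 (q k))"
      and "r1 k = f.nrm (poly_eval a\<^sub>1 ([:\<omega>\<^sub>1, -1:] * (1 + p k) - [:b:]))"
      and "r2 k = f.nrm (poly_eval a\<^sub>2 ([:\<omega>\<^sub>2, -1:] * (1 + q k) - [:b:]))"
      and "e k = f.nrm (poly_eval (a\<^sub>1 + a\<^sub>2) ([:\<omega>\<^sub>1 + \<omega>\<^sub>2 - b, -1:] * P k - 1))"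
      and "X k = f.nrm (poly_eval a\<^sub>1 ([:\<omega>\<^sub>1, -1:] * p k))"
      and "W k = f.nrm (poly_eval (a\<^sub>1 + a\<^sub>2) (P k))" for k
    note defs = x_def y_def x1_def y1_def r1_def r2_def e_def X_def W_def
    note lims = lim_r1 lim_r2 lim_e lim_X lim_1 lim_2 m1.nrm_poly_limit[OF p(1)]
      m2.nrm_poly_limit[OF q(1)] m.nrm_poly_limit[OF P]
    note lims = lims[folded defs]
    have ineq: "cmod (b * \<phi> (poly_eval (a\<^sub>1 + a\<^sub>2) (P k)) - 1)
        \<le> e k * (\<Sum>n<Suc N. y1 k * ((x k * y k) ^ n * x1 k))
          + W k * (r1 k + X k * (y k * ((x k * y k) ^ N * x1 k))
            + (\<Sum>n<Suc N. r1 k * (y k * ((x k * y k) ^ n * x1 k)) + r2 k * ((x k * y k) ^ n * x1 k)))" for k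
      unfolding defs by (intro f.approximate_resolvent_bound centered m.selfadjoint)
    have lhs: "(\<lambda>k. cmod (b * \<phi> (poly_eval (a\<^sub>1 + a\<^sub>2) (P k)) - 1)) \<longlonglongrightarrow> cmod (b * cauchy_transform \<mu> z - 1)"
      unfolding m.state_poly_eval cauchy_transform_def
      by (intro tendsto_intros m.poly_limit_integral P)
    have rhs: "(\<lambda>k. e k * (\<Sum>n<Suc N. y1 k * ((x k * y k) ^ n * x1 k))
          + W k * (r1 k + X k * (y k * ((x k * y k) ^ N * x1 k))
            + (\<Sum>n<Suc N. r1 k * (y k * ((x k * y k) ^ n * x1 k)) + r2 k * ((x k * y k) ^ n * x1 k))))
        \<longlonglongrightarrow> 0 * (\<Sum>n<Suc N. m2.l2 (\<lambda>t. u\<^sub>2 t + 1) * ((m1.l2 u\<^sub>1 * m2.l2 u\<^sub>2) ^ n * C))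
          + m.l2 (\<lambda>t. 1 / (z - complex_of_real t)) * (0 + m1.l2 (\<lambda>t. (\<omega>\<^sub>1 - complex_of_real t) * u\<^sub>1 t)
              * (m2.l2 u\<^sub>2 * ((m1.l2 u\<^sub>1 * m2.l2 u\<^sub>2) ^ N * C))
            + (\<Sum>n<Suc N. 0 * (m2.l2 u\<^sub>2 * ((m1.l2 u\<^sub>1 * m2.l2 u\<^sub>2) ^ n * C))
                + 0 * ((m1.l2 u\<^sub>1 * m2.l2 u\<^sub>2) ^ n * C)))"
      by (intro tendsto_add tendsto_mult tendsto_sum tendsto_power lims)
    show ?thesis
      using LIMSEQ_le[OF lhs rhs] ineq by (simp add: B_def \<rho>_def)
  qed
  have "\<rho> \<ge> 0" unfolding \<rho>_def m1.l2_def m2.l2_def by simp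
  moreover have "\<rho> < 1"
  proof -
    have s1: "(m1.l2 u\<^sub>1)\<^sup>2 = Im b / Im \<omega>\<^sub>1 - 1" unfolding u\<^sub>1_def b_def by (rule m1.l2_resolvent[OF \<omega>(1)])
    have s2: "(m2.l2 u\<^sub>2)\<^sup>2 = Im b / Im \<omega>\<^sub>2 - 1" unfolding u\<^sub>2_def b2 by (rule m2.l2_resolvent[OF \<omega>(2)])
    have Imb: "Im b = Im \<omega>\<^sub>1 + Im \<omega>\<^sub>2 - Im z"
      using zb by (metis add_diff_cancel_left' diff_add_cancel minus_complex.sel(2) plus_complex.sel(2))
    have "Im b / Im \<omega>\<^sub>1 - 1 = (Im \<omega>\<^sub>2 - Im z) / Im \<omega>\<^sub>1" "Im b / Im \<omega>\<^sub>2 - 1 = (Im \<omega>\<^sub>1 - Im z) / Im \<omega>\<^sub>2"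
      using \<omega> by (auto simp: Imb field_simps)
    note s = s1[unfolded this] s2[unfolded this]
    \<comment> \<open>The quotients are squares of L2 norms by \<open>s\<close>, so both numerators
      are nonnegative; Im z > 0 then makes the product of the quotients, which is \<rho>^2, strictly
      less than 1.\<close>
    have "(Im \<omega>\<^sub>2 - Im z) / Im \<omega>\<^sub>1 \<ge> 0" "(Im \<omega>\<^sub>1 - Im z) / Im \<omega>\<^sub>2 \<ge> 0"
      using s[symmetric] by simp_all
    then have nn: "Im \<omega>\<^sub>2 - Im z \<ge> 0" "Im \<omega>\<^sub>1 - Im z \<ge> 0"
      using \<omega> by (auto simp: zero_le_divide_iff)
    have "(Im \<omega>\<^sub>2 - Im z) * (Im \<omega>\<^sub>1 - Im z) < Im \<omega>\<^sub>2 * Im \<omega>\<^sub>1"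
      using nn z by (intro mult_strict_mono') auto
    then have "\<rho>\<^sup>2 < 1\<^sup>2" unfolding \<rho>_def power_mult_distrib s using \<omega> by (simp add: field_simps)
    then show ?thesis by (rule power2_less_imp_less) simp
  qed
  ultimately have "(\<lambda>N. \<rho> ^ N) \<longlonglongrightarrow> 0" by (simp add: LIMSEQ_realpow_zero)
  then have "B \<longlonglongrightarrow> 0"
    unfolding B_def by (intro tendsto_mult_right_zero tendsto_mult_left_zero)
  then have "cmod (b * cauchy_transform \<mu> z - 1) \<le> 0"
    by (rule LIMSEQ_le_const) (use bound in auto)
  then show ?thesis using m1.cauchy_transform_nonzero[OF \<omega>(1)] by (simp add: b_def field_simps)
qed


section \<open>Atoms from an unbounded Cauchy transform\<close>

context bounded_distribution
begin

text \<open>Split the integral at distance d from \<alpha>. Cauchy-Schwarz bounds the near part; on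
  the far part |w - t| >= d / 2.\<close>

lemma cmod_cauchy_transform_le_local:
  assumes w: "Im w > 0" and d: "d > 0" and near: "cmod (w - complex_of_real \<alpha>) \<le> d / 2"
  shows "cmod (cauchy_transform \<mu> w) \<le> sqrt (measure \<mu> {\<alpha> - d..\<alpha> + d} * energy w) + 2 / d"
proof -
  define B where "B = {\<alpha> - d..\<alpha> + d}"
  have [measurable]: "B \<in> sets borel" by (simp add: B_def)
  let ?h = "\<lambda>t. 1 / (w - complex_of_real t)"
  let ?i = "\<lambda>t. complex_of_real (indicator B t)"
  have int: "integrable \<mu> (\<lambda>t. ?i t * ?h t)" "integrable \<mu> (\<lambda>t. (1 - ?i t) * ?h t)"
    by (rule Bochner_Integration.integrable_bound[OF integrable_inverse_diff[OF w]];
        auto simp: norm_mult indicator_def)+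
  have "cauchy_transform \<mu> w = (\<integral>t. ?i t * ?h t + (1 - ?i t) * ?h t \<partial>\<mu>)"
    unfolding cauchy_transform_def by (simp add: diff_divide_distrib)
  also have "\<dots> = (\<integral>t. ?i t * ?h t \<partial>\<mu>) + (\<integral>t. (1 - ?i t) * ?h t \<partial>\<mu>)"
    using int by (rule Bochner_Integration.integral_add)
  finally have split: "cauchy_transform \<mu> w = (\<integral>t. ?i t * ?h t \<partial>\<mu>) + (\<integral>t. (1 - ?i t) * ?h t \<partial>\<mu>)" .
  have near_part: "cmod (\<integral>t. ?i t * ?h t \<partial>\<mu>) \<le> sqrt (measure \<mu> B * energy w)"
  proof (rule real_le_rsqrt)
    have sq: "(cmod (?i t))\<^sup>2 = indicator B t" for t
      by (cases "t \<in> B") auto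
    have "(cmod (\<integral>t. ?i t * ?h t \<partial>\<mu>))\<^sup>2 \<le> (\<integral>t. (cmod (?i t))\<^sup>2 \<partial>\<mu>) * (\<integral>t. (cmod (?h t))\<^sup>2 \<partial>\<mu>)"
    proof (rule Cauchy_Schwarz_integral)
      show "integrable \<mu> (\<lambda>t. (cmod (?i t))\<^sup>2)"
        unfolding sq by (intro integrable_real_indicator) (auto simp: less_top[symmetric])
    qed (use integrable_energy[OF w] in simp_all)
    then show "(cmod (\<integral>t. ?i t * ?h t \<partial>\<mu>))\<^sup>2 \<le> measure \<mu> B * energy w"
      unfolding sq by (simp add: energy_def)
  qed
  have "cmod (\<integral>t. (1 - ?i t) * ?h t \<partial>\<mu>) \<le> (\<integral>t. 2 / d \<partial>\<mu>)"
  proof (rule Bochner_Integration.integral_norm_bound_integral[OF int(2)])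
    fix t
    show "norm ((1 - ?i t) * ?h t) \<le> 2 / d"
    proof (cases "t \<in> B")
      case False
      then have "d \<le> cmod (complex_of_real \<alpha> - complex_of_real t)"
        by (simp flip: of_real_diff) (auto simp: abs_real_def B_def)
      also have "\<dots> \<le> cmod (w - complex_of_real t) + cmod (w - complex_of_real \<alpha>)"
        using norm_triangle_ineq4[of "w - complex_of_real t" "w - complex_of_real \<alpha>"] by simp
      finally have "d / 2 \<le> cmod (w - complex_of_real t)" using near by simp
      then have "1 / cmod (w - complex_of_real t) \<le> 1 / (d / 2)"
        using d by (intro frac_le) auto
      then show ?thesis using False by (simp add: norm_divide)
    qed (use d in simp)
  qed simp
  then have far_part: "cmod (\<integral>t. (1 - ?i t) * ?h t \<partial>\<mu>) \<le> 2 / d" by (simp add: prob_space)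
  show ?thesis
    unfolding split B_def[symmetric] by (rule norm_triangle_mono[OF near_part far_part])
qed

text \<open>The ratio equals |G|^2 / energy. In the local estimate divided by the square root of the
  energy, the far term tends to 0, and the mass of [\<alpha> - d, \<alpha> + d] is close to that of
  the atom for small d.\<close>

lemma Im_ratio_eventually_le_atom:
  assumes w: "\<And>n. Im (w n) > 0" and lim: "w \<longlonglongrightarrow> complex_of_real \<alpha>"
    and G: "filterlim (\<lambda>n. cmod (cauchy_transform \<mu> (w n))) at_top sequentially" and e: "e > 0"
  shows "\<forall>\<^sub>F n in sequentially. Im (w n) / Im (1 / cauchy_transform \<mu> (w n)) \<le> measure \<mu> {\<alpha>} + e"
proof -
  have "(\<lambda>n. measure \<mu> {\<alpha> - 1 / Suc n..\<alpha> + 1 / Suc n}) \<longlonglongrightarrow> measure \<mu> (\<Inter>n. {\<alpha> - 1 / Suc n..\<alpha> + 1 / Suc n})"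
  proof (rule finite_Lim_measure_decseq)
    show "decseq (\<lambda>n. {\<alpha> - 1 / real (Suc n)..\<alpha> + 1 / real (Suc n)})"
    proof (rule decseq_SucI)
      fix n
      have "1 / real (Suc (Suc n)) \<le> 1 / real (Suc n)" by (intro divide_left_mono) auto
      then show "{\<alpha> - 1 / real (Suc (Suc n))..\<alpha> + 1 / real (Suc (Suc n))}
          \<subseteq> {\<alpha> - 1 / real (Suc n)..\<alpha> + 1 / real (Suc n)}"
        by auto
    qed
  qed auto
  also have "(\<Inter>n. {\<alpha> - 1 / real (Suc n)..\<alpha> + 1 / real (Suc n)}) = {\<alpha>}"
  proof (rule equalityI; rule subsetI)
    fix t assume t: "t \<in> (\<Inter>n. {\<alpha> - 1 / real (Suc n)..\<alpha> + 1 / real (Suc n)})"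
    have "\<bar>t - \<alpha>\<bar> \<le> 0"
    proof (rule LIMSEQ_le_const[OF LIMSEQ_inverse_real_of_nat])
      show "\<exists>N. \<forall>n\<ge>N. \<bar>t - \<alpha>\<bar> \<le> inverse (real (Suc n))"
      proof (intro exI allI impI)
        fix n
        have "t \<in> {\<alpha> - 1 / real (Suc n)..\<alpha> + 1 / real (Suc n)}" using t by blast
        then show "\<bar>t - \<alpha>\<bar> \<le> inverse (real (Suc n))"
          unfolding inverse_eq_divide abs_le_iff by simp
      qed
    qed
    then show "t \<in> {\<alpha>}" by simp
  qed auto
  finally have "\<forall>\<^sub>F n in sequentially.
      measure \<mu> {\<alpha> - 1 / real (Suc n)..\<alpha> + 1 / real (Suc n)} < measure \<mu> {\<alpha>} + e / 2"
    using e by (intro order_tendstoD(2)) auto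
  then obtain n where n: "measure \<mu> {\<alpha> - 1 / real (Suc n)..\<alpha> + 1 / real (Suc n)} < measure \<mu> {\<alpha>} + e / 2"
    by (auto simp: eventually_sequentially)
  define d where "d = 1 / real (Suc n)"
  define m where "m = measure \<mu> {\<alpha> - d..\<alpha> + d}"
  have d: "d > 0" and m: "m \<ge> 0" "m < measure \<mu> {\<alpha>} + e / 2" using n by (auto simp: d_def m_def)
  let ?g = "\<lambda>n. cmod (cauchy_transform \<mu> (w n))"
  have "(\<lambda>n. 2 / d / ?g n) \<longlonglongrightarrow> 0" by (rule real_tendsto_divide_at_top[OF tendsto_const G])
  then have "(\<lambda>n. (sqrt m + 2 / d / ?g n)\<^sup>2) \<longlonglongrightarrow> (sqrt m + 0)\<^sup>2"
    by (intro tendsto_intros)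
  moreover have "(sqrt m + 0)\<^sup>2 < measure \<mu> {\<alpha>} + e" using m e by simp
  ultimately have small: "\<forall>\<^sub>F n in sequentially. (sqrt m + 2 / d / ?g n)\<^sup>2 < measure \<mu> {\<alpha>} + e"
    by (rule order_tendstoD(2))
  have near: "\<forall>\<^sub>F n in sequentially. dist (w n) (complex_of_real \<alpha>) < d / 2"
    using d by (intro tendstoD[OF lim]) auto
  from small near show ?thesis
  proof eventually_elim
    fix n assume s: "(sqrt m + 2 / d / ?g n)\<^sup>2 < measure \<mu> {\<alpha>} + e"
      and near: "dist (w n) (complex_of_real \<alpha>) < d / 2"
    have I: "energy (w n) > 0" by (rule energy_pos[OF w])
    have g: "?g n > 0" using cauchy_transform_nonzero[OF w] by simp
    have gI: "?g n \<le> sqrt (energy (w n))"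
      by (rule real_le_rsqrt) (rule cmod_cauchy_transform_le_energy[OF w])
    have "?g n \<le> sqrt m * sqrt (energy (w n)) + 2 / d"
      using cmod_cauchy_transform_le_local[OF w d, of n \<alpha>] near
      by (simp add: m_def dist_norm real_sqrt_mult)
    then have "?g n / sqrt (energy (w n)) \<le> sqrt m + 2 / d / sqrt (energy (w n))"
      using I by (simp add: field_simps)
    \<comment> \<open>The energy is at least |G|^2, so the divergence of |G| makes this term
      negligible.\<close>
    also have "2 / d / sqrt (energy (w n)) \<le> 2 / d / ?g n"
      using d g gI by (intro frac_le) auto
    finally have "?g n / sqrt (energy (w n)) \<le> sqrt m + 2 / d / ?g n" by simp
    then have "(?g n / sqrt (energy (w n)))\<^sup>2 \<le> (sqrt m + 2 / d / ?g n)\<^sup>2"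
      using g I by (intro power_mono) auto
    then have "(?g n)\<^sup>2 / energy (w n) \<le> (sqrt m + 2 / d / ?g n)\<^sup>2"
      using I by (simp add: power_divide)
    moreover have "Im (w n) / Im (1 / cauchy_transform \<mu> (w n)) = (?g n)\<^sup>2 / energy (w n)"
      unfolding Im_reciprocal_cauchy_transform[OF w] using w[of n] by simp
    ultimately show "Im (w n) / Im (1 / cauchy_transform \<mu> (w n)) \<le> measure \<mu> {\<alpha>} + e"
      using s by linarith
  qed
qed

text \<open>At distance more than 1 from [-M, M] the kernel is smaller than 1; this confines the
  subordination points to a compact set.\<close>

lemma cauchy_transform_large_imp_bounded:
  assumes w: "Im w > 0" and G: "cmod (cauchy_transform \<mu> w) \<ge> 1"
  shows "cmod w \<le> M + 1"
proof (rule ccontr)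
  assume "\<not> cmod w \<le> M + 1"
  then have r: "cmod w - M > 1" by simp
  have "cmod (cauchy_transform \<mu> w) \<le> (\<integral>t. cmod (1 / (w - complex_of_real t)) \<partial>\<mu>)"
    unfolding cauchy_transform_def by (rule integral_norm_bound)
  also have "\<dots> \<le> (\<integral>t. 1 / (cmod w - M) \<partial>\<mu>)"
  proof (rule integral_mono_AE)
    show "AE t in \<mu>. cmod (1 / (w - complex_of_real t)) \<le> 1 / (cmod w - M)"
      using AE_bounded
    proof eventually_elim
      fix t assume "\<bar>t\<bar> \<le> M"
      then have "cmod w - M \<le> cmod (w - complex_of_real t)"
        using norm_triangle_ineq2[of w "complex_of_real t"] by simp
      then show "cmod (1 / (w - complex_of_real t)) \<le> 1 / (cmod w - M)"
        using r by (auto simp: norm_divide intro!: frac_le)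
    qed
  qed (use integrable_inverse_diff[OF w] in auto)
  also have "\<dots> = 1 / (cmod w - M)" by (simp add: prob_space)
  also have "\<dots> < 1" using r by simp
  finally show False using G by simp
qed

end

lemma unbounded_imp_atoms:
  assumes "bounded_distribution \<mu>\<^sub>1 M" and "bounded_distribution \<mu>\<^sub>2 M"
    and subordination: "\<And>z. Im z > 0 \<Longrightarrow> \<exists>\<omega>\<^sub>1 \<omega>\<^sub>2. Im \<omega>\<^sub>1 > 0 \<and> Im \<omega>\<^sub>2 > 0 \<and>
      cauchy_transform \<mu> z = cauchy_transform \<mu>\<^sub>1 \<omega>\<^sub>1 \<and> cauchy_transform \<mu> z = cauchy_transform \<mu>\<^sub>2 \<omega>\<^sub>2 \<and>
      \<omega>\<^sub>1 + \<omega>\<^sub>2 = z + 1 / cauchy_transform \<mu> z"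
    and unbounded: "unbounded_cauchy_transform \<mu>"
  shows "\<exists>\<alpha> \<beta>. measure \<mu>\<^sub>1 {\<alpha>} + measure \<mu>\<^sub>2 {\<beta>} \<ge> 1"
proof -
  interpret m1: bounded_distribution \<mu>\<^sub>1 M by fact
  interpret m2: bounded_distribution \<mu>\<^sub>2 M by fact
  \<comment> \<open>The added 1 gives |G| >= 1 already at n = 0, so that every subordination point
    is confined.\<close>
  have "\<exists>z. Im z > 0 \<and> cmod (cauchy_transform \<mu> z) > real n + 1" for n
    using unbounded unfolding unbounded_cauchy_transform_def bounded_iff upper_half_plane_def
    by (auto simp: not_le)
  then obtain z where z: "\<And>n. Im (z n) > 0" "\<And>n. cmod (cauchy_transform \<mu> (z n)) > real n + 1" by metis
  define G where "G n = cauchy_transform \<mu> (z n)" for n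
  have "\<exists>v w. Im v > 0 \<and> Im w > 0 \<and> G n = cauchy_transform \<mu>\<^sub>1 v \<and> G n = cauchy_transform \<mu>\<^sub>2 w \<and>
      v + w = z n + 1 / G n" for n
    using subordination[OF z(1)] unfolding G_def .
  then obtain v w where vw: "\<And>n. Im (v n) > 0" "\<And>n. Im (w n) > 0"
    and Gv: "\<And>n. G n = cauchy_transform \<mu>\<^sub>1 (v n)" and Gw: "\<And>n. G n = cauchy_transform \<mu>\<^sub>2 (w n)"
    and sum: "\<And>n. v n + w n = z n + 1 / G n" by metis
  have G1: "cmod (G n) > real n + 1" for n using z(2) by (simp add: G_def)
  have range: "\<forall>n. (v n, w n) \<in> cball 0 (M + 1) \<times> cball 0 (M + 1)"
  proof
    fix n
    have "cmod (G n) \<ge> 1" using G1[of n] by linarith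
    then show "(v n, w n) \<in> cball 0 (M + 1) \<times> cball 0 (M + 1)"
      using m1.cauchy_transform_large_imp_bounded[OF vw(1), of n]
        m2.cauchy_transform_large_imp_bounded[OF vw(2), of n] by (simp flip: Gv Gw)
  qed
  have "seq_compact (cball (0::complex) (M + 1) \<times> cball (0::complex) (M + 1))"
    by (intro compact_imp_seq_compact compact_Times compact_cball)
  from seq_compactE[OF this, of "\<lambda>n. (v n, w n)"] obtain l r
    where r: "strict_mono (r :: nat \<Rightarrow> nat)" and lim: "((\<lambda>n. (v n, w n)) \<circ> r) \<longlonglongrightarrow> l"
    using range by metis
  define v' w' z' G' where "v' = v \<circ> r" and "w' = w \<circ> r" and "z' = z \<circ> r" and "G' = G \<circ> r"
  have limv: "v' \<longlonglongrightarrow> fst l" and limw: "w' \<longlonglongrightarrow> snd l"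
    using tendsto_fst[OF lim] tendsto_snd[OF lim] by (simp_all add: v'_def w'_def o_def)
  have vw': "Im (v' n) > 0" "Im (w' n) > 0" "Im (z' n) > 0" for n
    using vw z by (simp_all add: v'_def w'_def z'_def)
  have Gv': "cauchy_transform \<mu>\<^sub>1 (v' n) = G' n" and Gw': "cauchy_transform \<mu>\<^sub>2 (w' n) = G' n"
    and sum': "v' n + w' n = z' n + 1 / G' n" for n
    using Gv Gw sum by (simp_all add: v'_def w'_def z'_def G'_def)
  have Ginf: "filterlim (\<lambda>n. cmod (G' n)) at_top sequentially"
  proof (rule filterlim_at_top_mono[OF filterlim_real_sequentially])
    show "\<forall>\<^sub>F n in sequentially. real n \<le> cmod (G' n)"
    proof (intro always_eventually allI)
      fix n
      have "real n \<le> real (r n)" using seq_suble[OF r, of n] by simp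
      then show "real n \<le> cmod (G' n)" using G1[of "r n"] by (simp add: G'_def)
    qed
  qed
  then have inv: "(\<lambda>n. 1 / cmod (G' n)) \<longlonglongrightarrow> 0" by (intro real_tendsto_divide_at_top[OF tendsto_const])
  have Im_le: "Im (v' n) \<le> Im (1 / G' n)" "Im (w' n) \<le> Im (1 / G' n)" for n
    using m1.Im_le_Im_reciprocal[OF vw'(1), of n] m2.Im_le_Im_reciprocal[OF vw'(2), of n]
    by (simp_all only: Gv' Gw')
  have "Im (1 / G' n) \<le> 1 / cmod (G' n)" for n
    using abs_Im_le_cmod[of "1 / G' n"] by (simp add: norm_divide)
  then have upper: "Im (v' n) \<le> 1 / cmod (G' n)" "Im (w' n) \<le> 1 / cmod (G' n)" for n
    using Im_le order_trans by blast+
  \<comment> \<open>Both imaginary parts lie between 0 and 1 / |G'|, hence the limit points are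
    real.\<close>
  have "(\<lambda>n. Im (v' n)) \<longlonglongrightarrow> 0" "(\<lambda>n. Im (w' n)) \<longlonglongrightarrow> 0"
    by (rule tendsto_sandwich[OF _ _ tendsto_const inv];
        simp only: upper less_imp_le[OF vw'(1)] less_imp_le[OF vw'(2)] eventually_True)+
  then have "Im (fst l) = 0" "Im (snd l) = 0"
    using LIMSEQ_unique tendsto_Im[OF limv] tendsto_Im[OF limw] by blast+
  then have l: "fst l = complex_of_real (Re (fst l))" "snd l = complex_of_real (Re (snd l))"
    by (simp_all add: complex_eq_iff)
  define \<alpha> \<beta> where "\<alpha> = Re (fst l)" and "\<beta> = Re (snd l)"
  have limv: "v' \<longlonglongrightarrow> complex_of_real \<alpha>" and limw: "w' \<longlonglongrightarrow> complex_of_real \<beta>"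
    using limv limw l by (simp_all add: \<alpha>_def \<beta>_def)
  have "1 \<le> measure \<mu>\<^sub>1 {\<alpha>} + measure \<mu>\<^sub>2 {\<beta>} + e" if e: "e > 0" for e
  proof -
    have e2: "e / 2 > 0" using e by simp
    have "\<forall>\<^sub>F n in sequentially. Im (v' n) / Im (1 / G' n) \<le> measure \<mu>\<^sub>1 {\<alpha>} + e / 2"
      using m1.Im_ratio_eventually_le_atom[OF vw'(1) limv _ e2] Ginf by (simp only: Gv')
    moreover have "\<forall>\<^sub>F n in sequentially. Im (w' n) / Im (1 / G' n) \<le> measure \<mu>\<^sub>2 {\<beta>} + e / 2"
      using m2.Im_ratio_eventually_le_atom[OF vw'(2) limw _ e2] Ginf by (simp only: Gw')
    ultimately have "\<forall>\<^sub>F n in sequentially. 1 \<le> measure \<mu>\<^sub>1 {\<alpha>} + measure \<mu>\<^sub>2 {\<beta>} + e"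
    proof eventually_elim
      case (elim n)
      have F: "Im (1 / G' n) > 0" using Im_le(1)[of n] vw'(1)[of n] by linarith
      \<comment> \<open>Since Im z' > 0, the two ratios sum to at least 1, while each is at most its
        atom plus e / 2.\<close>
      have "Im (v' n) + Im (w' n) = Im (z' n) + Im (1 / G' n)"
        using arg_cong[OF sum'[of n], of Im] by simp
      then have "1 \<le> (Im (v' n) + Im (w' n)) / Im (1 / G' n)"
        using F vw'(3)[of n] by (subst pos_le_divide_eq) auto
      then show ?case using elim by (simp add: add_divide_distrib)
    qed
    then show ?thesis by simp
  qed
  then have "1 \<le> measure \<mu>\<^sub>1 {\<alpha>} + measure \<mu>\<^sub>2 {\<beta>}" by (rule field_le_epsilon)
  then show ?thesis by blast
qed


section \<open>Marginals of a pair distribution\<close>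

lemma bounded_distribution_distr:
  assumes "prob_space \<eta>" and [measurable_cong]: "sets \<eta> = sets borel"
    and [measurable]: "f \<in> borel_measurable borel" and "AE x in \<eta>. \<bar>f x\<bar> \<le> M"
  shows "bounded_distribution (distr \<eta> borel f) M"
proof -
  interpret prob_space \<eta> by fact
  interpret d: prob_space "distr \<eta> borel f" by (rule prob_space_distr) measurable
  show ?thesis
  proof unfold_locales
    show "AE t in distr \<eta> borel f. \<bar>t\<bar> \<le> M" using assms(4) by (subst AE_distr_iff) auto
  qed simp
qed

text \<open>The bounds hold for every larger radius, so that all the measures can later use one
  common M. The moments of the marginals are the joint moments with one exponent 0.\<close>

lemma pair_distribution_marginals:
  assumes \<eta>: "pair_distribution \<phi> (a, b) \<eta>"
  obtains M where "\<And>N. N \<ge> M \<Longrightarrow> bounded_distribution (first_marginal \<eta>) N"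
    and "\<And>N. N \<ge> M \<Longrightarrow> bounded_distribution (second_marginal \<eta>) N"
    and "has_moments \<phi> a (first_marginal \<eta>)" and "has_moments \<phi> b (second_marginal \<eta>)"
proof -
  have p: "prob_space \<eta>" and s[measurable_cong]: "sets \<eta> = sets borel"
    and mom: "\<And>m n. \<phi> (a ^ m * b ^ n) = complex_of_real (\<integral>x. fst x ^ m * snd x ^ n \<partial>\<eta>)"
    using \<eta> unfolding pair_distribution_def by auto
  obtain K where K: "compact K" "emeasure \<eta> (- K) = 0" using \<eta> unfolding pair_distribution_def by auto
  obtain M where M: "\<And>x. x \<in> K \<Longrightarrow> norm x \<le> M"
    using compact_imp_bounded[OF K(1)] unfolding bounded_iff by blast
  have "- K \<in> sets \<eta>" using compact_imp_closed[OF K(1)] by (simp add: s)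
  then have "- K \<in> null_sets \<eta>" using K(2) by auto
  then have AE: "AE x in \<eta>. x \<in> K" by (rule AE_I') auto
  have le: "\<bar>fst x\<bar> \<le> norm x" "\<bar>snd x\<bar> \<le> norm x" for x :: "real \<times> real"
    using norm_fst_le[of "fst x" "snd x"] norm_snd_le[of "snd x" "fst x"] by simp_all
  have fst_snd [measurable]: "fst \<in> borel_measurable (borel :: (real \<times> real) measure)"
    "snd \<in> borel_measurable (borel :: (real \<times> real) measure)"
    by (auto intro!: borel_measurable_continuous_onI continuous_intros)
  show thesis
  proof (rule that[of M])
    fix N assume N: "N \<ge> M"
    have "AE x in \<eta>. \<bar>fst x\<bar> \<le> N" "AE x in \<eta>. \<bar>snd x\<bar> \<le> N"
      using AE by (eventually_elim, metis M N le order_trans)+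
    then show "bounded_distribution (first_marginal \<eta>) N" "bounded_distribution (second_marginal \<eta>) N"
      unfolding first_marginal_def second_marginal_def
      using bounded_distribution_distr[OF p s] fst_snd by blast+
  next
    show "has_moments \<phi> a (first_marginal \<eta>)"
      unfolding has_moments_def first_marginal_def
      using mom[of _ 0] by (simp add: integral_distr)
    show "has_moments \<phi> b (second_marginal \<eta>)"
      unfolding has_moments_def second_marginal_def
      using mom[of 0] by (simp add: integral_distr)
  qed
qed

section \<open>From the two-variable Cauchy transform to the marginals\<close>

text \<open>Cauchy-Schwarz with respect to \<eta> separates the variables into the energies of the
  marginals, and Im z * energy(z) = |Im G(z)| <= |G(z)|.\<close>

lemma cauchy_transform2_bound:
  assumes \<eta>: "prob_space \<eta>" and s[measurable_cong]: "sets \<eta> = sets borel"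
    and b1: "bounded_distribution (first_marginal \<eta>) M" and b2: "bounded_distribution (second_marginal \<eta>) M"
    and z: "Im z > 0" and w: "Im w > 0"
  shows "sqrt (Im z * Im w) * cmod (cauchy_transform2 \<eta> z w)
    \<le> sqrt (cmod (cauchy_transform (first_marginal \<eta>) z) * cmod (cauchy_transform (second_marginal \<eta>) w))"
proof -
  interpret m1: bounded_distribution "first_marginal \<eta>" M by fact
  interpret m2: bounded_distribution "second_marginal \<eta>" M by fact
  have [measurable]: "fst \<in> borel_measurable (borel :: (real \<times> real) measure)"
    "snd \<in> borel_measurable (borel :: (real \<times> real) measure)"
    by (auto intro!: borel_measurable_continuous_onI continuous_intros)
  let ?f = "\<lambda>x :: real \<times> real. 1 / (z - complex_of_real (fst x))"
  let ?g = "\<lambda>x :: real \<times> real. 1 / (w - complex_of_real (snd x))"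
  have f: "integrable \<eta> (\<lambda>x. (cmod (?f x))\<^sup>2)" "(\<integral>x. (cmod (?f x))\<^sup>2 \<partial>\<eta>) = m1.energy z"
    using m1.integrable_energy[OF z] unfolding m1.energy_def
    by (simp_all add: first_marginal_def integral_distr integrable_distr_eq)
  have g: "integrable \<eta> (\<lambda>x. (cmod (?g x))\<^sup>2)" "(\<integral>x. (cmod (?g x))\<^sup>2 \<partial>\<eta>) = m2.energy w"
    using m2.integrable_energy[OF w] unfolding m2.energy_def
    by (simp_all add: second_marginal_def integral_distr integrable_distr_eq)
  have "(cmod (\<integral>x. ?f x * ?g x \<partial>\<eta>))\<^sup>2 \<le> m1.energy z * m2.energy w"
    unfolding f(2)[symmetric] g(2)[symmetric]
    by (rule Cauchy_Schwarz_integral[OF _ _ f(1) g(1)]) measurable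
  then have "(cmod (cauchy_transform2 \<eta> z w))\<^sup>2 \<le> m1.energy z * m2.energy w"
    by (simp add: cauchy_transform2_def)
  then have "(Im z * Im w) * (cmod (cauchy_transform2 \<eta> z w))\<^sup>2 \<le> (Im z * Im w) * (m1.energy z * m2.energy w)"
    using z w by (intro mult_left_mono) auto
  also have "\<dots> = (Im z * m1.energy z) * (Im w * m2.energy w)" by simp
  also have "\<dots> \<le> cmod (cauchy_transform (first_marginal \<eta>) z) * cmod (cauchy_transform (second_marginal \<eta>) w)"
    using abs_Im_le_cmod[of "cauchy_transform (first_marginal \<eta>) z"] m1.Im_cauchy_transform[OF z]
      abs_Im_le_cmod[of "cauchy_transform (second_marginal \<eta>) w"] m2.Im_cauchy_transform[OF w]
      z w m2.energy_pos[OF w]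
    by (intro mult_mono) auto
  finally show ?thesis
    using z w by (intro real_le_rsqrt) (simp add: power_mult_distrib)
qed

text \<open>Brouwer's theorem provides subordination points, freeness identifies their common value
  with G(z), and compactness extracts the atoms.\<close>

lemma free_sum_atoms:
  assumes "faithful_state \<phi>" and sa: "a\<^sub>1\<^sup>\<star> = a\<^sub>1" "a\<^sub>2\<^sup>\<star> = a\<^sub>2" and free: "free_pair \<phi> a\<^sub>1 a\<^sub>2"
    and b: "bounded_distribution \<mu>\<^sub>1 M" "bounded_distribution \<mu>\<^sub>2 M" "bounded_distribution \<mu> M"
    and mom: "has_moments \<phi> a\<^sub>1 \<mu>\<^sub>1" "has_moments \<phi> a\<^sub>2 \<mu>\<^sub>2" "has_moments \<phi> (a\<^sub>1 + a\<^sub>2) \<mu>"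
    and unbounded: "unbounded_cauchy_transform \<mu>"
  shows "\<exists>\<alpha> \<beta>. measure \<mu>\<^sub>1 {\<alpha>} + measure \<mu>\<^sub>2 {\<beta>} \<ge> 1"
proof (rule unbounded_imp_atoms[OF b(1,2) _ unbounded])
  have st: "positive_state \<phi>" using assms(1) by (simp add: faithful_state_def positive_state_def)
  then have f: "free_selfadjoint_pair \<phi> a\<^sub>1 a\<^sub>2"
    using sa free by (simp add: free_selfadjoint_pair_def free_selfadjoint_pair_axioms_def)
  have m: "moment_distribution \<phi> a\<^sub>1 \<mu>\<^sub>1 M" "moment_distribution \<phi> a\<^sub>2 \<mu>\<^sub>2 M"
    "moment_distribution \<phi> (a\<^sub>1 + a\<^sub>2) \<mu> M"
    using st b mom sa by (simp_all add: moment_distribution_def moment_distribution_axioms_def adj_add)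
  fix z :: complex
  assume z: "Im z > 0"
  obtain \<omega>\<^sub>1 \<omega>\<^sub>2 where \<omega>: "Im \<omega>\<^sub>1 \<ge> Im z" "Im \<omega>\<^sub>2 \<ge> Im z"
    "cauchy_transform \<mu>\<^sub>1 \<omega>\<^sub>1 = cauchy_transform \<mu>\<^sub>2 \<omega>\<^sub>2"
    "\<omega>\<^sub>1 + \<omega>\<^sub>2 = z + 1 / cauchy_transform \<mu>\<^sub>1 \<omega>\<^sub>1"
    using subordination_fixed_point[OF b(1,2) z] .
  have "cauchy_transform \<mu> z = cauchy_transform \<mu>\<^sub>1 \<omega>\<^sub>1"
    by (rule free_subordination[OF f m z _ _ \<omega>(3,4)]) (use \<omega> z in auto)
  then show "\<exists>\<omega>\<^sub>1 \<omega>\<^sub>2. Im \<omega>\<^sub>1 > 0 \<and> Im \<omega>\<^sub>2 > 0 \<and>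
      cauchy_transform \<mu> z = cauchy_transform \<mu>\<^sub>1 \<omega>\<^sub>1 \<and> cauchy_transform \<mu> z = cauchy_transform \<mu>\<^sub>2 \<omega>\<^sub>2 \<and>
      \<omega>\<^sub>1 + \<omega>\<^sub>2 = z + 1 / cauchy_transform \<mu> z"
    using \<omega> z by (intro exI[of _ \<omega>\<^sub>1] exI[of _ \<omega>\<^sub>2]) auto
qed

theorem corollary3p9:
  fixes \<phi> :: "'a::cstar_algebra \<Rightarrow> complex"
    and a\<^sub>1 b\<^sub>1 a\<^sub>2 b\<^sub>2 :: 'a
    and \<eta>\<^sub>1 \<eta>\<^sub>2 \<eta> :: "(real \<times> real) measure"
    and z w :: "nat \<Rightarrow> complex"
  assumes "faithful_state \<phi>"
    and "selfadjoint_pair (a\<^sub>1, b\<^sub>1)" and "selfadjoint_pair (a\<^sub>2, b\<^sub>2)"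
    and "bipartite_pair (a\<^sub>1, b\<^sub>1)" and "bipartite_pair (a\<^sub>2, b\<^sub>2)"
    and "bi_free TYPE('x::state_space) TYPE('y::state_space) \<phi> (a\<^sub>1, b\<^sub>1) (a\<^sub>2, b\<^sub>2)"
    and "\<nexists>c. a\<^sub>1 = c *\<^sub>C 1" and "\<nexists>c. b\<^sub>1 = c *\<^sub>C 1"
    and "\<nexists>c. a\<^sub>2 = c *\<^sub>C 1" and "\<nexists>c. b\<^sub>2 = c *\<^sub>C 1"
    and "pair_distribution \<phi> (a\<^sub>1, b\<^sub>1) \<eta>\<^sub>1" and "pair_distribution \<phi> (a\<^sub>2, b\<^sub>2) \<eta>\<^sub>2"
    and "pair_distribution \<phi> (a\<^sub>1 + a\<^sub>2, b\<^sub>1 + b\<^sub>2) \<eta>"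
    and "\<And>n. z n \<in> upper_half_plane" and "\<And>n. w n \<in> upper_half_plane"
    and "filterlim (\<lambda>n. sqrt (Im (z n) * Im (w n)) * cmod (cauchy_transform2 \<eta> (z n) (w n)))
           at_top sequentially"
  shows "(unbounded_cauchy_transform (first_marginal \<eta>) \<or>
          unbounded_cauchy_transform (second_marginal \<eta>)) \<and>
         (\<exists>\<alpha> \<beta> :: real.
            measure (first_marginal \<eta>\<^sub>1) {\<alpha>} + measure (first_marginal \<eta>\<^sub>2) {\<beta>} \<ge> 1 \<or>
            measure (second_marginal \<eta>\<^sub>1) {\<alpha>} + measure (second_marginal \<eta>\<^sub>2) {\<beta>} \<ge> 1)"
proof -
  have sa: "a\<^sub>1\<^sup>\<star> = a\<^sub>1" "b\<^sub>1\<^sup>\<star> = b\<^sub>1" "a\<^sub>2\<^sup>\<star> = a\<^sub>2" "b\<^sub>2\<^sup>\<star> = b\<^sub>2"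
    using assms(2,3) by (simp_all add: selfadjoint_pair_def)
  have lin: "Vector_Spaces.linear (*\<^sub>C) (*) \<phi>" using assms(1) by (simp add: faithful_state_def)
  note free = bi_free_imp_free_pairs[OF lin assms(6)]
  obtain M1 where M1: "\<And>N. N \<ge> M1 \<Longrightarrow> bounded_distribution (first_marginal \<eta>\<^sub>1) N"
      "\<And>N. N \<ge> M1 \<Longrightarrow> bounded_distribution (second_marginal \<eta>\<^sub>1) N"
      "has_moments \<phi> a\<^sub>1 (first_marginal \<eta>\<^sub>1)" "has_moments \<phi> b\<^sub>1 (second_marginal \<eta>\<^sub>1)"
    using pair_distribution_marginals[OF assms(11)] by blast
  obtain M2 where M2: "\<And>N. N \<ge> M2 \<Longrightarrow> bounded_distribution (first_marginal \<eta>\<^sub>2) N"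
      "\<And>N. N \<ge> M2 \<Longrightarrow> bounded_distribution (second_marginal \<eta>\<^sub>2) N"
      "has_moments \<phi> a\<^sub>2 (first_marginal \<eta>\<^sub>2)" "has_moments \<phi> b\<^sub>2 (second_marginal \<eta>\<^sub>2)"
    using pair_distribution_marginals[OF assms(12)] by blast
  obtain M3 where M3: "\<And>N. N \<ge> M3 \<Longrightarrow> bounded_distribution (first_marginal \<eta>) N"
      "\<And>N. N \<ge> M3 \<Longrightarrow> bounded_distribution (second_marginal \<eta>) N"
      "has_moments \<phi> (a\<^sub>1 + a\<^sub>2) (first_marginal \<eta>)" "has_moments \<phi> (b\<^sub>1 + b\<^sub>2) (second_marginal \<eta>)"
    using pair_distribution_marginals[OF assms(13)] by blast
  define M where "M = max M1 (max M2 M3)"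
  have M: "M1 \<le> M" "M2 \<le> M" "M3 \<le> M" by (simp_all add: M_def)
  have zw: "Im (z n) > 0" "Im (w n) > 0" for n
    using assms(14,15)[of n] by (simp_all add: upper_half_plane_def)
  have unbounded: "unbounded_cauchy_transform (first_marginal \<eta>) \<or>
      unbounded_cauchy_transform (second_marginal \<eta>)"
  proof (rule ccontr)
    assume "\<not> ?thesis"
    then obtain B C where B: "\<And>v. Im v > 0 \<Longrightarrow> cmod (cauchy_transform (first_marginal \<eta>) v) \<le> B"
      and C: "\<And>v. Im v > 0 \<Longrightarrow> cmod (cauchy_transform (second_marginal \<eta>) v) \<le> C"
      unfolding unbounded_cauchy_transform_def bounded_iff upper_half_plane_def by auto
    have "sqrt (Im (z n) * Im (w n)) * cmod (cauchy_transform2 \<eta> (z n) (w n)) \<le> sqrt (B * C)" for n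
    proof -
      have "sqrt (Im (z n) * Im (w n)) * cmod (cauchy_transform2 \<eta> (z n) (w n))
          \<le> sqrt (cmod (cauchy_transform (first_marginal \<eta>) (z n))
              * cmod (cauchy_transform (second_marginal \<eta>) (w n)))"
        using assms(13) by (intro cauchy_transform2_bound[OF _ _ M3(1)[OF M(3)] M3(2)[OF M(3)] zw])
          (simp_all add: pair_distribution_def)
      also have "\<dots> \<le> sqrt (B * C)"
        \<comment> \<open>The monotonicity of the product needs B >= 0, which holds because B bounds
          a norm.\<close>
        by (intro real_sqrt_le_mono mult_mono B C zw order_trans[OF norm_ge_zero B[OF zw(1)]]) simp
      finally show ?thesis .
    qed
    moreover have "\<exists>n. sqrt (Im (z n) * Im (w n)) * cmod (cauchy_transform2 \<eta> (z n) (w n)) \<ge> sqrt (B * C) + 1"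
      using assms(16) by (auto simp: filterlim_at_top eventually_sequentially)
    ultimately show False by (smt (verit))
  qed
  moreover have "\<exists>\<alpha> \<beta>. measure (first_marginal \<eta>\<^sub>1) {\<alpha>} + measure (first_marginal \<eta>\<^sub>2) {\<beta>} \<ge> 1"
    if "unbounded_cauchy_transform (first_marginal \<eta>)"
    by (rule free_sum_atoms[OF assms(1) sa(1,3) free(1) M1(1)[OF M(1)] M2(1)[OF M(2)] M3(1)[OF M(3)]
          M1(3) M2(3) M3(3) that])
  moreover have "\<exists>\<alpha> \<beta>. measure (second_marginal \<eta>\<^sub>1) {\<alpha>} + measure (second_marginal \<eta>\<^sub>2) {\<beta>} \<ge> 1"
    if "unbounded_cauchy_transform (second_marginal \<eta>)"
    by (rule free_sum_atoms[OF assms(1) sa(2,4) free(2) M1(2)[OF M(1)] M2(2)[OF M(2)] M3(2)[OF M(3)]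
          M1(4) M2(4) M3(4) that])
  ultimately show ?thesis by blast
qed

end
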